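(* Let $n\ge1$ and let $$D=\{(z,w)\in\mathbb{C}^n\times\mathbb{C}:\ |w|^2<e^{-|z|^2}\}.$$ Then $D$ is a pseudoconvex domain in $\mathbb{C}^{n+1}$, and the holomorphic embedding $\iota:(\mathbb{C}^n,\omega_{eucl})\to(D,\omega_D)$, $\iota(z)=(z,0)$, is an isometric embedding (that is, $\iota^*\omega_D=\omega_{eucl}$) whose image $\mathbb{C}^n\times\{0\}$ is a totally geodesic complex submanifold of $(D,\omega_D)$, i.e. the second fundamental form of $\mathbb{C}^n\times\{0\}$ in $(D,\omega_D)$ is identically zero.
   Context: $\omega_{eucl}=\sqrt{-1}\,\partial\overline\partial|z|^2$ is the Euclidean metric of $\mathbb{C}^n$. $\omega_D=\sqrt{-1}\,\partial\overline\partial\log K_D$ is the Bergman metric of $D$, where $K_D=\sum_j|f_j|^2$ for an orthonormal basis $\{f_j\}$ of the Bergman space $A^2(D)$, the Hilbert space of holomorphic functions on $D$ that are square integrable with respect to Lebesgue measure. *)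

theory Defs
  imports "HOL-Analysis.Analysis"
begin

subsection \<open>Holomorphic functions and maps on open subsets of complex coordinate space\<close>

definition holo_fun_on :: "(complex^'m) set \<Rightarrow> (complex^'m \<Rightarrow> complex) \<Rightarrow> bool" where
  "holo_fun_on S f \<longleftrightarrow>
     (\<forall>p\<in>S. \<exists>f'. (f has_derivative f') (at p) \<and> (\<forall>c v. f' (c *s v) = c * f' v))"

definition holo_map_on :: "(complex^'m) set \<Rightarrow> (complex^'m \<Rightarrow> complex^'k) \<Rightarrow> bool" where
  "holo_map_on S f \<longleftrightarrow> (\<forall>k. holo_fun_on S (\<lambda>p. f p $ k))"

definition holomorphic_embedding :: "(complex^'m) set \<Rightarrow> (complex^'n \<Rightarrow> complex^'m) \<Rightarrow> bool" where
  "holomorphic_embedding D f \<longleftrightarrow>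
     holo_map_on UNIV f \<and> range f \<subseteq> D \<and>
     (\<forall>x. inj (frechet_derivative f (at x))) \<and>
     (\<exists>h. homeomorphism UNIV (range f) f h)"

text \<open>\<open>S\<close> is a \<open>d\<close>-dimensional (embedded) complex submanifold of the open set \<open>D\<close>: near each of its
  points some biholomorphic chart of \<open>D\<close> carries it to a coordinate subspace of dimension \<open>d\<close>.\<close>

definition complex_submanifold :: "(complex^'m) set \<Rightarrow> nat \<Rightarrow> (complex^'m) set \<Rightarrow> bool" where
  "complex_submanifold D d S \<longleftrightarrow>
     S \<subseteq> D \<and>
     (\<forall>p\<in>S. \<exists>U V \<phi> \<psi> I.
        open U \<and> p \<in> U \<and> U \<subseteq> D \<and> open V \<and>
        homeomorphism U V \<phi> \<psi> \<and> holo_map_on U \<phi> \<and> holo_map_on V \<psi> \<and>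
        card (UNIV - I) = d \<and>
        \<phi> ` (S \<inter> U) = V \<inter> {x :: complex^'m. \<forall>k\<in>I. x $ k = 0})"


subsection \<open>Pseudoconvexity\<close>

text \<open>Continuous real-valued plurisubharmonic functions: the sub-mean-value inequality on every
  closed complex disc contained in \<open>D\<close>.\<close>

definition continuous_psh_on :: "(complex^'m) set \<Rightarrow> (complex^'m \<Rightarrow> real) \<Rightarrow> bool" where
  "continuous_psh_on D u \<longleftrightarrow>
     continuous_on D u \<and>
     (\<forall>p v. (\<forall>\<zeta>. cmod \<zeta> \<le> 1 \<longrightarrow> p + \<zeta> *s v \<in> D) \<longrightarrow>
        u p \<le> 1 / (2 * pi) * integral {0..2*pi} (\<lambda>\<theta>. u (p + cis \<theta> *s v)))"

definition pseudoconvex_domain :: "(complex^'m) set \<Rightarrow> bool" where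
  "pseudoconvex_domain D \<longleftrightarrow>
     open D \<and> connected D \<and> D \<noteq> {} \<and>
     (\<exists>u. continuous_psh_on D u \<and> (\<forall>c. compact {p\<in>D. u p \<le> c}))"


subsection \<open>Bergman space and Bergman kernel\<close>

text \<open>Elements of the Bergman space are represented by total functions, whose values outside \<open>D\<close>
  play no role.\<close>

definition bergman_space :: "(complex^'m) set \<Rightarrow> (complex^'m \<Rightarrow> complex) set" where
  "bergman_space D =
     {f. holo_fun_on D f \<and> set_integrable lborel D (\<lambda>p. (cmod (f p))\<^sup>2)}"

definition bergman_inner ::
    "(complex^'m) set \<Rightarrow> (complex^'m \<Rightarrow> complex) \<Rightarrow> (complex^'m \<Rightarrow> complex) \<Rightarrow> complex" where
  "bergman_inner D f g = set_lebesgue_integral lborel D (\<lambda>p. f p * cnj (g p))"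

text \<open>Orthonormal (Hilbert) basis: orthonormal with dense linear span.\<close>

definition bergman_onb :: "(complex^'m) set \<Rightarrow> (complex^'m \<Rightarrow> complex) set \<Rightarrow> bool" where
  "bergman_onb D B \<longleftrightarrow>
     B \<subseteq> bergman_space D \<and>
     (\<forall>f\<in>B. \<forall>g\<in>B. bergman_inner D f g = (if f = g then 1 else 0)) \<and>
     (\<forall>h\<in>bergman_space D. \<forall>\<epsilon>>0. \<exists>F c. finite F \<and> F \<subseteq> B \<and>
        set_lebesgue_integral lborel D (\<lambda>p. (cmod (h p - (\<Sum>f\<in>F. c f * f p)))\<^sup>2) < \<epsilon>)"

text \<open>The sum is the same for every orthonormal basis, so the choice is immaterial on \<open>D\<close>.\<close>

definition bergman_kernel :: "(complex^'m) set \<Rightarrow> complex^'m \<Rightarrow> real" where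
  "bergman_kernel D p = (\<Sum>\<^sub>\<infinity>f\<in>(SOME B. bergman_onb D B). (cmod (f p))\<^sup>2)"


subsection \<open>Complex Hessian forms and the Bergman metric\<close>

definition wirtinger :: "'m \<Rightarrow> (complex^'m \<Rightarrow> complex) \<Rightarrow> complex^'m \<Rightarrow> complex" where
  "wirtinger k f p =
     (frechet_derivative f (at p) (axis k 1) - \<i> * frechet_derivative f (at p) (axis k \<i>)) / 2"

definition wirtinger_bar :: "'m \<Rightarrow> (complex^'m \<Rightarrow> complex) \<Rightarrow> complex^'m \<Rightarrow> complex" where
  "wirtinger_bar k f p =
     (frechet_derivative f (at p) (axis k 1) + \<i> * frechet_derivative f (at p) (axis k \<i>)) / 2"

text \<open>The (1,1)-form \<open>\<i> \<Sum> \<phi>\<^sub>a\<^sub>b dz\<^sub>a \<and> d(cnj z\<^sub>b)\<close>, with \<open>\<phi>\<^sub>a\<^sub>b\<close> the mixed second Wirtinger derivatives of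
  the potential, evaluated at \<open>p\<close> on the real tangent vectors \<open>u\<close>, \<open>v\<close>.\<close>

definition ddbar_form ::
    "(complex^'m \<Rightarrow> real) \<Rightarrow> complex^'m \<Rightarrow> complex^'m \<Rightarrow> complex^'m \<Rightarrow> complex" where
  "ddbar_form \<phi> p u v =
     \<i> * (\<Sum>a\<in>UNIV. \<Sum>b\<in>UNIV.
            wirtinger a (wirtinger_bar b (\<lambda>q. complex_of_real (\<phi> q))) p *
            (u $ a * cnj (v $ b) - v $ a * cnj (u $ b)))"

definition eucl_form :: "complex^'m \<Rightarrow> complex^'m \<Rightarrow> complex^'m \<Rightarrow> complex" where
  "eucl_form = ddbar_form (\<lambda>z. (norm z)\<^sup>2)"

definition bergman_form ::
    "(complex^'m) set \<Rightarrow> complex^'m \<Rightarrow> complex^'m \<Rightarrow> complex^'m \<Rightarrow> complex" where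
  "bergman_form D = ddbar_form (\<lambda>p. ln (bergman_kernel D p))"

definition pullback_form ::
    "(complex^'n \<Rightarrow> complex^'m) \<Rightarrow> (complex^'m \<Rightarrow> complex^'m \<Rightarrow> complex^'m \<Rightarrow> complex) \<Rightarrow>
     complex^'n \<Rightarrow> complex^'n \<Rightarrow> complex^'n \<Rightarrow> complex" where
  "pullback_form f \<omega> x u v =
     \<omega> (f x) (frechet_derivative f (at x) u) (frechet_derivative f (at x) v)"

text \<open>The metric \<open>g(u,v) = \<omega>(u, J v)\<close> of a real (1,1)-form.\<close>

definition metric_of_form ::
    "(complex^'m \<Rightarrow> complex^'m \<Rightarrow> complex^'m \<Rightarrow> complex) \<Rightarrow>
     complex^'m \<Rightarrow> complex^'m \<Rightarrow> complex^'m \<Rightarrow> real" where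
  "metric_of_form \<omega> p u v = Re (\<omega> p u (\<i> *s v))"


subsection \<open>Riemannian metrics on open sets and the second fundamental form of an immersion\<close>

primrec Ck_on :: "nat \<Rightarrow> 'a::euclidean_space set \<Rightarrow> ('a \<Rightarrow> 'b::euclidean_space) \<Rightarrow> bool" where
  "Ck_on 0 S f \<longleftrightarrow> continuous_on S f"
| "Ck_on (Suc k) S f \<longleftrightarrow>
     (\<forall>p\<in>S. f differentiable (at p)) \<and> (\<forall>v. Ck_on k S (\<lambda>p. frechet_derivative f (at p) v))"

definition smooth_on :: "'a::euclidean_space set \<Rightarrow> ('a \<Rightarrow> 'b::euclidean_space) \<Rightarrow> bool" where
  "smooth_on S f \<longleftrightarrow> (\<forall>k. Ck_on k S f)"

definition riemannian_metric_on ::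
    "'a::euclidean_space set \<Rightarrow> ('a \<Rightarrow> 'a \<Rightarrow> 'a \<Rightarrow> real) \<Rightarrow> bool" where
  "riemannian_metric_on D g \<longleftrightarrow>
     (\<forall>p\<in>D. bilinear (g p) \<and> (\<forall>u v. g p u v = g p v u) \<and> (\<forall>u. u \<noteq> 0 \<longrightarrow> g p u u > 0)) \<and>
     (\<forall>u v. smooth_on D (\<lambda>p. g p u v))"

text \<open>Christoffel symbols of the Levi-Civita connection: the Koszul formula for the constant (hence
  commuting) vector fields \<open>u\<close>, \<open>v\<close>, \<open>w\<close>.\<close>

definition christoffel ::
    "('a::euclidean_space \<Rightarrow> 'a \<Rightarrow> 'a \<Rightarrow> real) \<Rightarrow> 'a \<Rightarrow> 'a \<Rightarrow> 'a \<Rightarrow> 'a" where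
  "christoffel g p u v = (THE x. \<forall>w. 2 * g p x w =
       frechet_derivative (\<lambda>q. g q v w) (at p) u
     + frechet_derivative (\<lambda>q. g q u w) (at p) v
     - frechet_derivative (\<lambda>q. g q u v) (at p) w)"

text \<open>Levi-Civita covariant derivative at \<open>x\<close>, in direction \<open>u\<close>, of a vector field \<open>W\<close> along \<open>f\<close>.\<close>

definition cov_deriv_along ::
    "('a::euclidean_space \<Rightarrow> 'a \<Rightarrow> 'a \<Rightarrow> real) \<Rightarrow> ('b::euclidean_space \<Rightarrow> 'a) \<Rightarrow>
     'b \<Rightarrow> ('b \<Rightarrow> 'a) \<Rightarrow> 'b \<Rightarrow> 'a" where
  "cov_deriv_along g f u W x =
     frechet_derivative W (at x) u + christoffel g (f x) (frechet_derivative f (at x) u) (W x)"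

definition normal_part ::
    "('a::euclidean_space \<Rightarrow> 'a \<Rightarrow> 'a \<Rightarrow> real) \<Rightarrow> 'a \<Rightarrow> 'a set \<Rightarrow> 'a \<Rightarrow> 'a" where
  "normal_part g p T y = (THE \<nu>. (\<forall>t\<in>T. g p \<nu> t = 0) \<and> y - \<nu> \<in> T)"

text \<open>\<open>II(X,Y)\<close> is the normal part of \<open>\<nabla>\<^sub>X Y\<close>, for vector fields \<open>X\<close>, \<open>Y\<close> on the immersed manifold,
  which are pushed forward to tangent fields along \<open>f\<close>.\<close>

definition second_fundamental_form ::
    "('a::euclidean_space \<Rightarrow> 'a \<Rightarrow> 'a \<Rightarrow> real) \<Rightarrow> ('b::euclidean_space \<Rightarrow> 'a) \<Rightarrow>
     ('b \<Rightarrow> 'b) \<Rightarrow> ('b \<Rightarrow> 'b) \<Rightarrow> 'b \<Rightarrow> 'a" where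
  "second_fundamental_form g f X Y x =
     normal_part g (f x) (range (frechet_derivative f (at x)))
       (cov_deriv_along g f (X x) (\<lambda>y. frechet_derivative f (at y) (Y y)) x)"


subsection \<open>Coordinates on \<open>\<complex>\<^sup>n \<times> \<complex>\<close>\<close>

text \<open>\<open>\<complex>\<^sup>n\<^sup>+\<^sup>1\<close> is \<open>complex^('n option)\<close>: coordinate \<open>Some i\<close> is \<open>z\<^sub>i\<close>, coordinate \<open>None\<close> is \<open>w\<close>.\<close>

definition pt :: "complex^'n \<Rightarrow> complex \<Rightarrow> complex^('n option)" where
  "pt z w = (\<chi> k. case k of None \<Rightarrow> w | Some i \<Rightarrow> z $ i)"

end

theory Submission
  imports Defs "HOL-Complex_Analysis.Cauchy_Integral_Formula"
begin

text \<open>The domain \<open>D\<close> is the sublevel set \<open>rho < 1\<close> of \<open>rho (z, w) = |w|\<^sup>2 exp (|z|\<^sup>2)\<close>. Everything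
  follows from the form of its Bergman kernel on the diagonal,
  \<open>K (z, w) = exp (|z|\<^sup>2) P (rho (z, w))\<close>, where \<open>P t = \<Sum> t\<^sup>k / c\<^sub>k\<close> and \<open>c\<^sub>k\<close> is the integral
  of \<open>|w|\<close> to the power \<open>2k\<close> over \<open>D\<close> (lemma \<open>bergman_kernel_eq\<close>).

  To find \<open>K\<close>, average over circles: on \<open>D\<close>, the mean value property in \<open>z\<close> and Cauchy's formula
  in \<open>w\<close> show that a function of \<open>w\<close> alone reproduces the values of Bergman functions at
  \<open>(0, s)\<close> (\<open>reproducing_on_w_axis\<close>). The translations of \<open>\<complex>\<^sup>n\<close> lift to automorphisms
  \<open>(z, w) \<mapsto> (z + a, w exp (- \<langle>z, a\<rangle> - |a|\<^sup>2 / 2))\<close> of \<open>D\<close>, which carry every point to the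
  w-axis; the induced unitary operators transport the reproducing kernel (\<open>kern_reproducing\<close>).
  That \<open>K\<close> is the sum over an arbitrary orthonormal basis is Parseval's identity for the
  reproducing kernel. Since \<open>bergman_kernel\<close> chooses a basis, one must exist: orthonormalising
  the kernels at a dense sequence of points gives a family whose partial Fourier sums converge
  at every point, and Fatou's lemma turns this into convergence in norm (\<open>bergman_onb_exists\<close>).

  With \<open>F = ln P\<close>, differentiating \<open>ln K = |z|\<^sup>2 + F (rho)\<close> gives the Hermitian form
  \<open>(1 + t F') |dz|\<^sup>2 + exp (|z|\<^sup>2) (t F')' |dw + w \<langle>dz, z\<rangle>|\<^sup>2\<close> at \<open>t = rho\<close>. The first
  coefficient is at least 1, and the second is positive because \<open>t (t F')'\<close>, for \<open>t > 0\<close>, is the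
  variance of a nondegenerate distribution (\<open>qcoef_pos\<close>). On \<open>w = 0\<close> the form restricts to
  \<open>|dz|\<^sup>2\<close>, which is the isometry statement. Along this submanifold the derivatives of the
  metric that enter the Koszul formula for tangent vectors vanish, hence so does the second
  fundamental form (\<open>christoffel_on_axis\<close>).

  Pseudoconvexity is witnessed by the exhaustion \<open>|z|\<^sup>2 + 1 / (1 - rho)\<close>; on the boundary of any
  closed disc, \<open>rho\<close> is the squared modulus of an entire function, which yields the
  sub-mean-value inequality (\<open>psh_exhaustion\<close>).\<close>

unbundle no fps_syntax

section \<open>Linear changes of variables for Lebesgue measure\<close>

lemma basis_bij_isometry:
  fixes L :: "'a::euclidean_space \<Rightarrow> 'b::euclidean_space"
  assumes L: "linear L" and bij: "bij_betw L Basis Basis" and e: "e \<in> Basis"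
  shows "L x \<bullet> L e = x \<bullet> e"
proof -
  have "L x = L (\<Sum>b\<in>Basis. (x \<bullet> b) *\<^sub>R b)"
    by (simp add: euclidean_representation)
  also have "\<dots> = (\<Sum>b\<in>Basis. (x \<bullet> b) *\<^sub>R L b)"
    by (simp add: linear_sum[OF L] linear_scale[OF L])
  finally have "L x \<bullet> L e = (\<Sum>b\<in>Basis. (x \<bullet> b) * (L b \<bullet> L e))"
    by (simp add: inner_sum_left)
  also have "\<dots> = (\<Sum>b\<in>Basis. if b = e then x \<bullet> b else 0)"
  proof (rule sum.cong)
    fix b :: 'a assume b: "b \<in> Basis"
    have "L b \<in> Basis" "L e \<in> Basis" using bij b e by (auto simp: bij_betw_def)
    moreover have "L b = L e \<longleftrightarrow> b = e"
      using bij b e by (auto simp: bij_betw_def inj_on_def)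
    ultimately show "x \<bullet> b * (L b \<bullet> L e) = (if b = e then x \<bullet> b else 0)"
      by (simp add: inner_Basis)
  qed simp
  also have "\<dots> = x \<bullet> e" using e by simp
  finally show ?thesis .
qed

text \<open>A bijection between the orthonormal bases carries boxes to boxes with the same side lengths.
  This lets complex coordinate spaces be split into products, which is where Fubini applies.\<close>

lemma lborel_distr_basis_bij:
  fixes L :: "'a::euclidean_space \<Rightarrow> 'b::euclidean_space"
  assumes L: "linear L" and bij: "bij_betw L Basis Basis"
  shows "distr lborel borel L = lborel"
proof (rule lborel_eqI[symmetric])
  have meas: "L \<in> borel_measurable borel"
    using L by (intro borel_measurable_continuous_onI linear_continuous_on) (simp add: linear_conv_bounded_linear)
  fix l u :: 'b assume lu: "\<And>b. b \<in> Basis \<Longrightarrow> l \<bullet> b \<le> u \<bullet> b"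
  define l' u' where "l' = (\<Sum>e\<in>Basis. (l \<bullet> L e) *\<^sub>R e)" and "u' = (\<Sum>e\<in>Basis. (u \<bullet> L e) *\<^sub>R e)"
  have LB: "L e \<in> Basis" if "e \<in> Basis" for e using bij that by (auto simp: bij_betw_def)
  have l': "l' \<bullet> e = l \<bullet> L e" and u': "u' \<bullet> e = u \<bullet> L e" if "e \<in> Basis" for e
    using that by (simp_all add: l'_def u'_def inner_sum_left inner_Basis if_distrib sum.delta cong: if_cong)
  have img: "Basis = L ` Basis" using bij by (simp add: bij_betw_def)
  have "L -` box l u = box l' u'"
  proof (rule set_eqI)
    fix x
    have "L x \<in> box l u \<longleftrightarrow> (\<forall>e\<in>Basis. l \<bullet> L e < L x \<bullet> L e \<and> L x \<bullet> L e < u \<bullet> L e)"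
      unfolding mem_box by (subst img) simp
    also have "\<dots> \<longleftrightarrow> x \<in> box l' u'"
      unfolding mem_box by (simp add: l' u' basis_bij_isometry[OF L bij])
    finally show "x \<in> L -` box l u \<longleftrightarrow> x \<in> box l' u'" by simp
  qed
  then have "emeasure (distr lborel borel L) (box l u) = emeasure lborel (box l' u')"
    using meas by (simp add: emeasure_distr)
  also have "\<dots> = (\<Prod>e\<in>Basis. (u' - l') \<bullet> e)"
    using lu LB by (intro emeasure_lborel_box) (simp add: l' u')
  also have "(\<Prod>e\<in>Basis. (u' - l') \<bullet> e) = (\<Prod>e\<in>Basis. (u - l) \<bullet> L e)"
    by (intro prod.cong) (simp_all add: inner_diff_left l' u')
  also have "\<dots> = (\<Prod>b\<in>Basis. (u - l) \<bullet> b)"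
    by (rule prod.reindex_bij_betw[OF bij])
  finally show "emeasure (distr lborel borel L) (box l u) = ennreal (\<Prod>b\<in>Basis. (u - l) \<bullet> b)" .
qed simp

lemma borel_measurable_fst_shear:
  fixes A :: "'b::euclidean_space \<Rightarrow> 'a::euclidean_space"
  assumes A[measurable]: "A \<in> borel_measurable borel"
  shows "(\<lambda>(x, y). (x + A y, y)) \<in> borel_measurable borel"
proof -
  have "(\<lambda>(x, y). (x + A y, y)) \<in> borel \<Otimes>\<^sub>M borel \<rightarrow>\<^sub>M (borel \<Otimes>\<^sub>M borel :: ('a \<times> 'b) measure)"
    by measurable
  then show ?thesis unfolding borel_prod .
qed

lemma borel_measurable_snd_shear:
  fixes A :: "'a::euclidean_space \<Rightarrow> 'b::euclidean_space"
  assumes A[measurable]: "A \<in> borel_measurable borel"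
  shows "(\<lambda>(x, y). (x, y + A x)) \<in> borel_measurable borel"
proof -
  have "(\<lambda>(x, y). (x, y + A x)) \<in> borel \<Otimes>\<^sub>M borel \<rightarrow>\<^sub>M (borel \<Otimes>\<^sub>M borel :: ('a \<times> 'b) measure)"
    by measurable
  then show ?thesis unfolding borel_prod .
qed

lemma borel_measurable_swap:
  "(\<lambda>(x, y). (y, x)) \<in> borel_measurable (borel :: ('a::euclidean_space \<times> 'b::euclidean_space) measure)"
proof -
  have "(\<lambda>(x, y). (y, x)) \<in> borel \<Otimes>\<^sub>M borel \<rightarrow>\<^sub>M (borel \<Otimes>\<^sub>M borel :: ('b \<times> 'a) measure)"
    by measurable
  then show ?thesis unfolding borel_prod .
qed

text \<open>For fixed second coordinate a shear is a translation, so Fubini reduces the claim to translation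
  invariance.\<close>

lemma lborel_distr_fst_shear:
  fixes A :: "'b::euclidean_space \<Rightarrow> 'a::euclidean_space"
  assumes A[measurable]: "A \<in> borel_measurable borel"
  shows "distr lborel borel (\<lambda>(x, y). (x + A y, y)) = (lborel :: ('a \<times> 'b) measure)"
proof (rule measure_eqI)
  let ?S = "\<lambda>(x, y). (x + A y, y)"
  fix X :: "('a \<times> 'b) set" assume "X \<in> sets (distr lborel borel ?S)"
  then have X[measurable]: "X \<in> sets (borel \<Otimes>\<^sub>M borel)" by (simp only: borel_prod sets_distr)
  have Xb: "X \<in> sets borel"
    using X unfolding borel_prod .
  have mb: "?S \<in> lborel \<rightarrow>\<^sub>M (borel :: ('a \<times> 'b) measure)"
    using borel_measurable_fst_shear[OF A] by simp
  have "emeasure (distr lborel borel ?S) X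
      = (\<integral>\<^sup>+p. indicator X p \<partial>distr lborel borel ?S)"
    using Xb by (intro nn_integral_indicator[symmetric]) (simp only: sets_distr)
  also have "\<dots> = (\<integral>\<^sup>+p. indicator X (?S p) \<partial>lborel)"
    using Xb by (intro nn_integral_distr mb borel_measurable_indicator) simp
  also have "\<dots> = (\<integral>\<^sup>+p. indicator X (?S p) \<partial>(lborel \<Otimes>\<^sub>M lborel))"
    by (simp only: lborel_prod)
  also have "\<dots> = (\<integral>\<^sup>+y. \<integral>\<^sup>+x. indicator X (x + A y, y) \<partial>lborel \<partial>lborel)"
    using lborel_pair.nn_integral_snd[of "\<lambda>p. indicator X (?S p)"] by simp
  also have "\<dots> = (\<integral>\<^sup>+y. \<integral>\<^sup>+x. indicator X (x, y) \<partial>lborel \<partial>lborel)"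
  proof (rule nn_integral_cong)
    fix y
    have "(\<integral>\<^sup>+x. indicator X (x, y) \<partial>lborel) = (\<integral>\<^sup>+x. indicator X (x, y) \<partial>distr lborel borel ((+) (A y)))"
      by (simp only: lborel_distr_plus)
    also have "\<dots> = (\<integral>\<^sup>+x. indicator X (A y + x, y) \<partial>lborel)"
      by (subst nn_integral_distr) simp_all
    finally show "(\<integral>\<^sup>+x. indicator X (x + A y, y) \<partial>lborel) = (\<integral>\<^sup>+x. indicator X (x, y) \<partial>lborel)"
      by (simp add: add.commute)
  qed
  also have "\<dots> = emeasure (lborel \<Otimes>\<^sub>M lborel) X"
    using lborel_pair.nn_integral_snd[of "indicator X"] by simp
  finally show "emeasure (distr lborel borel ?S) X = emeasure lborel X"
    by (simp only: lborel_prod)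
qed (simp only: sets_distr sets_lborel)

lemma lborel_distr_swap:
  "distr lborel borel (\<lambda>(x, y). (y, x)) = (lborel :: ('a::euclidean_space \<times> 'b::euclidean_space) measure)"
proof (rule lborel_distr_basis_bij)
  show "linear (\<lambda>(x::'b, y::'a). (y, x))"
    by (auto intro!: linearI)
  show "bij_betw (\<lambda>(x::'b, y::'a). (y, x)) Basis Basis"
    by (rule bij_betwI[where g="\<lambda>(x, y). (y, x)"]) (auto simp: Basis_prod_def)
qed

lemma lborel_distr_comp:
  fixes f :: "'a::euclidean_space \<Rightarrow> 'b::euclidean_space" and g :: "'b \<Rightarrow> 'c::euclidean_space"
  assumes "distr lborel borel f = lborel" "distr lborel borel g = lborel"
    and "f \<in> borel_measurable borel" "g \<in> borel_measurable borel"
  shows "distr lborel borel (\<lambda>x. g (f x)) = lborel"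
  using distr_distr[of g borel borel f lborel] assms by (simp add: o_def)

lemma lborel_distr_snd_shear:
  fixes A :: "'a::euclidean_space \<Rightarrow> 'b::euclidean_space"
  assumes A[measurable]: "A \<in> borel_measurable borel"
  shows "distr lborel borel (\<lambda>(x, y). (x, y + A x)) = (lborel :: ('a \<times> 'b) measure)"
proof -
  let ?sw = "\<lambda>(x::'a, y::'b). (y, x)" and ?ws = "\<lambda>(x::'b, y::'a). (y, x)" and ?sh = "\<lambda>(x::'b, y::'a). (x + A y, y)"
  note m = borel_measurable_swap borel_measurable_fst_shear[OF A]
  have 1: "distr lborel borel (\<lambda>p. ?sh (?sw p)) = lborel"
    by (rule lborel_distr_comp[OF lborel_distr_swap lborel_distr_fst_shear[OF A] m])
  have "distr lborel borel (\<lambda>p. ?ws (?sh (?sw p))) = lborel"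
    by (rule lborel_distr_comp[OF 1 lborel_distr_swap measurable_compose[OF m] m(1)])
  then show ?thesis by (simp add: case_prod_unfold)
qed

definition vec_Complex :: "(real^'m) \<times> (real^'m) \<Rightarrow> complex^'m" where
  "vec_Complex p = (\<chi> k. Complex (fst p $ k) (snd p $ k))"

lemma lborel_distr_vec_Complex: "distr lborel borel vec_Complex = (lborel :: (complex^'m) measure)"
proof (rule lborel_distr_basis_bij)
  show "linear (vec_Complex :: _ \<Rightarrow> complex^'m)"
    by (auto intro!: linearI simp: vec_Complex_def vec_eq_iff complex_eq_iff)
  show "bij_betw vec_Complex Basis (Basis :: (complex^'m) set)"
  proof (rule bij_betwI[where g="\<lambda>x. (\<chi> k. Re (x $ k), \<chi> k. Im (x $ k))"])
    show "vec_Complex \<in> Basis \<rightarrow> (Basis :: (complex^'m) set)"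
    proof
      fix p :: "(real^'m) \<times> (real^'m)" assume "p \<in> Basis"
      then obtain k where "p = (axis k 1, 0) \<or> p = (0, axis k 1)"
        by (auto simp: Basis_prod_def Basis_vec_def)
      then have "vec_Complex p = axis k 1 \<or> vec_Complex p = axis k \<i>"
        by (auto simp: vec_Complex_def axis_def vec_eq_iff complex_eq_iff)
      then show "vec_Complex p \<in> Basis"
        by (auto simp: Basis_vec_def Basis_complex_def)
    qed
    show "(\<lambda>x. (\<chi> k. Re (x $ k), \<chi> k. Im (x $ k))) \<in> (Basis :: (complex^'m) set) \<rightarrow> Basis"
    proof
      fix p :: "complex^'m" assume "p \<in> Basis"
      then obtain k b where p: "p = axis k b" "b = 1 \<or> b = \<i>"
        by (auto simp: Basis_vec_def Basis_complex_def)
      then have "(\<chi> k. Re (p $ k), \<chi> k. Im (p $ k)) = (axis k (1::real), 0) \<or>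
          (\<chi> k. Re (p $ k), \<chi> k. Im (p $ k)) = (0, axis k (1::real))"
        by (auto simp: axis_def vec_eq_iff)
      then show "(\<chi> k. Re (p $ k), \<chi> k. Im (p $ k)) \<in> Basis"
        by (auto simp: Basis_prod_def Basis_vec_def)
    qed
  qed (auto simp: vec_Complex_def vec_eq_iff complex_eq_iff)
qed

text \<open>The classical factorisation of a plane rotation into shears. It breaks down for the half turn,
  where the shear factor \<open>(cos t - 1) / sin t\<close> becomes infinite.\<close>

lemma rotation_three_shears:
  fixes u :: complex
  assumes "cmod u = 1" "u \<noteq> -1"
  obtains a b where "\<And>x y. u * Complex x y = Complex (x + a * y + a * (y + b * (x + a * y))) (y + b * (x + a * y))"
proof
  define a where "a = (if Im u = 0 then 0 else (Re u - 1) / Im u)"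
  have n: "Re u * Re u + Im u * Im u = 1"
    using assms(1) by (metis cmod_power2 one_power2 power2_eq_square)
  show "u * Complex x y = Complex (x + a * y + a * (y + Im u * (x + a * y))) (y + Im u * (x + a * y))" for x y
  proof (cases "Im u = 0")
    case True
    then have "u = 1" using n assms(2) by (auto simp: complex_eq_iff square_eq_1_iff)
    then show ?thesis by (simp add: a_def complex_eq_iff)
  next
    case False
    have 1: "Im u * a = Re u - 1" using False by (simp add: a_def)
    have 2: "a + a + a * (Im u * a) = - Im u"
    proof -
      have "Im u * (a + a + a * (Im u * a)) = 2 * (Im u * a) + (Im u * a) * (Im u * a)"
        by (simp add: algebra_simps)
      also have "\<dots> = Re u * Re u - 1" unfolding 1 by (simp add: algebra_simps)
      also have "\<dots> = Im u * (- Im u)" using n by simp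
      finally show ?thesis using False by (simp only: mult_left_cancel[OF False])
    qed
    show ?thesis
      unfolding complex_eq_iff
    proof
      have "x + a * y + a * (y + Im u * (x + a * y)) = x * (1 + Im u * a) + y * (a + a + a * (Im u * a))"
        by (simp add: algebra_simps)
      also have "\<dots> = Re u * x - Im u * y" unfolding 2 using 1 by simp
      finally show "Re (u * Complex x y) = Re (Complex (x + a * y + a * (y + Im u * (x + a * y))) (y + Im u * (x + a * y)))" by simp
      have "y + Im u * (x + a * y) = y * (1 + Im u * a) + Im u * x" by (simp add: algebra_simps)
      then show "Im (u * Complex x y) = Im (Complex (x + a * y + a * (y + Im u * (x + a * y))) (y + Im u * (x + a * y)))"
        using 1 by (simp add: mult.commute)
    qed
  qed
qed

text \<open>All coordinates are rotated at once by three shears of \<open>\<real>\<^sup>m \<times> \<real>\<^sup>m\<close>. To avoid the half turn, each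
  rotation is performed as two rotations by the principal square root of its factor.\<close>

lemma lborel_distr_diag_unitary:
  fixes u :: "'m::finite \<Rightarrow> complex"
  assumes u: "\<And>k. cmod (u k) = 1"
  shows "distr lborel borel (\<lambda>p. \<chi> k. u k * p $ k) = (lborel :: (complex^'m) measure)"
proof -
  have meas: "(\<lambda>p::complex^'m. \<chi> k. v k * p $ k) \<in> borel_measurable borel" for v :: "'m \<Rightarrow> complex"
    by (intro borel_measurable_continuous_onI continuous_intros)
  have *: "distr lborel borel (\<lambda>p. \<chi> k. v k * p $ k) = (lborel :: (complex^'m) measure)"
    if v: "\<And>k. cmod (v k) = 1" "\<And>k. v k \<noteq> -1" for v :: "'m \<Rightarrow> complex"
  proof -
    have "\<exists>a b. \<forall>x y. v k * Complex x y = Complex (x + a * y + a * (y + b * (x + a * y))) (y + b * (x + a * y))" for k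
      by (rule rotation_three_shears[OF v]) blast
    then have "\<forall>k. \<exists>a b. \<forall>x y. v k * Complex x y = Complex (x + a * y + a * (y + b * (x + a * y))) (y + b * (x + a * y))"
      by blast
    from choice[OF this] obtain a where "\<forall>k. \<exists>b. \<forall>x y. v k * Complex x y =
        Complex (x + a k * y + a k * (y + b * (x + a k * y))) (y + b * (x + a k * y))" by blast
    from choice[OF this] obtain b where ab: "\<And>k x y. v k * Complex x y =
        Complex (x + a k * y + a k * (y + b k * (x + a k * y))) (y + b k * (x + a k * y))" by blast
    let ?A = "\<lambda>y::real^'m. \<chi> k. a k * y $ k" and ?B = "\<lambda>y::real^'m. \<chi> k. b k * y $ k"
    let ?S = "\<lambda>(x, y). (x + ?A y, y)" and ?T = "\<lambda>(x, y). (x, y + ?B x)"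
    have mA: "?A \<in> borel_measurable borel" and mB: "?B \<in> borel_measurable borel"
      by (intro borel_measurable_continuous_onI continuous_intros)+
    note S = lborel_distr_fst_shear[OF mA] and mS = borel_measurable_fst_shear[OF mA]
      and T = lborel_distr_snd_shear[OF mB] and mT = borel_measurable_snd_shear[OF mB]
    have mV: "vec_Complex \<in> borel_measurable (borel :: ((real^'m) \<times> (real^'m)) measure)"
      unfolding vec_Complex_def Complex_eq by (intro borel_measurable_continuous_onI continuous_intros)
    have ST: "distr lborel borel (\<lambda>p. ?S (?T (?S p))) = lborel"
      by (rule lborel_distr_comp[OF S lborel_distr_comp[OF T S mT mS] mS measurable_compose[OF mT mS]])
    have "distr lborel borel (\<lambda>p. vec_Complex (?S (?T (?S p)))) = (lborel :: (complex^'m) measure)"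
      by (rule lborel_distr_comp[OF ST lborel_distr_vec_Complex measurable_compose[OF mS measurable_compose[OF mT mS]] mV])
    moreover have "vec_Complex (?S (?T (?S p))) = (\<chi> k. v k * vec_Complex p $ k)" for p
      by (simp add: vec_Complex_def case_prod_unfold vec_eq_iff ab)
    ultimately have "distr lborel borel (\<lambda>p. (\<chi> k. v k * vec_Complex p $ k)) = (lborel :: (complex^'m) measure)"
      by simp
    moreover have "distr lborel borel (\<lambda>p. (\<chi> k. v k * vec_Complex p $ k))
        = distr (distr lborel borel vec_Complex) borel (\<lambda>p::complex^'m. (\<chi> k. v k * p $ k))"
      using mV meas[of v] by (simp add: distr_distr o_def)
    ultimately show ?thesis by (simp add: lborel_distr_vec_Complex)
  qed
  have r: "csqrt (u k) \<noteq> -1" "cmod (csqrt (u k)) = 1" for k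
  proof -
    show "csqrt (u k) \<noteq> -1" proof
      assume "csqrt (u k) = -1"
      then have "Re (csqrt (u k)) = -1" by simp
      then show False using Re_csqrt[of "u k"] by linarith
    qed
    show "cmod (csqrt (u k)) = 1" using u[of k] by (simp add: norm_csqrt)
  qed
  have sq: "distr lborel borel (\<lambda>p. \<chi> k. csqrt (u k) * p $ k) = (lborel :: (complex^'m) measure)"
    using r by (intro *) auto
  have "distr lborel borel (\<lambda>p. \<chi> k. csqrt (u k) * (\<chi> k. csqrt (u k) * p $ k) $ k) = (lborel :: (complex^'m) measure)"
    by (intro lborel_distr_comp[OF sq sq] meas)
  moreover have "(\<chi> k. csqrt (u k) * (\<chi> k. csqrt (u k) * p $ k) $ k) = (\<chi> k. u k * p $ k)" for p :: "complex^'m"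
    using power2_csqrt[of "u _"] by (simp add: vec_eq_iff mult.assoc[symmetric] power2_eq_square[symmetric])
  ultimately show ?thesis by simp
qed

text \<open>Multiplication by \<open>c\<close> is a dilation by the modulus of \<open>c\<close> followed by a rotation.\<close>

lemma lborel_complex_mult:
  fixes c :: complex assumes c: "c \<noteq> 0" and G[measurable]: "G \<in> borel_measurable borel"
  shows "(\<integral>\<^sup>+w. ennreal ((cmod c)\<^sup>2) * G (w * c) \<partial>lborel) = (\<integral>\<^sup>+w. G w \<partial>lborel)"
proof -
  \<comment> \<open>the rotation of \<open>\<complex>\<close> is obtained from the one of \<open>\<complex>\<^sup>1\<close>\<close>
  define u where "u = c / of_real (cmod c)"
  have u: "cmod u = 1" "c = of_real (cmod c) * u" using c by (simp_all add: u_def norm_divide)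
  have vec1: "distr lborel borel (\<lambda>p::complex^1. p $ 1) = lborel"
  proof (rule lborel_distr_basis_bij)
    show "linear (\<lambda>p::complex^1. p $ 1)" by (auto intro!: linearI)
    show "bij_betw (\<lambda>p::complex^1. p $ 1) Basis Basis"
      by (rule bij_betwI[where g="\<lambda>x. axis 1 x"]) (auto simp: Basis_vec_def axis_def vec_eq_iff)
  qed
  have mv: "(\<lambda>p::complex^1. p $ 1) \<in> borel_measurable borel" "(\<lambda>p::complex^1. \<chi> k. u * p $ k) \<in> borel_measurable borel"
    by (intro borel_measurable_continuous_onI continuous_intros)+
  have 1: "distr lborel borel (\<lambda>p::complex^1. (\<chi> k. u * p $ k) $ 1) = lborel"
    by (rule lborel_distr_comp[OF lborel_distr_diag_unitary vec1 mv(2,1)]) (rule u)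
  have "distr (distr lborel borel (\<lambda>p::complex^1. p $ 1)) borel ((*) u) = lborel"
    using mv 1 by (simp add: distr_distr o_def)
  then have rot: "distr lborel borel ((*) u) = lborel" by (simp add: vec1)
  have "(\<integral>\<^sup>+w. G w \<partial>lborel) = (\<integral>\<^sup>+w. G w \<partial>density (distr lborel borel (\<lambda>x. 0 + cmod c *\<^sub>R x)) (\<lambda>_. \<bar>cmod c\<bar>^DIM(complex)))"
    using lborel_affine[of "cmod c" "0::complex"] c by simp
  also have "\<dots> = (\<integral>\<^sup>+w. ennreal ((cmod c)\<^sup>2) * G (cmod c *\<^sub>R w) \<partial>lborel)"
    by (simp add: nn_integral_density nn_integral_distr)
  also have "\<dots> = (\<integral>\<^sup>+w. ennreal ((cmod c)\<^sup>2) * G (cmod c *\<^sub>R w) \<partial>distr lborel borel ((*) u))"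
    by (simp add: rot)
  also have "\<dots> = (\<integral>\<^sup>+w. ennreal ((cmod c)\<^sup>2) * G (cmod c *\<^sub>R (u * w)) \<partial>lborel)"
    by (subst nn_integral_distr) auto
  also have "\<dots> = (\<integral>\<^sup>+w. ennreal ((cmod c)\<^sup>2) * G (w * c) \<partial>lborel)"
    using u(2) by (intro nn_integral_cong) (metis mult.assoc mult.commute scaleR_conv_of_real)
  finally show ?thesis by simp
qed

lemma pt_nth [simp]: "pt z w $ None = w" "pt z w $ Some i = z $ i"
  by (simp_all add: pt_def)

lemma pt_collapse [simp]: "pt (\<chi> i. p $ Some i) (p $ None) = p"
  by (simp add: vec_eq_iff pt_def split: option.split)

lemma lborel_distr_pt: "distr lborel borel (\<lambda>(z::complex^'n, w). pt z w) = lborel"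
proof (rule lborel_distr_basis_bij)
  show "linear (\<lambda>(z::complex^'n, w). pt z w)"
    by (auto intro!: linearI simp: pt_def vec_eq_iff split: option.split)
  show "bij_betw (\<lambda>(z::complex^'n, w). pt z w) Basis Basis"
  proof (rule bij_betwI[where g="\<lambda>p. (\<chi> i. p $ Some i, p $ None)"])
    show "(\<lambda>(z::complex^'n, w). pt z w) \<in> Basis \<rightarrow> Basis"
    proof
      fix q :: "(complex^'n) \<times> complex" assume "q \<in> Basis"
      then obtain i b where b: "b \<in> Basis" "q = (axis i b, 0) \<or> q = (0, b)"
        by (auto simp: Basis_prod_def Basis_vec_def)
      then have "(\<lambda>(z, w). pt z w) q = axis (Some i) b \<or> (\<lambda>(z, w). pt z w) q = axis None b"
        by (auto simp: pt_def axis_def vec_eq_iff split: option.split)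
      then show "(\<lambda>(z, w). pt z w) q \<in> Basis"
        using b(1) by (auto simp: Basis_vec_def)
    qed
    show "(\<lambda>p. (\<chi> i. p $ Some i, p $ None)) \<in> Basis \<rightarrow> (Basis :: ((complex^'n) \<times> complex) set)"
    proof
      fix p :: "complex^('n option)" assume "p \<in> Basis"
      then obtain k b where p: "p = axis k b" "b \<in> Basis" by (auto simp: Basis_vec_def)
      show "(\<chi> i. p $ Some i, p $ None) \<in> (Basis :: ((complex^'n) \<times> complex) set)"
      proof (cases k)
        case None
        then have "(\<chi> i. p $ Some i, p $ None) = (0, b)" by (simp add: p axis_def vec_eq_iff)
        then show ?thesis using p by (simp add: Basis_prod_def)
      next
        case (Some i)
        then have "(\<chi> i. p $ Some i, p $ None) = (axis i b, 0)" by (auto simp: p axis_def vec_eq_iff)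
        then show ?thesis using p by (auto simp: Basis_prod_def Basis_vec_def)
      qed
    qed
  qed (auto simp: vec_eq_iff pt_def split: option.split)
qed

section \<open>Function spaces with a reproducing kernel\<close>

text \<open>The form \<open>ip\<close> is semidefinite rather than definite, because Bergman functions are total
  functions whose values outside the domain are invisible to the inner product.\<close>

locale kernel_space =
  fixes V :: "('p \<Rightarrow> complex) set" and ip :: "('p \<Rightarrow> complex) \<Rightarrow> ('p \<Rightarrow> complex) \<Rightarrow> complex"
    and X :: "'p set" and k :: "'p \<Rightarrow> 'p \<Rightarrow> complex"
  assumes zero_closed: "(\<lambda>x. 0) \<in> V"
    and add_closed: "f \<in> V \<Longrightarrow> g \<in> V \<Longrightarrow> (\<lambda>x. f x + g x) \<in> V"
    and scale_closed: "f \<in> V \<Longrightarrow> (\<lambda>x. c * f x) \<in> V"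
    and ip_add: "f \<in> V \<Longrightarrow> g \<in> V \<Longrightarrow> h \<in> V \<Longrightarrow> ip (\<lambda>x. f x + g x) h = ip f h + ip g h"
    and ip_scale: "f \<in> V \<Longrightarrow> g \<in> V \<Longrightarrow> ip (\<lambda>x. c * f x) g = c * ip f g"
    and ip_sym: "f \<in> V \<Longrightarrow> g \<in> V \<Longrightarrow> ip g f = cnj (ip f g)"
    and ip_nonneg: "f \<in> V \<Longrightarrow> 0 \<le> Re (ip f f)"
    and kernel_closed: "p \<in> X \<Longrightarrow> k p \<in> V"
    and reproducing: "h \<in> V \<Longrightarrow> p \<in> X \<Longrightarrow> ip h (k p) = h p"
begin

definition sqn :: "('p \<Rightarrow> complex) \<Rightarrow> real" where
  "sqn f = Re (ip f f)"

definition lincomb :: "('p \<Rightarrow> complex) set \<Rightarrow> (('p \<Rightarrow> complex) \<Rightarrow> complex) \<Rightarrow> 'p \<Rightarrow> complex" where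
  "lincomb F c = (\<lambda>x. \<Sum>f\<in>F. c f * f x)"

definition orthonormal :: "('p \<Rightarrow> complex) set \<Rightarrow> bool" where
  "orthonormal F \<longleftrightarrow> F \<subseteq> V \<and> (\<forall>f\<in>F. \<forall>g\<in>F. ip f g = (if f = g then 1 else 0))"

definition residual :: "('p \<Rightarrow> complex) set \<Rightarrow> ('p \<Rightarrow> complex) \<Rightarrow> 'p \<Rightarrow> complex" where
  "residual F h = (\<lambda>x. h x - lincomb F (ip h) x)"

lemma minus_closed: "f \<in> V \<Longrightarrow> g \<in> V \<Longrightarrow> (\<lambda>x. f x - g x) \<in> V"
  using add_closed[OF _ scale_closed[of g "-1"]] by simp

lemma ip_minus: "f \<in> V \<Longrightarrow> g \<in> V \<Longrightarrow> h \<in> V \<Longrightarrow> ip (\<lambda>x. f x - g x) h = ip f h - ip g h"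
  using ip_add[OF _ scale_closed[of g "-1"], of f h] ip_scale[of g h "-1"] by simp

lemma ip_minus_right: "f \<in> V \<Longrightarrow> g \<in> V \<Longrightarrow> h \<in> V \<Longrightarrow> ip h (\<lambda>x. f x - g x) = ip h f - ip h g"
  using ip_sym[OF minus_closed, of f g h] ip_sym[of f h] ip_sym[of g h] by (simp add: ip_minus)

lemma ip_scale_right: "f \<in> V \<Longrightarrow> g \<in> V \<Longrightarrow> ip g (\<lambda>x. c * f x) = cnj c * ip g f"
  using ip_sym[OF scale_closed, of f g c] ip_sym[of f g] by (simp add: ip_scale)

lemma lincomb_closed:
  assumes "finite F" "F \<subseteq> V" shows "lincomb F c \<in> V"
  using assms
proof (induction F rule: finite_induct)
  case empty then show ?case using zero_closed by (simp add: lincomb_def)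
next
  case (insert f F)
  then have "lincomb (insert f F) c = (\<lambda>x. (\<lambda>x. c f * f x) x + lincomb F c x)"
    by (simp add: lincomb_def)
  then show ?case using insert by (auto intro!: add_closed scale_closed)
qed

lemma ip_zero: "h \<in> V \<Longrightarrow> ip (\<lambda>x. 0) h = 0"
  using ip_scale[OF zero_closed, of h 0] by simp

lemma ip_lincomb:
  assumes "finite F" "F \<subseteq> V" "h \<in> V" shows "ip (lincomb F c) h = (\<Sum>f\<in>F. c f * ip f h)"
  using assms
proof (induction F rule: finite_induct)
  case empty then show ?case by (simp add: lincomb_def ip_zero)
next
  case (insert f F)
  then have "lincomb (insert f F) c = (\<lambda>x. (\<lambda>x. c f * f x) x + lincomb F c x)"
    by (simp add: lincomb_def)
  then have "ip (lincomb (insert f F) c) h = ip (\<lambda>x. (\<lambda>x. c f * f x) x + lincomb F c x) h" by simp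
  also have "\<dots> = ip (\<lambda>x. c f * f x) h + ip (lincomb F c) h"
    using insert.prems insert.hyps by (intro ip_add scale_closed lincomb_closed) auto
  finally show ?case using insert by (simp add: ip_scale)
qed

lemma ip_lincomb_right:
  assumes "finite F" "F \<subseteq> V" "h \<in> V" shows "ip h (lincomb F c) = (\<Sum>f\<in>F. cnj (c f) * ip h f)"
proof -
  have "ip h (lincomb F c) = cnj (ip (lincomb F c) h)"
    using assms by (intro ip_sym lincomb_closed)
  also have "\<dots> = (\<Sum>f\<in>F. cnj (c f) * cnj (ip f h))"
    using assms by (simp add: ip_lincomb)
  also have "\<dots> = (\<Sum>f\<in>F. cnj (c f) * ip h f)"
    using assms by (intro sum.cong refl arg_cong2[where f="(*)"] ip_sym[symmetric]) auto
  finally show ?thesis .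
qed

lemma orthonormal_subset: "orthonormal F \<Longrightarrow> G \<subseteq> F \<Longrightarrow> orthonormal G"
  unfolding orthonormal_def by blast

lemma sqn_nonneg: "f \<in> V \<Longrightarrow> 0 \<le> sqn f"
  by (simp add: sqn_def ip_nonneg)

lemma ip_self: "f \<in> V \<Longrightarrow> ip f f = of_real (sqn f)"
  using ip_sym[of f f] by (simp add: sqn_def complex_eq_iff)

lemma sqn_minus:
  assumes "f \<in> V" "g \<in> V"
  shows "sqn (\<lambda>x. f x - g x) = sqn f + sqn g - 2 * Re (ip f g)"
proof -
  have "ip (\<lambda>x. f x - g x) (\<lambda>x. f x - g x) = ip f f - ip f g - (ip g f - ip g g)"
    using assms by (simp add: ip_minus ip_minus_right minus_closed)
  then show ?thesis using ip_sym[OF assms] by (simp add: sqn_def)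
qed

lemma sqn_lincomb:
  assumes F: "finite F" "orthonormal F"
  shows "sqn (lincomb F c) = (\<Sum>f\<in>F. (cmod (c f))\<^sup>2)"
proof -
  have FV: "F \<subseteq> V" using F by (simp add: orthonormal_def)
  have "ip (lincomb F c) (lincomb F c) = (\<Sum>f\<in>F. c f * ip f (lincomb F c))"
    using F FV by (intro ip_lincomb lincomb_closed)
  also have "\<dots> = (\<Sum>f\<in>F. c f * (\<Sum>g\<in>F. cnj (c g) * (if f = g then 1 else 0)))"
    using F FV by (intro sum.cong refl) (auto simp: ip_lincomb_right orthonormal_def subset_iff intro!: sum.cong)
  also have "\<dots> = (\<Sum>f\<in>F. c f * cnj (c f))"
    using F by (intro sum.cong refl) (simp add: if_distrib sum.delta' cong: if_cong)
  finally show ?thesis unfolding sqn_def cmod_power2 by (simp add: power2_eq_square)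
qed

text \<open>Completing the square: the best coefficients are the Fourier coefficients, and Bessel's
  inequality is the special case where they are chosen.\<close>

lemma sqn_minus_lincomb:
  assumes F: "finite F" "orthonormal F" and h: "h \<in> V"
  shows "sqn (\<lambda>x. h x - lincomb F c x)
    = sqn h - (\<Sum>f\<in>F. (cmod (ip h f))\<^sup>2) + (\<Sum>f\<in>F. (cmod (c f - ip h f))\<^sup>2)"
proof -
  have FV: "F \<subseteq> V" using F by (simp add: orthonormal_def)
  have 2: "Re (ip h (lincomb F c)) = (\<Sum>f\<in>F. Re (cnj (c f) * ip h f))"
    using F FV h by (simp add: ip_lincomb_right)
  have 3: "(cmod (a - b))\<^sup>2 = (cmod a)\<^sup>2 - 2 * Re (cnj a * b) + (cmod b)\<^sup>2" for a b
    unfolding cmod_power2 by (simp add: power2_eq_square algebra_simps)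
  show ?thesis
    unfolding sqn_minus[OF h lincomb_closed[OF F(1) FV]] sqn_lincomb[OF F] 2 3
    by (simp add: sum.distrib sum_subtractf sum_distrib_left)
qed

lemma sqn_residual:
  assumes "finite F" "orthonormal F" "h \<in> V"
  shows "sqn (residual F h) = sqn h - (\<Sum>f\<in>F. (cmod (ip h f))\<^sup>2)"
  unfolding residual_def using sqn_minus_lincomb[OF assms, of "ip h"] by simp

lemma residual_closed:
  assumes "finite F" "orthonormal F" "h \<in> V" shows "residual F h \<in> V"
  unfolding residual_def using assms by (intro minus_closed lincomb_closed) (auto simp: orthonormal_def)

lemma ip_residual:
  assumes F: "finite F" "orthonormal F" and h: "h \<in> V" and f: "f \<in> F"
  shows "ip (residual F h) f = 0"
proof -
  have FV: "F \<subseteq> V" using F by (simp add: orthonormal_def)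
  have "ip (residual F h) f = ip h f - (\<Sum>g\<in>F. ip h g * ip g f)"
    unfolding residual_def using F FV h f by (subst ip_minus) (auto simp: ip_lincomb lincomb_closed subset_iff)
  also have "(\<Sum>g\<in>F. ip h g * ip g f) = (\<Sum>g\<in>F. if g = f then ip h g else 0)"
    using F f by (intro sum.cong) (auto simp: orthonormal_def)
  finally show ?thesis using F f by simp
qed

lemma bessel:
  assumes "finite F" "orthonormal F" "h \<in> V"
  shows "(\<Sum>f\<in>F. (cmod (ip h f))\<^sup>2) \<le> sqn h"
  using sqn_residual[OF assms] sqn_nonneg[OF residual_closed[OF assms]] by simp

lemma cauchy_schwarz:
  assumes f: "f \<in> V" and g: "g \<in> V" shows "(cmod (ip f g))\<^sup>2 \<le> sqn f * sqn g"
proof -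
  let ?a = "ip f g"
  have q: "0 \<le> sqn f + t\<^sup>2 * (cmod ?a)\<^sup>2 * sqn g - 2 * t * (cmod ?a)\<^sup>2" for t :: real
  proof -
    let ?c = "of_real t * ?a"
    have "sqn (\<lambda>x. ?c * g x) = (cmod ?c)\<^sup>2 * sqn g"
    proof -
      have "ip (\<lambda>x. ?c * g x) (\<lambda>x. ?c * g x) = (?c * cnj ?c) * of_real (sqn g)"
        unfolding ip_scale[OF g scale_closed[OF g]] ip_scale_right[OF g g] ip_self[OF g] by (simp only: mult.assoc)
      also have "?c * cnj ?c = of_real ((cmod ?c)\<^sup>2)"
        by (rule complex_norm_square[symmetric])
      finally show ?thesis unfolding sqn_def by (simp only: Re_complex_of_real flip: of_real_mult)
    qed
    moreover have "Re (ip f (\<lambda>x. ?c * g x)) = t * (cmod ?a)\<^sup>2"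
      unfolding ip_scale_right[OF g f] cmod_power2 by (simp add: power2_eq_square algebra_simps)
    ultimately show ?thesis
      using sqn_nonneg[OF minus_closed[OF f scale_closed[OF g, of ?c]]]
      by (simp add: sqn_minus f g scale_closed norm_mult power_mult_distrib)
  qed
  show ?thesis
  proof (cases "sqn g = 0")
    case True
    have "cmod ?a = 0"
    proof (rule ccontr)
      assume a: "cmod ?a \<noteq> 0"
      have "0 \<le> sqn f - 2 * ((sqn f + 1) / (2 * (cmod ?a)\<^sup>2)) * (cmod ?a)\<^sup>2"
        using q[of "(sqn f + 1) / (2 * (cmod ?a)\<^sup>2)"] True by simp
      then show False using a by (simp add: field_simps)
    qed
    then show ?thesis using True by simp
  next
    case False
    then have g0: "sqn g > 0" using sqn_nonneg[OF g] by simp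
    have "0 \<le> sqn f - (cmod ?a)\<^sup>2 / sqn g"
      using q[of "1 / sqn g"] g0 by (simp add: power2_eq_square field_simps)
    then show ?thesis using g0 by (simp add: field_simps)
  qed
qed

lemma sqn_kernel: "p \<in> X \<Longrightarrow> sqn (k p) = Re (k p p)"
  by (simp add: sqn_def reproducing kernel_closed)

text \<open>The Fourier coefficient of \<open>k p\<close> at a basis element \<open>f\<close> is the conjugate of \<open>f p\<close>, so this is
  Parseval's identity for \<open>k p\<close>. In particular the sum does not depend on the basis.\<close>

lemma orthonormal_basis_has_sum_kernel:
  assumes B: "orthonormal B"
    and dense: "\<And>h \<epsilon>. h \<in> V \<Longrightarrow> \<epsilon> > 0 \<Longrightarrow> \<exists>F c. finite F \<and> F \<subseteq> B \<and> sqn (\<lambda>x. h x - lincomb F c x) < \<epsilon>"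
    and p: "p \<in> X"
  shows "((\<lambda>f. (cmod (f p))\<^sup>2) has_sum sqn (k p)) B"
proof -
  have val: "cmod (f p) = cmod (ip (k p) f)" if "f \<in> B" for f
  proof -
    have fV: "f \<in> V" using that B by (auto simp: orthonormal_def)
    show ?thesis using ip_sym[OF fV kernel_closed[OF p]] reproducing[OF fV p] by simp
  qed
  have sumval: "(\<Sum>f\<in>F. (cmod (f p))\<^sup>2) = (\<Sum>f\<in>F. (cmod (ip (k p) f))\<^sup>2)" if "F \<subseteq> B" for F
    using that by (intro sum.cong) (auto simp: val)
  show ?thesis
    unfolding has_sum_def
  proof (rule order_tendstoI)
    fix a assume "a < sqn (k p)"
    then obtain F c where F: "finite F" "F \<subseteq> B" "sqn (\<lambda>x. k p x - lincomb F c x) < sqn (k p) - a"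
      using dense[OF kernel_closed[OF p], of "sqn (k p) - a"] by auto
    have "sqn (k p) - (\<Sum>f\<in>F. (cmod (ip (k p) f))\<^sup>2) \<le> sqn (\<lambda>x. k p x - lincomb F c x)"
      unfolding sqn_minus_lincomb[OF F(1) orthonormal_subset[OF B F(2)] kernel_closed[OF p]]
      by (simp add: sum_nonneg)
    then have aF: "a < (\<Sum>f\<in>F. (cmod (f p))\<^sup>2)" using F sumval by simp
    show "\<forall>\<^sub>F Y in finite_subsets_at_top B. a < (\<Sum>f\<in>Y. (cmod (f p))\<^sup>2)"
      unfolding eventually_finite_subsets_at_top
    proof (intro exI[of _ F] conjI allI impI)
      fix Y assume Y: "finite Y \<and> F \<subseteq> Y \<and> Y \<subseteq> B"
      then have "(\<Sum>f\<in>F. (cmod (f p))\<^sup>2) \<le> (\<Sum>f\<in>Y. (cmod (f p))\<^sup>2)" by (intro sum_mono2) auto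
      then show "a < (\<Sum>f\<in>Y. (cmod (f p))\<^sup>2)" using aF by simp
    qed (use F in auto)
  next
    fix a assume a: "sqn (k p) < a"
    have "(\<Sum>f\<in>Y. (cmod (f p))\<^sup>2) < a" if "finite Y \<and> Y \<subseteq> B" for Y
      using bessel[OF _ orthonormal_subset[OF B] kernel_closed[OF p], of Y] that a sumval[of Y] by simp
    then show "\<forall>\<^sub>F Y in finite_subsets_at_top B. (\<Sum>f\<in>Y. (cmod (f p))\<^sup>2) < a"
      unfolding eventually_finite_subsets_at_top by (intro exI[of _ "{}"]) auto
  qed
qed

text \<open>If \<open>x\<close> has a residual of positive norm, the normalised residual is the new element. Otherwise
  \<open>x\<close> is in the span up to a null function and nothing is added.\<close>

lemma gram_schmidt_step:
  assumes E: "finite E" "orthonormal E" and x: "x \<in> V"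
  shows "\<exists>E'. finite E' \<and> orthonormal E' \<and> E \<subseteq> E' \<and> sqn (residual E' x) = 0"
proof (cases "sqn (residual E x) = 0")
  case True then show ?thesis using E by blast
next
  case False
  define r where "r = residual E x"
  have r: "r \<in> V" unfolding r_def using assms by (rule residual_closed)
  have r0: "sqn r > 0" using False sqn_nonneg[OF r] by (simp add: r_def)
  define e where "e = (\<lambda>q. of_real (1 / sqrt (sqn r)) * r q)"
  have eV: "e \<in> V" unfolding e_def using r by (rule scale_closed)
  have EV: "E \<subseteq> V" using E by (simp add: orthonormal_def)
  have eE: "ip e f = 0" "ip f e = 0" if "f \<in> E" for f
  proof -
    have fV: "f \<in> V" using that EV by auto
    show "ip e f = 0"
      unfolding e_def ip_scale[OF r fV] using ip_residual[OF E x that] by (simp add: r_def)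
    then show "ip f e = 0" using ip_sym[OF eV fV] by simp
  qed
  have xe: "ip x e = of_real (sqrt (sqn r))"
  proof -
    have "ip x r - ip (lincomb E (ip x)) r = ip r r"
      using E x EV r unfolding r_def by (subst (3) residual_def) (simp add: ip_minus lincomb_closed)
    moreover have "ip (lincomb E (ip x)) r = 0"
    proof -
      have "ip f r = 0" if "f \<in> E" for f
        using ip_sym[OF r, of f] ip_residual[OF E x that] that EV by (auto simp: r_def)
      then show ?thesis using E EV r by (simp add: ip_lincomb)
    qed
    ultimately have "ip x r = of_real (sqn r)" using ip_self[OF r] by simp
    then show ?thesis
      unfolding e_def ip_scale_right[OF r x] using r0
      by (simp add: real_div_sqrt flip: of_real_divide of_real_mult)
  qed
  have ee: "ip e e = 1"
    unfolding e_def ip_scale[OF r scale_closed[OF r]] ip_scale_right[OF r r] ip_self[OF r] using r0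
    by (simp flip: of_real_mult of_real_divide)
  have "e \<notin> E" using eE(1) ee by fastforce
  have o: "orthonormal (insert e E)"
    using E eV eE ee \<open>e \<notin> E\<close> by (auto simp: orthonormal_def)
  have "sqn (residual (insert e E) x) = sqn (residual E x) - (cmod (ip x e))\<^sup>2"
    using E x o \<open>e \<notin> E\<close> by (simp add: sqn_residual)
  also have "\<dots> = 0" using r0 unfolding xe by (simp add: r_def)
  finally show ?thesis using E o by (intro exI[of _ "insert e E"]) auto
qed

lemma gram_schmidt:
  assumes x: "\<And>i. x i \<in> V"
  obtains E :: "nat \<Rightarrow> ('p \<Rightarrow> complex) set"
  where "\<And>i. finite (E i)" "\<And>i. orthonormal (E i)" "\<And>i. E i \<subseteq> E (Suc i)"
    "\<And>i. sqn (residual (E (Suc i)) (x i)) = 0"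
proof -
  have "\<exists>E. \<forall>n. (finite (E n) \<and> orthonormal (E n)) \<and> (E n \<subseteq> E (Suc n) \<and> sqn (residual (E (Suc n)) (x n)) = 0)"
  proof (rule dependent_nat_choice)
    show "\<exists>E. finite E \<and> orthonormal E" by (intro exI[of _ "{}"]) (simp add: orthonormal_def)
    fix E n assume "finite E \<and> orthonormal E"
    then show "\<exists>E'. (finite E' \<and> orthonormal E') \<and> E \<subseteq> E' \<and> sqn (residual E' (x n)) = 0"
      using gram_schmidt_step[OF _ _ x] by blast
  qed
  then show ?thesis using that by blast
qed

lemma residual_diff:
  assumes F: "finite F" "orthonormal F" and G: "G \<subseteq> F"
  shows "sqn (\<lambda>x. residual G h x - residual F h x) = (\<Sum>f\<in>F. (cmod (ip h f))\<^sup>2) - (\<Sum>f\<in>G. (cmod (ip h f))\<^sup>2)"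
proof -
  have "(\<lambda>x. residual G h x - residual F h x) = lincomb (F - G) (ip h)"
    unfolding residual_def lincomb_def by (simp add: fun_eq_iff sum_diff[OF F(1) G])
  moreover have "finite (F - G)" "orthonormal (F - G)"
    using F orthonormal_subset[OF F(2)] by auto
  ultimately show ?thesis
    by (simp only: sqn_lincomb sum_diff[OF F(1) G])
qed

text \<open>Orthonormalise countably many kernels whose points are dense. A residual \<open>h - \<Sum>\<langle>h,e\<rangle> e\<close> is
  orthogonal to the kernels used so far, hence vanishes at their points; as its norm is bounded
  and \<open>k q\<close> is approximated by these kernels, it tends to zero at every point. By Bessel the
  residuals also form a Cauchy sequence in norm. With Fatou's lemma these two facts will give
  norm convergence to zero.\<close>

lemma dense_kernels_chain:
  fixes p :: "nat \<Rightarrow> 'p"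
  assumes pX: "\<And>i. p i \<in> X"
    and approx: "\<And>q \<epsilon>. q \<in> X \<Longrightarrow> \<epsilon> > 0 \<Longrightarrow> \<exists>i. sqn (\<lambda>x. k q x - k (p i) x) < \<epsilon>"
  obtains E :: "nat \<Rightarrow> ('p \<Rightarrow> complex) set"
  where "\<And>i. finite (E i)" "\<And>i. orthonormal (E i)" "\<And>i j. i \<le> j \<Longrightarrow> E i \<subseteq> E j"
    "\<And>h q. h \<in> V \<Longrightarrow> q \<in> X \<Longrightarrow> (\<lambda>i. residual (E i) h q) \<longlonglongrightarrow> 0"
    "\<And>h \<epsilon>. h \<in> V \<Longrightarrow> \<epsilon> > 0 \<Longrightarrow> \<exists>j. \<forall>i\<ge>j. sqn (\<lambda>x. residual (E j) h x - residual (E i) h x) < \<epsilon>"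
proof -
  obtain E where E: "\<And>i. finite (E i)" "\<And>i. orthonormal (E i)" "\<And>i. E i \<subseteq> E (Suc i)"
    "\<And>i. sqn (residual (E (Suc i)) (k (p i))) = 0"
    using gram_schmidt[of "\<lambda>i. k (p i)"] kernel_closed pX by blast
  have mono: "E i \<subseteq> E j" if "i \<le> j" for i j
    using lift_Suc_mono_le[of E, OF _ that] E(3) by blast
  have rV: "residual (E i) h \<in> V" if "h \<in> V" for i h
    using that E by (intro residual_closed)
  have r_le: "sqn (residual (E i) h) \<le> sqn h" if "h \<in> V" for i h
    unfolding sqn_residual[OF E(1,2) that] by (simp add: sum_nonneg)
  \<comment> \<open>orthogonality to the kernels already used means vanishing at their points\<close>
  have zero: "residual (E i) h (p j) = 0" if h: "h \<in> V" and ij: "j < i" for i j h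
  proof -
    let ?r = "residual (E i) h" and ?K = "k (p j)"
    let ?S = "lincomb (E (Suc j)) (ip ?K)"
    have KV: "?K \<in> V" by (rule kernel_closed[OF pX])
    have SV: "?S \<in> V" using E by (intro lincomb_closed) (auto simp: orthonormal_def)
    have "(cmod (ip ?r (residual (E (Suc j)) ?K)))\<^sup>2 \<le> sqn ?r * sqn (residual (E (Suc j)) ?K)"
      by (rule cauchy_schwarz[OF rV[OF h] rV[OF KV]])
    then have "ip ?r (residual (E (Suc j)) ?K) = 0" by (simp add: E(4))
    moreover have "ip ?r ?S = 0"
    proof -
      have "E (Suc j) \<subseteq> E i" using ij by (intro mono) simp
      then have "ip ?r f = 0" if "f \<in> E (Suc j)" for f
        using ip_residual[OF E(1,2) h] that by blast
      moreover have "E (Suc j) \<subseteq> V" using E(2) by (simp add: orthonormal_def)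
      ultimately show ?thesis using E(1) rV[OF h] by (simp add: ip_lincomb_right)
    qed
    ultimately have "ip ?r ?K = 0"
      using ip_minus_right[OF KV SV rV[OF h]] by (simp add: residual_def[of "E (Suc j)"])
    then show ?thesis using reproducing[OF rV[OF h] pX] by simp
  qed
  have lim: "(\<lambda>i. residual (E i) h q) \<longlonglongrightarrow> 0" if h: "h \<in> V" and q: "q \<in> X" for h q
  proof (rule LIMSEQ_I)
    fix \<epsilon> :: real assume e: "\<epsilon> > 0"
    define \<delta> where "\<delta> = \<epsilon>\<^sup>2 / (sqn h + 1)"
    have \<delta>: "\<delta> > 0" using e sqn_nonneg[OF h] by (simp add: \<delta>_def)
    obtain j where j: "sqn (\<lambda>x. k q x - k (p j) x) < \<delta>" using approx[OF q \<delta>] by blast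
    have dV: "(\<lambda>x. k q x - k (p j) x) \<in> V" by (intro minus_closed kernel_closed q pX)
    have "cmod (residual (E i) h q) < \<epsilon>" if i: "j < i" for i
    proof -
      have "ip (residual (E i) h) (\<lambda>x. k q x - k (p j) x) = residual (E i) h q"
        using rV[OF h, of i] by (simp add: ip_minus_right kernel_closed q pX reproducing zero[OF h i])
      then have "(cmod (residual (E i) h q))\<^sup>2 \<le> sqn (residual (E i) h) * sqn (\<lambda>x. k q x - k (p j) x)"
        using cauchy_schwarz[OF rV[OF h, of i] dV] by simp
      also have "\<dots> \<le> sqn h * sqn (\<lambda>x. k q x - k (p j) x)"
        by (intro mult_right_mono r_le h sqn_nonneg dV)
      also have "\<dots> \<le> sqn h * \<delta>" using j sqn_nonneg[OF h] by (intro mult_left_mono) auto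
      also have "\<dots> < \<epsilon>\<^sup>2" using e sqn_nonneg[OF h] by (simp add: \<delta>_def field_simps)
      finally show ?thesis using e by (simp add: power2_less_imp_less)
    qed
    then show "\<exists>n0. \<forall>n\<ge>n0. norm (residual (E n) h q - 0) < \<epsilon>"
      by (intro exI[of _ "Suc j"]) (simp add: Suc_le_eq)
  qed
  have cauchy: "\<exists>j. \<forall>i\<ge>j. sqn (\<lambda>x. residual (E j) h x - residual (E i) h x) < \<epsilon>"
    if h: "h \<in> V" and e: "\<epsilon> > 0" for h \<epsilon>
  proof -
    \<comment> \<open>the norms of differences are differences of a bounded increasing sequence\<close>
    define s where "s i = (\<Sum>f\<in>E i. (cmod (ip h f))\<^sup>2)" for i
    have "incseq s" unfolding s_def incseq_def using mono E(1) by (auto intro!: sum_mono2)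
    moreover have "\<forall>i. s i \<le> sqn h" unfolding s_def using bessel[OF E(1,2) h] by blast
    ultimately obtain L where "s \<longlonglongrightarrow> L" using incseq_convergent by blast
    then have "Cauchy s" by (rule LIMSEQ_imp_Cauchy)
    then obtain j where "\<forall>m\<ge>j. \<forall>n\<ge>j. dist (s m) (s n) < \<epsilon>"
      using e unfolding Cauchy_def by blast
    then have "\<forall>i\<ge>j. dist (s i) (s j) < \<epsilon>" by simp
    then show ?thesis
      using residual_diff[OF E(1,2) mono] by (intro exI[of _ j]) (auto simp: s_def dist_real_def)
  qed
  show ?thesis by (rule that[OF E(1,2) mono lim cauchy])
qed

end

section \<open>The Hartogs domain and its automorphisms\<close>

definition zpart :: "complex^('n::finite option) \<Rightarrow> complex^'n" where
  "zpart p = (\<chi> i. p $ Some i)"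

definition hinner :: "complex^'n::finite \<Rightarrow> complex^'n \<Rightarrow> complex" where
  "hinner z a = (\<Sum>i\<in>UNIV. z $ i * cnj (a $ i))"

text \<open>The domain is the sublevel set of this function, and the Bergman kernel depends on the point
  through it and \<open>|z|\<^sup>2\<close> only.\<close>

definition rho :: "complex^('n::finite option) \<Rightarrow> real" where
  "rho p = (cmod (p $ None))\<^sup>2 * exp ((norm (zpart p))\<^sup>2)"

definition hartogs :: "(complex^('n::finite option)) set" where
  "hartogs = {p. rho p < 1}"

text \<open>The translation \<open>z \<mapsto> z + a\<close> lifts to the automorphism \<open>shift a\<close> of the domain when \<open>w\<close> is
  multiplied by this factor, as in the Weyl representation on the Fock space. The factor is also
  the complex Jacobian determinant of the lift.\<close>

definition shift_factor :: "complex^'n::finite \<Rightarrow> complex^'n \<Rightarrow> complex" where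
  "shift_factor a z = exp (- hinner z a - of_real ((norm a)\<^sup>2 / 2))"

definition shift :: "complex^'n::finite \<Rightarrow> complex^('n option) \<Rightarrow> complex^('n option)" where
  "shift a p = pt (zpart p + a) (p $ None * shift_factor a (zpart p))"

lemma zpart_pt [simp]: "zpart (pt z w) = z"
  by (simp add: zpart_def)

lemma zpart_nth [simp]: "zpart p $ i = p $ Some i"
  by (simp add: zpart_def)

lemma pt_zpart [simp]: "pt (zpart p) (p $ None) = p"
  by (simp add: zpart_def)

lemma zpart_add: "zpart (p + q) = zpart p + zpart q" and zpart_scaleR: "zpart (r *\<^sub>R p) = r *\<^sub>R zpart p"
  and zpart_zero [simp]: "zpart 0 = 0"
  by (simp_all add: vec_eq_iff)

lemma norm_sq_vec: "(norm (z :: complex^'n::finite))\<^sup>2 = (\<Sum>i\<in>UNIV. (cmod (z $ i))\<^sup>2)"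
  by (simp add: norm_vec_def L2_set_def sum_nonneg)

lemma hinner_self: "hinner z z = of_real ((norm z)\<^sup>2)"
  unfolding hinner_def norm_sq_vec of_real_sum by (simp only: complex_norm_square)

lemma hinner_add_left: "hinner (z + y) a = hinner z a + hinner y a"
  by (simp add: hinner_def sum.distrib distrib_right)

lemma hinner_add_right: "hinner a (z + y) = hinner a z + hinner a y"
  by (simp add: hinner_def sum.distrib distrib_left)

lemma hinner_cnj: "cnj (hinner z a) = hinner a z"
  by (simp add: hinner_def mult.commute)

lemma hinner_0 [simp]: "hinner 0 a = 0" "hinner a 0 = 0"
  by (simp_all add: hinner_def)

lemma norm_sq_add: "(norm (z + a :: complex^'n::finite))\<^sup>2 = (norm z)\<^sup>2 + 2 * Re (hinner z a) + (norm a)\<^sup>2"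
proof -
  have "of_real ((norm (z + a))\<^sup>2) = hinner z z + (hinner z a + cnj (hinner z a)) + hinner a a"
    unfolding hinner_self[symmetric] by (simp add: hinner_add_left hinner_add_right hinner_cnj)
  also have "\<dots> = of_real ((norm z)\<^sup>2 + 2 * Re (hinner z a) + (norm a)\<^sup>2)"
    unfolding complex_add_cnj hinner_self by simp
  finally show ?thesis by (simp only: of_real_eq_iff)
qed

lemma cmod_shift_factor: "(cmod (shift_factor a z))\<^sup>2 = exp (- (2 * Re (hinner z a)) - (norm a)\<^sup>2)"
  by (simp add: shift_factor_def power2_eq_square exp_add[symmetric])

lemma shift_factor_nz [simp]: "shift_factor a z \<noteq> 0"
  by (simp add: shift_factor_def)

text \<open>The modulus of the factor compensates exactly the change of \<open>|z|\<^sup>2\<close> under translation.\<close>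

lemma rho_shift: "rho (shift a p) = rho p"
proof -
  have "rho (shift a p) = (cmod (p $ None))\<^sup>2 * ((cmod (shift_factor a (zpart p)))\<^sup>2 * exp ((norm (zpart p + a))\<^sup>2))"
    by (simp add: rho_def shift_def norm_mult power_mult_distrib)
  also have "(cmod (shift_factor a (zpart p)))\<^sup>2 * exp ((norm (zpart p + a))\<^sup>2) = exp ((norm (zpart p))\<^sup>2)"
    unfolding cmod_shift_factor norm_sq_add exp_add[symmetric] by simp
  finally show ?thesis by (simp add: rho_def)
qed

lemma continuous_on_zpart [continuous_intros]:
  "continuous_on S f \<Longrightarrow> continuous_on S (\<lambda>x. zpart (f x))"
  unfolding zpart_def by (intro continuous_intros)

lemma continuous_on_pt [continuous_intros]:
  assumes "continuous_on S f" "continuous_on S g"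
  shows "continuous_on S (\<lambda>x. pt (f x) (g x))"
  unfolding pt_def
proof (rule continuous_on_vec_lambda)
  fix k show "continuous_on S (\<lambda>x. case k of None \<Rightarrow> g x | Some i \<Rightarrow> f x $ i)"
    using assms by (cases k) (auto intro!: continuous_intros)
qed

lemma continuous_on_hinner [continuous_intros]:
  assumes "continuous_on S f" "continuous_on S g"
  shows "continuous_on S (\<lambda>x. hinner (f x) (g x))"
  unfolding hinner_def using assms by (intro continuous_intros)

lemma continuous_on_shift_factor [continuous_intros]:
  "continuous_on S f \<Longrightarrow> continuous_on S (\<lambda>x. shift_factor a (f x))"
  unfolding shift_factor_def by (intro continuous_intros) auto

lemma continuous_on_shift: "continuous_on S (shift a)"
  unfolding shift_def by (intro continuous_intros)

lemma continuous_on_rho: "continuous_on S rho"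
  unfolding rho_def by (intro continuous_intros)

lemma open_hartogs: "open hartogs"
  unfolding hartogs_def by (intro open_Collect_less continuous_on_rho continuous_intros)

lemma zero_in_hartogs: "0 \<in> hartogs"
  by (simp add: hartogs_def rho_def)

lemma rho_nonneg: "0 \<le> rho p"
  by (simp add: rho_def)

text \<open>The domain is a complete Reinhardt domain.\<close>

lemma rho_contract:
  assumes "\<And>k. cmod (u k) \<le> 1" shows "rho (\<chi> k. u k * p $ k) \<le> rho p"
proof -
  have le: "cmod (u k * p $ k) \<le> cmod (p $ k)" for k
    using assms[of k] by (simp add: norm_mult mult_left_le_one_le)
  show ?thesis
    unfolding rho_def norm_sq_vec
    by (intro mult_mono power_mono) (auto intro!: sum_mono power_mono simp: le)
qed

lemma hartogs_contract:
  "(\<And>k. cmod (u k) \<le> 1) \<Longrightarrow> p \<in> hartogs \<Longrightarrow> (\<chi> k. u k * p $ k) \<in> hartogs"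
  using rho_contract[of u p] by (simp add: hartogs_def)

lemma hartogs_w_bound:
  assumes "p \<in> hartogs" shows "cmod (p $ None) < 1"
proof -
  have "(cmod (p $ None))\<^sup>2 * 1 \<le> rho p"
    unfolding rho_def by (intro mult_left_mono) auto
  then have "(cmod (p $ None))\<^sup>2 < 1\<^sup>2" using assms by (simp add: hartogs_def)
  then show ?thesis by (rule power2_less_imp_less) simp
qed

lemma hartogs_w_axis: "pt 0 w \<in> hartogs \<longleftrightarrow> cmod w < 1"
  by (simp add: hartogs_def rho_def power_less_one_iff)

lemma shift_in_hartogs: "shift a p \<in> hartogs \<longleftrightarrow> p \<in> hartogs"
  by (simp add: hartogs_def rho_shift)

lemma hartogs_measurable [measurable]: "hartogs \<in> sets borel"
  by (intro borel_open open_hartogs)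

lemma nn_integral_pt:
  fixes G :: "complex^('n::finite option) \<Rightarrow> ennreal"
  assumes G: "G \<in> borel_measurable borel"
  shows "(\<integral>\<^sup>+p. G p \<partial>lborel) = (\<integral>\<^sup>+z. \<integral>\<^sup>+w. G (pt z w) \<partial>lborel \<partial>lborel)"
proof -
  have c: "continuous_on UNIV (\<lambda>(z::complex^'n, w). pt z w)"
    unfolding case_prod_unfold by (intro continuous_intros)
  then have m: "(\<lambda>(z::complex^'n, w). pt z w) \<in> borel_measurable borel"
    by (rule borel_measurable_continuous_onI)
  have m': "(\<lambda>(z::complex^'n, w). G (pt z w)) \<in> borel_measurable (lborel \<Otimes>\<^sub>M lborel)"
    using measurable_compose[OF m G] unfolding lborel_prod by (simp add: case_prod_unfold)
  have "(\<integral>\<^sup>+p. G p \<partial>lborel) = (\<integral>\<^sup>+p. G p \<partial>distr lborel borel (\<lambda>(z::complex^'n, w). pt z w))"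
    by (simp only: lborel_distr_pt)
  also have "\<dots> = (\<integral>\<^sup>+q. G ((\<lambda>(z::complex^'n, w). pt z w) q) \<partial>lborel)"
    using m G by (intro nn_integral_distr) simp_all
  also have "\<dots> = (\<integral>\<^sup>+q. (\<lambda>(z::complex^'n, w). G (pt z w)) q \<partial>(lborel \<Otimes>\<^sub>M lborel))"
    unfolding lborel_prod by (intro nn_integral_cong) (simp add: case_prod_unfold)
  also have "\<dots> = (\<integral>\<^sup>+z. \<integral>\<^sup>+w. G (pt z w) \<partial>lborel \<partial>lborel)"
    using lborel.nn_integral_fst[OF m'] by simp
  finally show ?thesis .
qed

text \<open>By Fubini: in each fibre the map is multiplication by a complex number, whose squared modulus is
  the density, and then the fibres are translated.\<close>

lemma lborel_distr_shift:
  fixes a :: "complex^'n::finite"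
  shows "distr (density lborel (\<lambda>p. ennreal ((cmod (shift_factor a (zpart p)))\<^sup>2))) borel (shift a) = lborel"
    (is "distr (density lborel ?J) borel _ = _")
proof (rule measure_eqI)
  have mS: "shift a \<in> borel_measurable borel"
    by (intro borel_measurable_continuous_onI continuous_on_shift)
  have mJ: "?J \<in> borel_measurable borel"
    by (intro measurable_compose[OF _ measurable_ennreal] borel_measurable_continuous_onI continuous_intros)
  fix X assume "X \<in> sets (distr (density lborel ?J) borel (shift a))"
  then have X: "X \<in> sets borel" by (simp only: sets_distr)
  have mI: "(\<lambda>p. indicator X p :: ennreal) \<in> borel_measurable borel" using X by simp
  have "emeasure (distr (density lborel ?J) borel (shift a)) X
      = (\<integral>\<^sup>+p. indicator X p \<partial>distr (density lborel ?J) borel (shift a))"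
    using X by (intro nn_integral_indicator[symmetric]) (simp only: sets_distr)
  also have "\<dots> = (\<integral>\<^sup>+p. indicator X (shift a p) \<partial>density lborel ?J)"
    using mS mI by (intro nn_integral_distr) simp_all
  also have "\<dots> = (\<integral>\<^sup>+p. ?J p * indicator X (shift a p) \<partial>lborel)"
    using mJ measurable_compose[OF mS mI] by (intro nn_integral_density) simp_all
  also have "\<dots> = (\<integral>\<^sup>+z. \<integral>\<^sup>+w. ennreal ((cmod (shift_factor a z))\<^sup>2) *
      indicator X (pt (z + a) (w * shift_factor a z)) \<partial>lborel \<partial>lborel)"
    using mJ measurable_compose[OF mS mI] by (subst nn_integral_pt) (simp_all add: shift_def)
  also have "\<dots> = (\<integral>\<^sup>+z. \<integral>\<^sup>+w. indicator X (pt (z + a) w) \<partial>lborel \<partial>lborel)"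
  proof (rule nn_integral_cong)
    fix z
    have "(\<lambda>w. pt (z + a) w) \<in> borel_measurable borel"
      by (intro borel_measurable_continuous_onI continuous_intros)
    from measurable_compose[OF this mI]
    show "(\<integral>\<^sup>+w. ennreal ((cmod (shift_factor a z))\<^sup>2) * indicator X (pt (z + a) (w * shift_factor a z)) \<partial>lborel)
        = (\<integral>\<^sup>+w. indicator X (pt (z + a) w) \<partial>lborel)"
      by (intro lborel_complex_mult) simp_all
  qed
  also have "\<dots> = (\<integral>\<^sup>+z. (\<lambda>y. \<integral>\<^sup>+w. indicator X (pt y w) \<partial>lborel) (a + z) \<partial>lborel)"
    by (simp only: add.commute)
  also have "\<dots> = (\<integral>\<^sup>+y. \<integral>\<^sup>+w. indicator X (pt y w) \<partial>lborel \<partial>distr lborel borel ((+) a))"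
  proof -
    have "continuous_on UNIV (\<lambda>(z::complex^'n, w). pt z w)"
      unfolding case_prod_unfold by (intro continuous_intros)
    then have m: "(\<lambda>(z::complex^'n, w). pt z w) \<in> borel_measurable borel"
      by (rule borel_measurable_continuous_onI)
    have m': "(\<lambda>(z::complex^'n, w). indicator X (pt z w) :: ennreal) \<in> borel_measurable (lborel \<Otimes>\<^sub>M lborel)"
      using measurable_compose[OF m mI] unfolding lborel_prod by (simp add: case_prod_unfold)
    have "(\<lambda>y. \<integral>\<^sup>+w. indicator X (pt y w) \<partial>lborel) \<in> borel_measurable borel"
      using lborel.borel_measurable_nn_integral[OF m'] by simp
    then show ?thesis by (intro nn_integral_distr[symmetric]) simp_all
  qed
  also have "\<dots> = (\<integral>\<^sup>+p. indicator X p \<partial>lborel)"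
    unfolding lborel_distr_plus by (rule nn_integral_pt[OF mI, symmetric])
  also have "\<dots> = emeasure lborel X" using X by simp
  finally show "emeasure (distr (density lborel ?J) borel (shift a)) X = emeasure lborel X" .
qed (simp only: sets_distr sets_lborel)

lemma change_of_variables_shift:
  fixes F :: "complex^('n::finite option) \<Rightarrow> 'b::{banach, second_countable_topology}"
  assumes F: "F \<in> borel_measurable borel"
  shows "integrable lborel F \<longleftrightarrow> integrable lborel (\<lambda>p. (cmod (shift_factor a (zpart p)))\<^sup>2 *\<^sub>R F (shift a p))" (is ?I)
    and "integral\<^sup>L lborel F = (\<integral>p. (cmod (shift_factor a (zpart p)))\<^sup>2 *\<^sub>R F (shift a p) \<partial>lborel)" (is ?E)
proof -
  let ?J = "\<lambda>p::complex^('n option). (cmod (shift_factor a (zpart p)))\<^sup>2"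
  have mS: "shift a \<in> borel_measurable borel"
    by (intro borel_measurable_continuous_onI continuous_on_shift)
  have mJ: "?J \<in> borel_measurable borel"
    by (intro borel_measurable_continuous_onI continuous_intros)
  note mFS = measurable_compose[OF mS F]
  have "integrable lborel F \<longleftrightarrow> integrable (density lborel ?J) (\<lambda>p. F (shift a p))"
    using mS F by (subst lborel_distr_shift[of a, symmetric], intro integrable_distr_eq) simp_all
  also have "\<dots> \<longleftrightarrow> integrable lborel (\<lambda>p. ?J p *\<^sub>R F (shift a p))"
    using mFS mJ by (intro integrable_density) simp_all
  finally show ?I .
  have "integral\<^sup>L lborel F = integral\<^sup>L (density lborel ?J) (\<lambda>p. F (shift a p))"
    using mS F by (subst lborel_distr_shift[of a, symmetric], intro integral_distr) simp_all
  also have "\<dots> = (\<integral>p. ?J p *\<^sub>R F (shift a p) \<partial>lborel)"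
    using mFS mJ by (intro integral_density) simp_all
  finally show ?E .
qed

text \<open>The bound \<open>|x| \<le> 1 + x\<^sup>2\<close> reduces this to the integral of \<open>exp (- |x|)\<close>.\<close>

lemma nn_integral_exp_minus_square_finite: "(\<integral>\<^sup>+x. ennreal (exp (- (x\<^sup>2))) \<partial>lborel) < \<infinity>"
proof -
  let ?g = "\<lambda>x::real. ennreal (exp (- x)) * indicator {0..} x"
  have lim: "((\<lambda>x::real. - exp (- x)) \<longlongrightarrow> - 0) at_top"
    by (intro tendsto_minus filterlim_compose[OF exp_at_bot] filterlim_uminus_at_bot_at_top)
  have "(\<integral>\<^sup>+x. ?g x \<partial>lborel) = ennreal (- 0 - (- exp (- 0)))"
    by (rule nn_integral_FTC_atLeast[OF _ _ _ lim]) (auto intro!: derivative_eq_intros)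
  then have g: "(\<integral>\<^sup>+x. ?g x \<partial>lborel) = 1" by simp
  have "(\<integral>\<^sup>+x. ?g x \<partial>lborel) = (\<integral>\<^sup>+x. ?g x \<partial>distr lborel borel uminus)"
    by (simp only: lborel_distr_uminus)
  also have "\<dots> = (\<integral>\<^sup>+x. ?g (- x) \<partial>lborel)" by (rule nn_integral_distr) simp_all
  finally have g': "(\<integral>\<^sup>+x. ?g (- x) \<partial>lborel) = 1" using g by simp
  have "(\<integral>\<^sup>+x. ennreal (exp (- (x\<^sup>2))) \<partial>lborel) \<le> (\<integral>\<^sup>+x. ennreal (exp 1) * (?g x + ?g (- x)) \<partial>lborel)"
  proof (rule nn_integral_mono)
    fix x :: real
    have "\<bar>x\<bar> \<le> 1 + x\<^sup>2"
      using zero_le_power2[of "\<bar>x\<bar> - 1/2"] by (simp add: power2_eq_square algebra_simps)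
    then have "exp (- (x\<^sup>2)) \<le> exp 1 * exp (- \<bar>x\<bar>)" by (simp flip: exp_add)
    then have "ennreal (exp (- (x\<^sup>2))) \<le> ennreal (exp 1) * ennreal (exp (- \<bar>x\<bar>))"
      by (simp add: ennreal_mult'[symmetric])
    also have "\<dots> \<le> ennreal (exp 1) * (?g x + ?g (- x))"
    proof (rule mult_left_mono)
      show "ennreal (exp (- \<bar>x\<bar>)) \<le> ?g x + ?g (- x)"
        by (cases "x \<ge> 0") (auto simp: add_increasing add_increasing2)
    qed simp
    finally show "ennreal (exp (- (x\<^sup>2))) \<le> ennreal (exp 1) * (?g x + ?g (- x))" .
  qed
  also have "\<dots> = ennreal (exp 1) * (1 + 1)"
    using g g' by (subst nn_integral_cmult, simp, subst nn_integral_add) simp_all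
  also have "\<dots> < \<infinity>" by (simp add: ennreal_mult_less_top)
  finally show ?thesis .
qed

lemma emeasure_cball_complex_le: "emeasure lborel (cball (0::complex) r) \<le> ennreal (4 * r\<^sup>2)"
proof (cases "r \<ge> 0")
  case True
  let ?c = "cbox (Complex (-r) (-r)) (Complex r r)"
  have "cball (0::complex) r \<subseteq> ?c"
  proof
    fix x :: complex assume "x \<in> cball 0 r"
    then have "\<bar>Re x\<bar> \<le> r" "\<bar>Im x\<bar> \<le> r"
      using abs_Re_le_cmod[of x] abs_Im_le_cmod[of x] by simp_all
    then show "x \<in> ?c" by (simp add: mem_box Basis_complex_def abs_le_iff)
  qed
  then have "emeasure lborel (cball (0::complex) r) \<le> emeasure lborel ?c"
    by (intro emeasure_mono) simp_all
  also have "\<dots> = ennreal (4 * r\<^sup>2)"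
    using True by (subst emeasure_lborel_cbox) (auto simp: Basis_complex_def power2_eq_square algebra_simps)
  finally show ?thesis .
qed simp

text \<open>The fibre over \<open>z\<close> is a disc of squared radius \<open>exp (- |z|\<^sup>2)\<close>, so the volume is at most a
  multiple of a Gaussian integral. Hence bounded holomorphic functions lie in the Bergman space.\<close>

lemma hartogs_finite_measure: "emeasure lborel (hartogs :: (complex^('n::finite option)) set) < \<infinity>"
proof -
  let ?H = "hartogs :: (complex^('n option)) set"
  have "emeasure lborel ?H = (\<integral>\<^sup>+p. indicator ?H p \<partial>lborel)" by simp
  also have "\<dots> = (\<integral>\<^sup>+z. \<integral>\<^sup>+w. indicator ?H (pt z w) \<partial>lborel \<partial>lborel)"
    by (rule nn_integral_pt) simp
  also have "\<dots> \<le> (\<integral>\<^sup>+z. 4 * ennreal (exp (- ((norm z)\<^sup>2))) \<partial>(lborel :: (complex^'n) measure))"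
  proof (rule nn_integral_mono)
    fix z :: "complex^'n"
    let ?r = "exp (- ((norm z)\<^sup>2) / 2)"
    have "(\<integral>\<^sup>+w. indicator ?H (pt z w) \<partial>lborel) \<le> (\<integral>\<^sup>+w. indicator (cball (0::complex) ?r) w \<partial>lborel)"
    proof (rule nn_integral_mono)
      fix w
      have "cmod w \<le> ?r" if "pt z w \<in> ?H"
      proof -
        have "(cmod w)\<^sup>2 * exp ((norm z)\<^sup>2) < 1" using that by (simp add: hartogs_def rho_def)
        then have "(cmod w)\<^sup>2 \<le> exp (- ((norm z)\<^sup>2))" by (simp add: exp_minus field_simps)
        also have "\<dots> = ?r\<^sup>2" by (simp add: power2_eq_square exp_add[symmetric])
        finally show ?thesis by (rule power2_le_imp_le) simp
      qed
      then show "(indicator ?H (pt z w) :: ennreal) \<le> indicator (cball 0 ?r) w"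
        by (auto simp: indicator_def)
    qed
    also have "\<dots> \<le> ennreal (4 * ?r\<^sup>2)"
      using emeasure_cball_complex_le[of ?r] by simp
    also have "\<dots> = 4 * ennreal (exp (- ((norm z)\<^sup>2)))"
      by (simp add: power2_eq_square exp_add[symmetric] ennreal_mult')
    finally show "(\<integral>\<^sup>+w. indicator ?H (pt z w) \<partial>lborel) \<le> 4 * ennreal (exp (- ((norm z)\<^sup>2)))" .
  qed
  also have "\<dots> = 4 * (\<integral>\<^sup>+z. ennreal (exp (- ((norm z)\<^sup>2))) \<partial>(lborel :: (complex^'n) measure))"
    by (rule nn_integral_cmult) simp
  also have "(\<integral>\<^sup>+z. ennreal (exp (- ((norm z)\<^sup>2))) \<partial>(lborel :: (complex^'n) measure))
      = (\<integral>\<^sup>+z. (\<Prod>b\<in>Basis. ennreal (exp (- ((z \<bullet> b)\<^sup>2)))) \<partial>(lborel :: (complex^'n) measure))"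
  proof (rule nn_integral_cong)
    fix z :: "complex^'n"
    have "exp (- ((norm z)\<^sup>2)) = (\<Prod>b\<in>Basis. exp (- ((z \<bullet> b)\<^sup>2)))"
      unfolding power2_norm_eq_inner euclidean_inner[of z z]
      by (simp add: exp_sum sum_negf power2_eq_square flip: sum_negf)
    then show "ennreal (exp (- ((norm z)\<^sup>2))) = (\<Prod>b\<in>Basis. ennreal (exp (- ((z \<bullet> b)\<^sup>2))))"
      by (simp add: prod_ennreal)
  qed
  also have "\<dots> = (\<Prod>b\<in>(Basis::(complex^'n) set). (\<integral>\<^sup>+x. ennreal (exp (- (x\<^sup>2))) \<partial>lborel))"
    by (rule nn_integral_lborel_prod) simp_all
  also have "4 * \<dots> < \<infinity>"
    using nn_integral_exp_minus_square_finite by (simp add: ennreal_mult_less_top power_less_top_ennreal)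
  finally show ?thesis .
qed

text \<open>Rotations with arbitrary real weights preserve the measure, so by Fubini the average over the
  rotated copies has the same integral. With weights 0 and 1 this averages over \<open>z\<close> or over \<open>w\<close>
  alone.\<close>

lemma circle_average:
  fixes F :: "complex^'m::finite \<Rightarrow> complex" and m :: "'m \<Rightarrow> real"
  assumes F: "integrable lborel F"
  defines "avg \<equiv> \<lambda>p. (1 / (2 * pi)) *\<^sub>R (LINT \<theta>:{0..2*pi}|lborel. F (\<chi> k. cis (m k * \<theta>) * p $ k))"
  shows "integrable lborel avg" and "integral\<^sup>L lborel avg = integral\<^sup>L lborel F"
proof -
  let ?R = "\<lambda>\<theta> (p::complex^'m). \<chi> k. cis (m k * \<theta>) * p $ k"
  define f where "f = (\<lambda>(\<theta>, p). indicator {0..2*pi} \<theta> *\<^sub>R F (?R \<theta> p))"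
  have mF: "F \<in> borel_measurable borel" using borel_measurable_integrable[OF F] by simp
  have mR: "?R \<theta> \<in> borel_measurable borel" for \<theta>
    by (intro borel_measurable_continuous_onI continuous_intros)
  have rot: "distr lborel borel (?R \<theta>) = lborel" for \<theta>
    by (rule lborel_distr_diag_unitary) simp
  have inv: "integrable lborel (\<lambda>p. G (?R \<theta> p)) \<and> (\<integral>p. G (?R \<theta> p) \<partial>lborel) = integral\<^sup>L lborel G"
    if "integrable lborel G" for G :: "complex^'m \<Rightarrow> 'b::{banach, second_countable_topology}" and \<theta>
  proof
    have mG: "G \<in> borel_measurable borel" using borel_measurable_integrable[OF that] by simp
    show "integrable lborel (\<lambda>p. G (?R \<theta> p))"
      using integrable_distr_eq[of "?R \<theta>" lborel borel G] mR mG that by (simp add: rot)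
    show "(\<integral>p. G (?R \<theta> p) \<partial>lborel) = integral\<^sup>L lborel G"
      using integral_distr[of "?R \<theta>" lborel borel G] mR mG by (simp add: rot)
  qed
  have mRR: "(\<lambda>(\<theta>, p). ?R \<theta> p) \<in> borel_measurable borel"
    unfolding case_prod_unfold cis_conv_exp by (intro borel_measurable_continuous_onI continuous_intros)
  have mf: "f \<in> borel_measurable (lborel \<Otimes>\<^sub>M lborel)"
  proof -
    have "(\<lambda>q. F ((\<lambda>(\<theta>, p). ?R \<theta> p) q)) \<in> borel_measurable borel"
      by (rule measurable_compose[OF mRR mF])
    moreover have "(\<lambda>q::real \<times> (complex^'m). fst q) \<in> borel_measurable borel"
      by (intro borel_measurable_continuous_onI continuous_intros)
    then have "(\<lambda>q::real \<times> (complex^'m). indicator {0..2*pi} (fst q) :: real) \<in> borel_measurable borel"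
      by (rule measurable_compose) simp
    ultimately have "(\<lambda>q. indicator {0..2*pi} (fst q) *\<^sub>R F ((\<lambda>(\<theta>, p). ?R \<theta> p) q)) \<in> borel_measurable borel"
      by (intro borel_measurable_scaleR)
    then show ?thesis unfolding lborel_prod f_def by (simp add: case_prod_unfold)
  qed
  have int: "integrable (lborel \<Otimes>\<^sub>M lborel) f"
  proof (rule lborel_pair.Fubini_integrable[OF mf])
    show "AE \<theta> in lborel. integrable lborel (\<lambda>p. f (\<theta>, p))"
      using inv[OF F] by (simp add: f_def)
    have "(\<lambda>\<theta>. \<integral>p. norm (f (\<theta>, p)) \<partial>lborel) = (\<lambda>\<theta>. indicator {0..2*pi} \<theta> *\<^sub>R (\<integral>p. norm (F p) \<partial>lborel))"
      using inv[OF integrable_norm[OF F]] by (auto simp: f_def)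
    then show "integrable lborel (\<lambda>\<theta>. \<integral>p. norm (f (\<theta>, p)) \<partial>lborel)"
      by simp
  qed
  have avg: "avg = (\<lambda>p. (1 / (2 * pi)) *\<^sub>R (\<integral>\<theta>. f (\<theta>, p) \<partial>lborel))"
    by (simp add: avg_def f_def set_lebesgue_integral_def)
  show "integrable lborel avg"
    unfolding avg using lborel_pair.integrable_snd[of "\<lambda>\<theta> p. f (\<theta>, p)"] int by simp
  have "integral\<^sup>L lborel avg = (1 / (2 * pi)) *\<^sub>R (\<integral>p. \<integral>\<theta>. f (\<theta>, p) \<partial>lborel \<partial>lborel)"
    unfolding avg by simp
  also have "(\<integral>p. \<integral>\<theta>. f (\<theta>, p) \<partial>lborel \<partial>lborel) = (\<integral>\<theta>. \<integral>p. f (\<theta>, p) \<partial>lborel \<partial>lborel)"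
    using lborel_pair.Fubini_integral[of "\<lambda>\<theta> p. f (\<theta>, p)"] int by simp
  also have "\<dots> = (\<integral>\<theta>. indicator {0..2*pi} \<theta> *\<^sub>R integral\<^sup>L lborel F \<partial>lborel)"
    using inv[OF F] by (simp add: f_def)
  also have "\<dots> = (2 * pi) *\<^sub>R integral\<^sup>L lborel F" by simp
  finally show "integral\<^sup>L lborel avg = integral\<^sup>L lborel F" by simp
qed

section \<open>Holomorphic functions of several variables\<close>

lemma holo_fun_onE:
  assumes "holo_fun_on S f" "p \<in> S"
  obtains f' where "(f has_derivative f') (at p)" "\<And>c v. f' (c *s v) = c * f' v"
  using assms unfolding holo_fun_on_def by blast

lemma holo_fun_onI:
  "(\<And>p. p \<in> S \<Longrightarrow> \<exists>f'. (f has_derivative f') (at p) \<and> (\<forall>c v. f' (c *s v) = c * f' v)) \<Longrightarrow> holo_fun_on S f"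
  unfolding holo_fun_on_def by blast

lemma holo_fun_on_const: "holo_fun_on S (\<lambda>p. c)"
  by (rule holo_fun_onI, intro exI[of _ "\<lambda>v. 0"]) auto

lemma holo_fun_on_nth: "holo_fun_on S (\<lambda>p. p $ k)"
  by (rule holo_fun_onI, intro exI[of _ "\<lambda>v. v $ k"])
    (auto intro!: bounded_linear_imp_has_derivative bounded_linear_vec_nth)

lemma holo_fun_on_add:
  assumes "holo_fun_on S f" "holo_fun_on S g" shows "holo_fun_on S (\<lambda>p. f p + g p)"
proof (rule holo_fun_onI)
  fix p assume "p \<in> S"
  with assms obtain f' g' where "(f has_derivative f') (at p)" "\<And>c v. f' (c *s v) = c * f' v"
    "(g has_derivative g') (at p)" "\<And>c v. g' (c *s v) = c * g' v" by (metis holo_fun_onE)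
  then show "\<exists>h. ((\<lambda>p. f p + g p) has_derivative h) (at p) \<and> (\<forall>c v. h (c *s v) = c * h v)"
    by (intro exI[of _ "\<lambda>v. f' v + g' v"]) (auto intro!: has_derivative_add simp: algebra_simps)
qed

lemma holo_fun_on_mult:
  assumes "holo_fun_on S f" "holo_fun_on S g" shows "holo_fun_on S (\<lambda>p. f p * g p)"
proof (rule holo_fun_onI)
  fix p assume "p \<in> S"
  with assms obtain f' g' where *: "(f has_derivative f') (at p)" "\<And>c v. f' (c *s v) = c * f' v"
    "(g has_derivative g') (at p)" "\<And>c v. g' (c *s v) = c * g' v" by (metis holo_fun_onE)
  show "\<exists>h. ((\<lambda>p. f p * g p) has_derivative h) (at p) \<and> (\<forall>c v. h (c *s v) = c * h v)"
    using has_derivative_mult[OF *(1,3)] *(2,4)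
    by (intro exI[of _ "\<lambda>v. f p * g' v + f' v * g p"]) (auto simp: algebra_simps)
qed

lemma holo_fun_on_sum:
  assumes "\<And>i. i \<in> I \<Longrightarrow> holo_fun_on S (f i)" shows "holo_fun_on S (\<lambda>p. \<Sum>i\<in>I. f i p)"
proof (cases "finite I")
  case True then show ?thesis using assms
    by (induction I rule: finite_induct) (auto intro: holo_fun_on_const holo_fun_on_add)
qed (simp add: holo_fun_on_const)

lemma holo_fun_on_compose:
  assumes f: "holo_fun_on S f" and g: "\<And>p. p \<in> S \<Longrightarrow> g field_differentiable at (f p)"
  shows "holo_fun_on S (\<lambda>p. g (f p))"
proof (rule holo_fun_onI)
  fix p assume p: "p \<in> S"
  obtain f' where f': "(f has_derivative f') (at p)" "\<And>c v. f' (c *s v) = c * f' v"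
    using holo_fun_onE[OF f p] by blast
  obtain d where "(g has_field_derivative d) (at (f p))" using g[OF p] by (auto simp: field_differentiable_def)
  then have "((\<lambda>p. g (f p)) has_derivative (\<lambda>v. d * f' v)) (at p)"
    using has_derivative_compose[OF f'(1), of g "(*) d"] by (simp add: has_field_derivative_def)
  then show "\<exists>h. ((\<lambda>p. g (f p)) has_derivative h) (at p) \<and> (\<forall>c v. h (c *s v) = c * h v)"
    by (intro exI[of _ "\<lambda>v. d * f' v"]) (simp add: f'(2))
qed

lemma holo_fun_on_imp_continuous_on: "holo_fun_on S f \<Longrightarrow> continuous_on S f"
  by (metis continuous_at_imp_continuous_on has_derivative_continuous holo_fun_onE)

lemma has_derivative_cart_componentwise:
  fixes \<Phi> :: "'a::real_normed_vector \<Rightarrow> complex^'m::finite"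
  assumes "\<And>k. ((\<lambda>p. \<Phi> p $ k) has_derivative L k) (at x)"
  shows "(\<Phi> has_derivative (\<lambda>v. \<chi> k. L k v)) (at x)"
  unfolding has_derivative_componentwise_within[of \<Phi>]
proof
  fix b :: "complex^'m" assume "b \<in> Basis"
  then obtain k c where b: "b = axis k c" by (auto simp: Basis_vec_def)
  have "((\<lambda>p. \<Phi> p $ k \<bullet> c) has_derivative (\<lambda>v. L k v \<bullet> c)) (at x)"
    by (rule has_derivative_inner_left[OF assms])
  then show "((\<lambda>p. \<Phi> p \<bullet> b) has_derivative (\<lambda>v. (\<chi> k. L k v) \<bullet> b)) (at x)"
    by (simp add: b inner_axis)
qed

lemma holo_fun_on_compose_map:
  fixes \<Phi> :: "complex^'m::finite \<Rightarrow> complex^'k::finite"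
  assumes \<Phi>: "holo_map_on S \<Phi>" and f: "holo_fun_on T f" and ST: "\<And>p. p \<in> S \<Longrightarrow> \<Phi> p \<in> T"
  shows "holo_fun_on S (\<lambda>p. f (\<Phi> p))"
proof (rule holo_fun_onI)
  fix p assume p: "p \<in> S"
  have "\<forall>k. \<exists>L. ((\<lambda>p. \<Phi> p $ k) has_derivative L) (at p) \<and> (\<forall>c v. L (c *s v) = c * L v)"
    using \<Phi> p unfolding holo_map_on_def holo_fun_on_def by blast
  from choice[OF this] obtain L where L: "\<And>k. ((\<lambda>p. \<Phi> p $ k) has_derivative L k) (at p)"
    "\<And>k c v. L k (c *s v) = c * L k v" by blast
  obtain f' where f': "(f has_derivative f') (at (\<Phi> p))" "\<And>c v. f' (c *s v) = c * f' v"
    using holo_fun_onE[OF f ST[OF p]] by blast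
  have "((\<lambda>p. f (\<Phi> p)) has_derivative (\<lambda>v. f' (\<chi> k. L k v))) (at p)"
    by (rule has_derivative_compose[OF has_derivative_cart_componentwise[OF L(1)] f'(1)])
  moreover have "f' (\<chi> k. L k (c *s v)) = c * f' (\<chi> k. L k v)" for c v
    unfolding f'(2)[symmetric] by (simp only: L(2)) (simp add: vector_scalar_mult_def)
  ultimately show "\<exists>h. ((\<lambda>p. f (\<Phi> p)) has_derivative h) (at p) \<and> (\<forall>c v. h (c *s v) = c * h v)"
    by (intro exI[of _ "\<lambda>v. f' (\<chi> k. L k v)"]) blast
qed

lemma holo_fun_on_line:
  fixes f :: "complex^'m::finite \<Rightarrow> complex"
  assumes f: "holo_fun_on T f" and S: "\<And>\<zeta>. \<zeta> \<in> S \<Longrightarrow> a + \<zeta> *s v \<in> T"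
  shows "(\<lambda>\<zeta>. f (a + \<zeta> *s v)) holomorphic_on S"
  unfolding holomorphic_on_def
proof
  fix \<zeta> assume "\<zeta> \<in> S"
  then obtain f' where f': "(f has_derivative f') (at (a + \<zeta> *s v))" "\<And>c v. f' (c *s v) = c * f' v"
    using holo_fun_onE[OF f S] by blast
  have "((\<lambda>\<zeta>. a + \<zeta> *s v) has_derivative (\<lambda>h. \<chi> k. h * v $ k)) (at \<zeta>)"
    by (rule has_derivative_cart_componentwise) (auto intro!: derivative_eq_intros)
  from has_derivative_compose[OF this f'(1)]
  have "((\<lambda>\<zeta>. f (a + \<zeta> *s v)) has_derivative (\<lambda>h. f' (h *s v))) (at \<zeta>)"
    by (simp add: vector_scalar_mult_def)
  then have "((\<lambda>\<zeta>. f (a + \<zeta> *s v)) has_field_derivative f' v) (at \<zeta>)"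
    by (simp add: has_field_derivative_def f'(2) mult_commute_abs)
  then show "(\<lambda>\<zeta>. f (a + \<zeta> *s v)) field_differentiable at \<zeta> within S"
    using field_differentiable_at_within field_differentiable_def by blast
qed

text \<open>Cauchy's formula for Taylor coefficients on the unit circle, written with a Lebesgue integral so
  that it combines with Fubini.\<close>

lemma circle_coefficient:
  assumes f: "f holomorphic_on S" and S: "open S" "cball 0 1 \<subseteq> S"
  shows "(1 / (2 * pi)) *\<^sub>R (LINT \<theta>:{0..2*pi}|lborel. f (cis \<theta>) * cnj (cis \<theta>) ^ k)
    = (deriv ^^ k) f 0 / fact k"
proof -
  have bS: "ball 0 1 \<subseteq> S" using S(2) ball_subset_cball by blast
  have fc: "continuous_on S f" using f by (rule holomorphic_on_imp_continuous_on)
  have "((\<lambda>u. f u / (u - 0) ^ Suc k) has_contour_integral 2 * pi * \<i> / fact k * (deriv ^^ k) f 0) (circlepath 0 1)"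
    by (rule Cauchy_has_contour_integral_higher_derivative_circlepath)
      (use f fc S bS in \<open>auto intro: continuous_on_subset holomorphic_on_subset\<close>)
  then have "((\<lambda>t. f (cis t) / cis t ^ Suc k * \<i> * cis t) has_integral 2 * pi * \<i> / fact k * (deriv ^^ k) f 0) {0..2*pi}"
    unfolding circlepath_def by (subst (asm) has_contour_integral_part_circlepath_iff) simp_all
  also have "(\<lambda>t. f (cis t) / cis t ^ Suc k * \<i> * cis t) = (\<lambda>t. \<i> * (f (cis t) * cnj (cis t) ^ k))"
    by (rule ext) (simp add: cis_cnj cis_divide[symmetric] field_simps flip: inverse_eq_divide cis_inverse)
  finally have "((\<lambda>t. (- \<i>) * (\<i> * (f (cis t) * cnj (cis t) ^ k))) has_integral
      (- \<i>) * (2 * pi * \<i> / fact k * (deriv ^^ k) f 0)) {0..2*pi}"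
    by (rule has_integral_mult_right)
  then have 1: "((\<lambda>t. f (cis t) * cnj (cis t) ^ k) has_integral 2 * pi * ((deriv ^^ k) f 0 / fact k)) {0..2*pi}"
    by (simp add: mult.assoc[symmetric]) (simp add: algebra_simps)
  have cS: "cis t \<in> S" for t using S(2) by (auto simp: subset_iff)
  have "continuous_on {0..2*pi} (\<lambda>t. f (cis t) * cnj (cis t) ^ k)"
    by (intro continuous_intros continuous_on_compose2[OF fc] continuous_on_cis) (auto simp: cS)
  then have "set_integrable lborel {0..2*pi} (\<lambda>t. f (cis t) * cnj (cis t) ^ k)"
    unfolding set_integrable_def
    by (intro borel_integrable_compact) auto
  then have "(LINT \<theta>:{0..2*pi}|lborel. f (cis \<theta>) * cnj (cis \<theta>) ^ k) = 2 * pi * ((deriv ^^ k) f 0 / fact k)"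
    using 1 by (simp add: set_borel_integral_eq_integral integral_unique)
  then show ?thesis by (simp add: scaleR_conv_of_real)
qed

lemma holo_fun_on_hinner_zpart: "holo_fun_on S (\<lambda>p. hinner (zpart p) a)"
  unfolding hinner_def zpart_nth by (intro holo_fun_on_sum holo_fun_on_mult holo_fun_on_nth holo_fun_on_const)

lemma holo_fun_on_shift_factor: "holo_fun_on S (\<lambda>p. shift_factor a (zpart p))"
proof -
  have "holo_fun_on S (\<lambda>p. (- 1) * hinner (zpart p) a + (- of_real ((norm a)\<^sup>2 / 2)))"
    by (intro holo_fun_on_add holo_fun_on_mult holo_fun_on_hinner_zpart holo_fun_on_const)
  then have "holo_fun_on S (\<lambda>p. - hinner (zpart p) a - of_real ((norm a)\<^sup>2 / 2))" by simp
  then show ?thesis unfolding shift_factor_def by (rule holo_fun_on_compose) (rule holomorphic_on_imp_differentiable_at[OF holomorphic_on_exp open_UNIV], simp)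
qed

lemma holo_map_on_shift: "holo_map_on S (shift a)"
  unfolding holo_map_on_def
proof
  fix k show "holo_fun_on S (\<lambda>p. shift a p $ k)"
    by (cases k) (auto simp: shift_def intro!: holo_fun_on_mult holo_fun_on_add holo_fun_on_nth
        holo_fun_on_const holo_fun_on_shift_factor)
qed

section \<open>The Bergman space: reproducing at points of the w-axis\<close>

text \<open>Fixing the domain as a parameter fixes the number of \<open>z\<close>-coordinates, so that the moments below
  need no type argument.\<close>

locale hartogs_space =
  fixes H :: "(complex^('n::finite option)) set"
  assumes H_eq: "H = hartogs"
begin

lemma open_H: "open H" and H_borel: "H \<in> sets borel" and H_lborel: "H \<in> sets lborel"
  using open_hartogs hartogs_measurable by (simp_all add: H_eq)

lemma H_finite: "emeasure lborel H < \<infinity>"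
  using hartogs_finite_measure by (simp add: H_eq)

lemma measurable_on_H:
  fixes f :: "complex^('n option) \<Rightarrow> 'b::real_normed_vector"
  shows "continuous_on H f \<Longrightarrow> (\<lambda>p. indicator H p *\<^sub>R f p) \<in> borel_measurable lborel"
  using borel_measurable_continuous_on_indicator[OF H_borel] by simp

lemma sq_integrable_mult:
  fixes f g :: "complex^('n option) \<Rightarrow> complex"
  assumes c: "continuous_on H f" "continuous_on H g"
    and i: "set_integrable lborel H (\<lambda>p. (cmod (f p))\<^sup>2)" "set_integrable lborel H (\<lambda>p. (cmod (g p))\<^sup>2)"
  shows "set_integrable lborel H (\<lambda>p. f p * g p)"
  unfolding set_integrable_def
proof (rule Bochner_Integration.integrable_bound)
  show "integrable lborel (\<lambda>p. indicator H p *\<^sub>R (cmod (f p))\<^sup>2 + indicator H p *\<^sub>R (cmod (g p))\<^sup>2)"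
    using i unfolding set_integrable_def by (rule Bochner_Integration.integrable_add)
  show "(\<lambda>p. indicator H p *\<^sub>R (f p * g p)) \<in> borel_measurable lborel"
    by (intro measurable_on_H continuous_intros c)
  have "cmod (f p) * cmod (g p) \<le> (cmod (f p))\<^sup>2 + (cmod (g p))\<^sup>2" for p
  proof -
    have "2 * (cmod (f p) * cmod (g p)) \<le> (cmod (f p))\<^sup>2 + (cmod (g p))\<^sup>2"
      using zero_le_power2[of "cmod (f p) - cmod (g p)"] by (simp add: power2_eq_square algebra_simps)
    moreover have "0 \<le> cmod (f p) * cmod (g p)" by simp
    ultimately show ?thesis by linarith
  qed
  then show "AE p in lborel. norm (indicator H p *\<^sub>R (f p * g p))
      \<le> norm (indicator H p *\<^sub>R (cmod (f p))\<^sup>2 + indicator H p *\<^sub>R (cmod (g p))\<^sup>2)"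
    by (intro AE_I2) (auto simp: indicator_def norm_mult)
qed

lemma bounded_integrable:
  fixes g :: "complex^('n option) \<Rightarrow> 'b::{banach, second_countable_topology}"
  assumes c: "continuous_on H g" and b: "\<And>p. p \<in> H \<Longrightarrow> norm (g p) \<le> C"
  shows "set_integrable lborel H g"
  unfolding set_integrable_def
proof (rule Bochner_Integration.integrable_bound)
  show "integrable lborel (\<lambda>p. indicator H p *\<^sub>R C)"
    using H_finite H_lborel by (intro integrable_scaleR_left integrable_real_indicator)
  show "(\<lambda>p. indicator H p *\<^sub>R g p) \<in> borel_measurable lborel"
    by (rule measurable_on_H[OF c])
  show "AE p in lborel. norm (indicator H p *\<^sub>R g p) \<le> norm (indicator H p *\<^sub>R C)"
    by (intro AE_I2) (auto simp: indicator_def intro: order_trans[OF b])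
qed

lemma bergman_spaceD:
  assumes "f \<in> bergman_space H"
  shows "holo_fun_on H f" "continuous_on H f" "set_integrable lborel H (\<lambda>p. (cmod (f p))\<^sup>2)"
  using assms holo_fun_on_imp_continuous_on by (auto simp: bergman_space_def)

lemma bergman_space_bounded:
  assumes "holo_fun_on H f" "\<And>p. p \<in> H \<Longrightarrow> cmod (f p) \<le> C"
  shows "f \<in> bergman_space H"
proof -
  have "set_integrable lborel H (\<lambda>p. (cmod (f p))\<^sup>2)"
  proof (rule bounded_integrable)
    show "continuous_on H (\<lambda>p. (cmod (f p))\<^sup>2)"
      using holo_fun_on_imp_continuous_on[OF assms(1)] by (intro continuous_intros)
    show "norm ((cmod (f p))\<^sup>2) \<le> C\<^sup>2" if "p \<in> H" for p
      using assms(2)[OF that] by (simp add: power_mono)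
  qed
  then show ?thesis using assms by (simp add: bergman_space_def)
qed

lemma bergman_integrable:
  assumes "f \<in> bergman_space H" "g \<in> bergman_space H"
  shows "set_integrable lborel H (\<lambda>p. f p * cnj (g p))"
  using bergman_spaceD[OF assms(1)] bergman_spaceD[OF assms(2)]
  by (intro sq_integrable_mult continuous_intros) simp_all

lemma bergman_zero: "(\<lambda>p. 0) \<in> bergman_space H"
  by (rule bergman_space_bounded[of _ 0]) (auto intro: holo_fun_on_const)

lemma bergman_scale:
  assumes "f \<in> bergman_space H" shows "(\<lambda>p. c * f p) \<in> bergman_space H"
proof -
  have "set_integrable lborel H (\<lambda>p. (cmod c)\<^sup>2 * (cmod (f p))\<^sup>2)"
    using bergman_spaceD(3)[OF assms] by (rule set_integrable_mult_right)
  then show ?thesis using bergman_spaceD(1)[OF assms]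
    by (auto simp: bergman_space_def norm_mult power_mult_distrib intro: holo_fun_on_mult holo_fun_on_const)
qed

lemma bergman_add:
  assumes f: "f \<in> bergman_space H" and g: "g \<in> bergman_space H" shows "(\<lambda>p. f p + g p) \<in> bergman_space H"
proof -
  note f' = bergman_spaceD[OF f] and g' = bergman_spaceD[OF g]
  have "integrable lborel (\<lambda>p. Re (indicator H p *\<^sub>R (f p * cnj (g p))))"
    using bergman_integrable[OF f g] unfolding set_integrable_def by (rule integrable_Re)
  then have "set_integrable lborel H (\<lambda>p. (cmod (f p))\<^sup>2 + (cmod (g p))\<^sup>2 + 2 * Re (f p * cnj (g p)))"
    using f'(3) g'(3) by (intro set_integral_add(1) set_integrable_mult_right) (simp_all add: set_integrable_def)
  moreover have "(cmod (x + y))\<^sup>2 = (cmod x)\<^sup>2 + (cmod y)\<^sup>2 + 2 * Re (x * cnj y)" for x y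
    unfolding cmod_power2 by (simp add: power2_eq_square algebra_simps)
  ultimately show ?thesis using f'(1) g'(1) by (simp add: bergman_space_def holo_fun_on_add)
qed

lemma bergman_inner_self:
  assumes "f \<in> bergman_space H"
  shows "bergman_inner H f f = of_real (set_lebesgue_integral lborel H (\<lambda>p. (cmod (f p))\<^sup>2))"
  unfolding bergman_inner_def set_lebesgue_integral_def integral_complex_of_real[symmetric] complex_norm_square[symmetric]
  by (intro Bochner_Integration.integral_cong) (simp_all add: indicator_def)

text \<open>The monomials in \<open>w\<close> are orthogonal and these are their squared norms, so the inverse moments
  are the coefficients of the kernel on the w-axis.\<close>

definition moment :: "nat \<Rightarrow> real" where
  "moment k = (LINT p:H|lborel. (cmod (p $ None)) ^ (2 * k))"

definition coef :: "nat \<Rightarrow> real" where "coef k = 1 / moment k"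

text \<open>The series whose value at \<open>cnj s * w\<close> is the kernel for the point \<open>(0, s)\<close>; its real restriction
  \<open>rser\<close> gives the diagonal.\<close>

definition cser :: "complex \<Rightarrow> complex" where "cser z = (\<Sum>k. of_real (coef k) * z ^ k)"

lemma w_less_1: "p \<in> H \<Longrightarrow> cmod (p $ None) < 1"
  using hartogs_w_bound by (simp add: H_eq)

lemma w_power_integrable: "set_integrable lborel H (\<lambda>p. (cmod (p $ None)) ^ (2 * k))"
proof (rule bounded_integrable)
  show "norm (cmod (p $ None) ^ (2 * k)) \<le> 1" if "p \<in> H" for p
    using w_less_1[OF that] by (simp add: power_le_one)
qed (intro continuous_intros)

text \<open>The part of the domain where \<open>|w| > r\<close> has positive volume and contributes at least \<open>r\<close> to the
  power \<open>2k\<close> per unit volume. So the series with coefficients \<open>1 / moment k\<close> converges in the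
  unit disc.\<close>

lemma moment_lower:
  assumes r: "0 < r" "r < 1"
  obtains m where "0 < m" "\<And>k. m * (r\<^sup>2) ^ k \<le> moment k"
proof
  define S where "S = H \<inter> {p. r < cmod (p $ None)}"
  have oS: "open S"
    unfolding S_def by (intro open_Int open_H open_Collect_less continuous_intros)
  have "(pt 0 (of_real ((1 + r) / 2)) :: complex^('n option)) \<in> S"
    using r unfolding S_def H_eq by (simp add: hartogs_w_axis del: of_real_add of_real_divide)
  then have "\<not> negligible S" using open_not_negligible[OF oS] by blast
  then have "emeasure lborel S \<noteq> 0"
    using oS by (simp add: negligible_iff_emeasure0)
  moreover have fin: "emeasure lborel S < \<infinity>"
    using emeasure_mono[of S H lborel] H_lborel H_finite by (auto simp: S_def intro: le_less_trans)
  ultimately show "0 < measure lborel S"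
    by (simp add: measure_def enn2real_positive_iff zero_less_iff_neq_zero)
  fix k
  have "measure lborel S * (r\<^sup>2) ^ k = (\<integral>p. indicator S p *\<^sub>R (r\<^sup>2) ^ k \<partial>lborel)"
    by simp
  also have "\<dots> \<le> (\<integral>p. indicator H p *\<^sub>R (cmod (p $ None)) ^ (2 * k) \<partial>lborel)"
  proof (rule integral_mono)
    show "integrable lborel (\<lambda>p. indicator S p *\<^sub>R (r\<^sup>2) ^ k)"
      using oS fin by (intro integrable_scaleR_left integrable_real_indicator) auto
    show "integrable lborel (\<lambda>p. indicator H p *\<^sub>R (cmod (p $ None)) ^ (2 * k))"
      using w_power_integrable unfolding set_integrable_def .
    show "indicator S p *\<^sub>R (r\<^sup>2) ^ k \<le> indicator H p *\<^sub>R (cmod (p $ None)) ^ (2 * k)" for p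
      using r by (auto simp: S_def indicator_def power_mult[symmetric] intro!: power_mono)
  qed
  finally show "measure lborel S * (r\<^sup>2) ^ k \<le> moment k"
    unfolding moment_def set_lebesgue_integral_def .
qed

lemma moment_pos: "0 < moment k"
proof -
  obtain m where "0 < m" "\<And>k. m * ((1/2)\<^sup>2) ^ k \<le> moment k"
    using moment_lower[of "1/2"] by auto
  then show ?thesis by (metis mult_pos_pos order_less_le_trans zero_less_power half_gt_zero zero_less_one)
qed

lemma coef_pos: "0 < coef k"
  by (simp add: coef_def moment_pos)

lemma coef_summable:
  assumes x: "0 \<le> x" "x < 1" shows "summable (\<lambda>k. coef k * x ^ k)"
proof -
  define r where "r = sqrt ((x + 1) / 2)"
  have r2: "r\<^sup>2 = (x + 1) / 2" using x by (simp add: r_def)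
  have r: "0 < r" "r < 1" using x by (simp_all add: r_def)
  obtain m where m: "0 < m" "\<And>k. m * (r\<^sup>2) ^ k \<le> moment k" using moment_lower[OF r] by blast
  have "summable (\<lambda>k. (1 / m) * (x / r\<^sup>2) ^ k)"
    using x by (intro summable_mult summable_geometric) (simp add: r2)
  then show ?thesis
  proof (rule summable_comparison_test'[where N=0])
    fix k
    have "m * (r\<^sup>2) ^ k > 0" using m(1) r(1) by simp
    then have "coef k \<le> 1 / (m * (r\<^sup>2) ^ k)"
      unfolding coef_def using m(2)[of k] by (intro divide_left_mono) (auto simp: moment_pos)
    then have "coef k * x ^ k \<le> 1 / (m * (r\<^sup>2) ^ k) * x ^ k"
      using x by (intro mult_right_mono) auto
    then show "norm (coef k * x ^ k) \<le> (1 / m) * (x / r\<^sup>2) ^ k"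
      using x coef_pos[of k] by (simp add: power_divide abs_mult)
  qed
qed

lemma cser_norm_summable: "cmod z < 1 \<Longrightarrow> summable (\<lambda>k. norm (of_real (coef k) * z ^ k :: complex))"
  using coef_summable[of "cmod z"] coef_pos by (simp add: norm_mult norm_power less_imp_le)

lemma cser_sums: "cmod z < 1 \<Longrightarrow> (\<lambda>k. of_real (coef k) * z ^ k) sums cser z"
  unfolding cser_def by (intro summable_sums summable_norm_cancel[OF cser_norm_summable])

lemma cser_holomorphic: "cser holomorphic_on ball 0 1"
  by (rule power_series_holomorphic[where a="\<lambda>k. of_real (coef k)"]) (use cser_sums in auto)

lemma cser_bound:
  assumes "cmod z \<le> x" "x < 1" shows "cmod (cser z) \<le> (\<Sum>k. coef k * x ^ k)"
proof -
  have x: "0 \<le> x" using assms(1) norm_ge_zero order_trans by blast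
  show ?thesis
    unfolding cser_def
  proof (rule norm_suminf_le)
    show "norm (of_real (coef k) * z ^ k) \<le> coef k * x ^ k" for k
      using assms(1) coef_pos[of k] by (simp add: norm_mult norm_power power_mono)
  qed (rule coef_summable[OF x assms(2)])
qed

lemma rotate_z:
  fixes p :: "complex^('n option)"
  shows "(\<chi> k. cis ((case k of None \<Rightarrow> 0 | Some i \<Rightarrow> 1) * \<theta>) * p $ k) = pt 0 (p $ None) + cis \<theta> *s pt (zpart p) 0"
  by (simp add: vec_eq_iff pt_def split: option.split)

lemma rotate_w:
  fixes p :: "complex^('n option)"
  shows "(\<chi> k. cis ((case k of None \<Rightarrow> 1 | Some i \<Rightarrow> 0) * \<theta>) * p $ k) = pt (zpart p) (cis \<theta> * p $ None)"
  by (simp add: vec_eq_iff pt_def split: option.split)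

lemma contract_z:
  assumes "p \<in> H" "cmod \<zeta> \<le> 1" shows "pt 0 (p $ None) + \<zeta> *s pt (zpart p) 0 \<in> H"
proof -
  have "(\<chi> k. (case k of None \<Rightarrow> 1 | Some i \<Rightarrow> \<zeta>) * p $ k) \<in> H"
    using assms unfolding H_eq by (intro hartogs_contract) (auto split: option.split)
  also have "(\<chi> k. (case k of None \<Rightarrow> 1 | Some i \<Rightarrow> \<zeta>) * p $ k) = pt 0 (p $ None) + \<zeta> *s pt (zpart p) 0"
    by (simp add: vec_eq_iff pt_def split: option.split)
  finally show ?thesis .
qed

lemma rotate_z_in_H: "pt 0 (p $ None) + cis \<theta> *s pt (zpart p) 0 \<in> H \<longleftrightarrow> p \<in> H"
proof
  assume "pt 0 (p $ None) + cis \<theta> *s pt (zpart p) 0 \<in> H"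
  from contract_z[OF this, of "cis (-\<theta>)"]
  have "pt 0 (p $ None) + cis (-\<theta>) *s pt (zpart (pt 0 (p $ None) + cis \<theta> *s pt (zpart p) 0)) 0 \<in> H" by simp
  also have "pt 0 (p $ None) + cis (-\<theta>) *s pt (zpart (pt 0 (p $ None) + cis \<theta> *s pt (zpart p) 0)) 0 = p"
    by (simp add: vec_eq_iff pt_def mult.assoc[symmetric] cis_mult split: option.split)
  finally show "p \<in> H" .
qed (simp add: contract_z)

lemma rotate_w_in_H: "pt (zpart p) (cis \<theta> * p $ None) \<in> H \<longleftrightarrow> p \<in> H"
  by (simp add: H_eq hartogs_def rho_def norm_mult)

text \<open>For fixed \<open>w\<close>, the mean value property on the circles \<open>\<zeta> \<mapsto> (\<zeta>z, w)\<close> replaces \<open>h (z, w)\<close> by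
  \<open>h (0, w)\<close>.\<close>

lemma average_over_z:
  assumes h: "holo_fun_on H h" and int: "set_integrable lborel H (\<lambda>p. h p * \<phi> (p $ None))"
  shows "set_integrable lborel H (\<lambda>p. h (pt 0 (p $ None)) * \<phi> (p $ None))"
    and "(LINT p:H|lborel. h p * \<phi> (p $ None)) = (LINT p:H|lborel. h (pt 0 (p $ None)) * \<phi> (p $ None))"
proof -
  let ?F = "\<lambda>p. indicator H p *\<^sub>R (h p * \<phi> (p $ None))"
  let ?m = "\<lambda>k::'n option. (case k of None \<Rightarrow> 0 | Some i \<Rightarrow> 1) :: real"
  have F: "integrable lborel ?F" using int unfolding set_integrable_def .
  have eq: "(1 / (2 * pi)) *\<^sub>R (LINT \<theta>:{0..2*pi}|lborel. ?F (\<chi> k. cis (?m k * \<theta>) * p $ k))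
      = indicator H p *\<^sub>R (h (pt 0 (p $ None)) * \<phi> (p $ None))" for p
  proof (cases "p \<in> H")
    case False
    then show ?thesis unfolding rotate_z by (simp add: rotate_z_in_H set_lebesgue_integral_def)
  next
    case True
    let ?f = "\<lambda>\<zeta>. h (pt 0 (p $ None) + \<zeta> *s pt (zpart p) 0)"
    let ?S = "{\<zeta>. pt 0 (p $ None) + \<zeta> *s pt (zpart p) 0 \<in> H}"
    have "?f holomorphic_on ?S" by (rule holo_fun_on_line[OF h]) simp
    moreover have "open ?S"
    proof -
      have "continuous_on UNIV (\<lambda>\<zeta>. pt 0 (p $ None) + \<zeta> *s pt (zpart p) 0)"
        unfolding vector_scalar_mult_def by (intro continuous_intros)
      from open_vimage[OF open_H this] show ?thesis by (simp add: vimage_def)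
    qed
    moreover have "cball 0 1 \<subseteq> ?S" using contract_z[OF True] by auto
    ultimately have "(1 / (2 * pi)) *\<^sub>R (LINT \<theta>:{0..2*pi}|lborel. ?f (cis \<theta>) * cnj (cis \<theta>) ^ 0) = (deriv ^^ 0) ?f 0 / fact 0"
      by (rule circle_coefficient)
    then have "(1 / (2 * pi)) *\<^sub>R (LINT \<theta>:{0..2*pi}|lborel. ?f (cis \<theta>)) = h (pt 0 (p $ None))" by simp
    note 1 = this
    have 2: "(LINT \<theta>:{0..2*pi}|lborel. ?F (\<chi> k. cis (?m k * \<theta>) * p $ k))
        = (LINT \<theta>:{0..2*pi}|lborel. ?f (cis \<theta>)) * \<phi> (p $ None)"
      unfolding rotate_z using True by (simp add: rotate_z_in_H)
    show ?thesis unfolding 2 unfolding mult_scaleR_left[symmetric] unfolding 1 using True by simp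
  qed
  show "set_integrable lborel H (\<lambda>p. h (pt 0 (p $ None)) * \<phi> (p $ None))"
    unfolding set_integrable_def using circle_average(1)[OF F, of ?m] unfolding eq .
  show "(LINT p:H|lborel. h p * \<phi> (p $ None)) = (LINT p:H|lborel. h (pt 0 (p $ None)) * \<phi> (p $ None))"
    unfolding set_lebesgue_integral_def using circle_average(2)[OF F, of ?m] unfolding eq by simp
qed

text \<open>Rotating \<open>w\<close> isolates one Taylor coefficient.\<close>

lemma average_over_w:
  assumes g: "g holomorphic_on ball 0 1"
    and int: "set_integrable lborel H (\<lambda>p. g (p $ None) * cnj (p $ None) ^ k)"
  shows "(LINT p:H|lborel. g (p $ None) * cnj (p $ None) ^ k) = (deriv ^^ k) g 0 / fact k * moment k"
proof -
  let ?F = "\<lambda>p. indicator H p *\<^sub>R (g (p $ None) * cnj (p $ None) ^ k)"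
  let ?m = "\<lambda>k::'n option. (case k of None \<Rightarrow> 1 | Some i \<Rightarrow> 0) :: real"
  have F: "integrable lborel ?F" using int unfolding set_integrable_def .
  have eq: "(1 / (2 * pi)) *\<^sub>R (LINT \<theta>:{0..2*pi}|lborel. ?F (\<chi> k. cis (?m k * \<theta>) * p $ k))
      = (deriv ^^ k) g 0 / fact k * (of_real (indicator H p *\<^sub>R (cmod (p $ None)) ^ (2 * k)))" for p
  proof (cases "p \<in> H")
    case False
    then show ?thesis unfolding rotate_w by (simp add: rotate_w_in_H set_lebesgue_integral_def)
  next
    case True
    let ?w = "p $ None"
    let ?S = "{\<zeta>. ?w * \<zeta> \<in> ball 0 1}"
    have oS: "open ?S"
      using open_vimage[of "ball 0 1" "\<lambda>\<zeta>. ?w * \<zeta>"] by (simp add: vimage_def continuous_intros)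
    have cS: "cball 0 1 \<subseteq> ?S"
    proof
      fix \<zeta> :: complex assume "\<zeta> \<in> cball 0 1"
      then have "cmod ?w * cmod \<zeta> \<le> cmod ?w * 1" by (intro mult_left_mono) auto
      then show "\<zeta> \<in> ?S" using w_less_1[OF True] by (simp add: norm_mult)
    qed
    have hol: "(\<lambda>\<zeta>. g (?w * \<zeta>)) holomorphic_on ?S"
      by (rule holomorphic_on_compose_gen[unfolded o_def, OF _ g]) (auto intro!: holomorphic_intros)
    have "(1 / (2 * pi)) *\<^sub>R (LINT \<theta>:{0..2*pi}|lborel. g (?w * cis \<theta>) * cnj (cis \<theta>) ^ k)
        = (deriv ^^ k) (\<lambda>\<zeta>. g (?w * \<zeta>)) 0 / fact k"
      by (rule circle_coefficient[OF hol oS cS])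
    also have "(deriv ^^ k) (\<lambda>\<zeta>. g (?w * \<zeta>)) 0 = ?w ^ k * (deriv ^^ k) g (?w * 0)"
      by (rule higher_deriv_compose_linear[OF g oS open_ball]) auto
    finally have 1: "(1 / (2 * pi)) *\<^sub>R (LINT \<theta>:{0..2*pi}|lborel. g (?w * cis \<theta>) * cnj (cis \<theta>) ^ k)
        = ?w ^ k * (deriv ^^ k) g 0 / fact k" by simp
    have 2: "(LINT \<theta>:{0..2*pi}|lborel. ?F (\<chi> k. cis (?m k * \<theta>) * p $ k))
        = (LINT \<theta>:{0..2*pi}|lborel. g (?w * cis \<theta>) * cnj (cis \<theta>) ^ k) * cnj ?w ^ k"
    proof -
      have "(LINT \<theta>:{0..2*pi}|lborel. ?F (\<chi> k. cis (?m k * \<theta>) * p $ k))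
          = (LINT \<theta>:{0..2*pi}|lborel. (g (?w * cis \<theta>) * cnj (cis \<theta>) ^ k) * cnj ?w ^ k)"
      proof -
        have "?F (\<chi> k. cis (?m k * \<theta>) * p $ k) = (g (?w * cis \<theta>) * cnj (cis \<theta>) ^ k) * cnj ?w ^ k" for \<theta>
          unfolding rotate_w using True rotate_w_in_H[of p \<theta>]
          by (simp add: power_mult_distrib mult.commute[of "cis \<theta>"])
        then show ?thesis by simp
      qed
      then show ?thesis by simp
    qed
    have "?w ^ k * cnj ?w ^ k = of_real ((cmod ?w) ^ (2 * k))"
      unfolding power_mult_distrib[symmetric] complex_norm_square[symmetric] by (simp add: power_mult)
    then show ?thesis
      unfolding 2 unfolding mult_scaleR_left[symmetric] unfolding 1 using True by (simp add: algebra_simps)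
  qed
  have "(LINT p:H|lborel. g (p $ None) * cnj (p $ None) ^ k)
      = (\<integral>p. (deriv ^^ k) g 0 / fact k * (of_real (indicator H p *\<^sub>R (cmod (p $ None)) ^ (2 * k))) \<partial>lborel)"
    unfolding set_lebesgue_integral_def using circle_average(2)[OF F, of ?m] unfolding eq by simp
  also have "\<dots> = (deriv ^^ k) g 0 / fact k * moment k"
    unfolding moment_def set_lebesgue_integral_def integral_complex_of_real[symmetric]
    by (rule integral_mult_right_zero)
  finally show ?thesis .
qed

text \<open>The two averages show that the inner product of \<open>h\<close> with the k-th power of \<open>w\<close> is the k-th
  Taylor coefficient of \<open>w \<mapsto> h (0, w)\<close> times the k-th moment. Dividing by the moments and
  summing against the powers of \<open>s\<close> gives back \<open>h (0, s)\<close>. The kernel here depends on \<open>w\<close> alone.\<close>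

lemma reproducing_on_w_axis:
  assumes h: "h \<in> bergman_space H" and s: "cmod s < 1"
  shows "bergman_inner H h (\<lambda>p. cser (cnj s * p $ None)) = h (pt 0 s)"
proof -
  note h' = bergman_spaceD[OF h]
  define b where "b k = (deriv ^^ k) (\<lambda>w. h (pt 0 w)) 0 / fact k" for k
  have hol: "(\<lambda>w. h (pt 0 w)) holomorphic_on ball 0 1"
  proof -
    have "(\<lambda>\<zeta>. h (0 + \<zeta> *s pt 0 1)) holomorphic_on ball 0 1"
    proof (rule holo_fun_on_line[OF h'(1)])
      fix \<zeta> :: complex assume "\<zeta> \<in> ball 0 1"
      moreover have "0 + \<zeta> *s pt 0 1 = (pt 0 \<zeta> :: complex^('n option))"
        by (simp add: vec_eq_iff pt_def split: option.split)
      ultimately show "0 + \<zeta> *s pt 0 1 \<in> H" by (simp add: H_eq hartogs_w_axis)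
    qed
    moreover have "0 + \<zeta> *s pt 0 1 = (pt 0 \<zeta> :: complex^('n option))" for \<zeta>
      by (simp add: vec_eq_iff pt_def split: option.split)
    ultimately show ?thesis by simp
  qed
  have mono_int: "set_integrable lborel H (\<lambda>p. h p * cnj (p $ None) ^ k)" for k
  proof (rule sq_integrable_mult[OF h'(2) _ h'(3)])
    show "set_integrable lborel H (\<lambda>p. (cmod (cnj (p $ None) ^ k))\<^sup>2)"
      using w_power_integrable[of k] by (simp add: norm_power power_mult[symmetric] mult.commute)
  qed (intro continuous_intros)
  have mono_val: "(LINT p:H|lborel. h p * cnj (p $ None) ^ k) = b k * moment k" for k
    using average_over_z[OF h'(1), of "\<lambda>w. cnj w ^ k", OF mono_int] average_over_w[OF hol, of k]
    by (simp add: b_def)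
  let ?f = "\<lambda>k p. indicator H p *\<^sub>R (h p * cnj (of_real (coef k) * (cnj s * p $ None) ^ k))"
  have f_eq: "?f k p = (of_real (coef k) * s ^ k) * (indicator H p *\<^sub>R (h p * cnj (p $ None) ^ k))" for k p
    by (simp add: power_mult_distrib)
  have f_int: "integrable lborel (?f k)" for k
    using mono_int[of k] unfolding f_eq set_integrable_def by (rule integrable_mult_right)
  have f_val: "integral\<^sup>L lborel (?f k) = b k * s ^ k" for k
  proof -
    have "integral\<^sup>L lborel (?f k) = (of_real (coef k) * s ^ k) * (LINT p:H|lborel. h p * cnj (p $ None) ^ k)"
      unfolding f_eq set_lebesgue_integral_def by (rule integral_mult_right_zero)
    then show ?thesis using moment_pos[of k] by (simp add: mono_val coef_def)
  qed
  have h_int: "integrable lborel (\<lambda>p. indicator H p *\<^sub>R h p)"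
    using mono_int[of 0] by (simp add: set_integrable_def)
  have sw: "cmod (cnj s * p $ None) < 1" if "p \<in> H" for p
  proof -
    have "cmod s * cmod (p $ None) \<le> cmod s * 1"
      using w_less_1[OF that] by (intro mult_left_mono) auto
    then show ?thesis using s by (simp add: norm_mult)
  qed
  have f_bound: "norm (?f k p) \<le> (coef k * cmod s ^ k) * norm (indicator H p *\<^sub>R h p)" for k p
  proof (cases "p \<in> H")
    case True
    have "cmod (p $ None) ^ k \<le> 1" using w_less_1[OF True] by (simp add: power_le_one)
    then have "(coef k * cmod s ^ k * cmod (h p)) * cmod (p $ None) ^ k \<le> (coef k * cmod s ^ k * cmod (h p)) * 1"
      using coef_pos[of k] by (intro mult_left_mono) auto
    then show ?thesis using True coef_pos[of k] by (simp add: norm_mult norm_power power_mult_distrib algebra_simps)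
  qed simp
  have sum_s: "summable (\<lambda>k. coef k * cmod s ^ k)" by (rule coef_summable) (use s in auto)
  have sums1: "(\<lambda>k. integral\<^sup>L lborel (?f k)) sums (\<integral>p. (\<Sum>k. ?f k p) \<partial>lborel)"
  proof (rule sums_integral[OF f_int])
    show "AE p in lborel. summable (\<lambda>k. norm (?f k p))"
    proof (intro AE_I2)
      fix p show "summable (\<lambda>k. norm (?f k p))"
        by (rule summable_comparison_test'[OF summable_mult2[OF sum_s], of 0]) (use f_bound in simp)
    qed
    show "summable (\<lambda>k. \<integral>p. norm (?f k p) \<partial>lborel)"
    proof (rule summable_comparison_test'[OF summable_mult2[OF sum_s], of 0])
      fix k
      have "(\<integral>p. norm (?f k p) \<partial>lborel) \<le> (\<integral>p. (coef k * cmod s ^ k) * norm (indicator H p *\<^sub>R h p) \<partial>lborel)"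
        by (intro integral_mono f_bound integrable_norm integrable_mult_right f_int h_int)
      also have "\<dots> = (coef k * cmod s ^ k) * (\<integral>p. norm (indicator H p *\<^sub>R h p) \<partial>lborel)"
        by (rule integral_mult_right_zero)
      finally show "norm (\<integral>p. norm (?f k p) \<partial>lborel) \<le> (coef k * cmod s ^ k) * (\<integral>p. norm (indicator H p *\<^sub>R h p) \<partial>lborel)"
        by simp
    qed
  qed
  have sums2: "(\<Sum>k. ?f k p) = indicator H p *\<^sub>R (h p * cnj (cser (cnj s * p $ None)))" for p
  proof (cases "p \<in> H")
    case True
    have "(\<lambda>k. h p * cnj (of_real (coef k) * (cnj s * p $ None) ^ k)) sums (h p * cnj (cser (cnj s * p $ None)))"
      using cser_sums[OF sw[OF True]] by (intro sums_mult) (simp only: sums_cnj)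
    then show ?thesis using True by (simp add: sums_iff)
  qed simp
  have "(\<lambda>k. b k * s ^ k) sums bergman_inner H h (\<lambda>p. cser (cnj s * p $ None))"
    using sums1 unfolding f_val sums2 bergman_inner_def set_lebesgue_integral_def .
  moreover have "(\<lambda>k. b k * s ^ k) sums h (pt 0 s)"
    using holomorphic_power_series[OF hol, of s] s by (simp add: b_def)
  ultimately show ?thesis by (rule sums_unique2)
qed

end

section \<open>The Bergman kernel\<close>

lemma hinner_minus_right: "hinner z (- a) = - hinner z a"
  by (simp add: hinner_def sum_negf)

lemma two_Re_hinner_le: "2 * Re (hinner z a) \<le> (norm z)\<^sup>2 + (norm a)\<^sup>2"
  using norm_sq_add[of z "- a"] zero_le_power2[of "norm (z + - a)"] by (simp add: hinner_minus_right)

context hartogs_space begin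

text \<open>This is the kernel on the w-axis carried to the point \<open>p\<close> by the automorphism \<open>shift (zpart p)\<close>,
  multiplied out.\<close>

definition kern :: "complex^('n option) \<Rightarrow> complex^('n option) \<Rightarrow> complex" where
  "kern p q = exp (hinner (zpart q) (zpart p)) * cser (q $ None * cnj (p $ None) * exp (hinner (zpart q) (zpart p)))"

text \<open>The unitary operator on the Bergman space induced by an automorphism: composition, times the
  Jacobian.\<close>

definition weighted_shift :: "complex^'n \<Rightarrow> (complex^('n option) \<Rightarrow> complex) \<Rightarrow> complex^('n option) \<Rightarrow> complex" where
  "weighted_shift a f = (\<lambda>p. f (shift a p) * shift_factor a (zpart p))"

definition rser :: "real \<Rightarrow> real" where "rser t = (\<Sum>k. coef k * t ^ k)"

lemma shift_in_H: "shift a p \<in> H \<longleftrightarrow> p \<in> H"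
  by (simp add: H_eq shift_in_hartogs)

text \<open>The squared modulus is at most \<open>rho q * rho p\<close>, because \<open>2 Re \<langle>z, a\<rangle> \<le> |z|\<^sup>2 + |a|\<^sup>2\<close>.\<close>

lemma kern_argument_in_disc:
  assumes "p \<in> H" "q \<in> H"
  shows "cmod (q $ None * cnj (p $ None) * exp (hinner (zpart q) (zpart p))) < 1"
proof -
  let ?x = "q $ None * cnj (p $ None) * exp (hinner (zpart q) (zpart p))"
  have "(cmod ?x)\<^sup>2 = (cmod (q $ None))\<^sup>2 * (cmod (p $ None))\<^sup>2 * exp (2 * Re (hinner (zpart q) (zpart p)))"
    by (simp add: norm_mult power_mult_distrib exp_double[symmetric] power2_eq_square[of "exp _"] exp_add[symmetric])
  also have "\<dots> \<le> (cmod (q $ None))\<^sup>2 * (cmod (p $ None))\<^sup>2 * exp ((norm (zpart q))\<^sup>2 + (norm (zpart p))\<^sup>2)"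
    using two_Re_hinner_le by (intro mult_left_mono) auto
  also have "\<dots> = rho q * rho p" by (simp add: rho_def exp_add)
  also have "\<dots> < 1 * 1"
    using assms rho_nonneg[of p] rho_nonneg[of q] by (intro mult_strict_mono') (auto simp: H_eq hartogs_def)
  finally have "(cmod ?x)\<^sup>2 < 1\<^sup>2" by simp
  then show ?thesis by (rule power2_less_imp_less) simp
qed

lemma cser_differentiable: "cmod z < 1 \<Longrightarrow> cser field_differentiable at z"
  using holomorphic_on_imp_differentiable_at[OF cser_holomorphic open_ball, of z] by simp

lemma kern_holo:
  assumes p: "p \<in> H" shows "holo_fun_on H (kern p)"
proof -
  have e: "holo_fun_on H (\<lambda>q. exp (hinner (zpart q) (zpart p)))"
    by (rule holo_fun_on_compose[OF holo_fun_on_hinner_zpart])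
      (rule holomorphic_on_imp_differentiable_at[OF holomorphic_on_exp open_UNIV], simp)
  have "holo_fun_on H (\<lambda>q. cser (q $ None * cnj (p $ None) * exp (hinner (zpart q) (zpart p))))"
    by (rule holo_fun_on_compose)
      (auto intro!: holo_fun_on_mult holo_fun_on_nth holo_fun_on_const e cser_differentiable kern_argument_in_disc p)
  with e show ?thesis unfolding kern_def by (rule holo_fun_on_mult)
qed

lemma axis_kernel_closed:
  assumes s: "cmod s < 1" shows "(\<lambda>p. cser (cnj s * p $ None)) \<in> bergman_space H"
proof (rule bergman_space_bounded)
  have sw: "cmod (cnj s * p $ None) \<le> cmod s" if "p \<in> H" for p
    using w_less_1[OF that] by (simp add: norm_mult mult_left_le)
  show "holo_fun_on H (\<lambda>p. cser (cnj s * p $ None))"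
    by (rule holo_fun_on_compose)
      (use sw s in \<open>auto intro!: holo_fun_on_mult holo_fun_on_nth holo_fun_on_const cser_differentiable intro: le_less_trans\<close>)
  show "cmod (cser (cnj s * p $ None)) \<le> (\<Sum>k. coef k * cmod s ^ k)" if "p \<in> H" for p
    by (rule cser_bound[OF sw[OF that] s])
qed

lemma weighted_shift_holo: "holo_fun_on H f \<Longrightarrow> holo_fun_on H (weighted_shift a f)"
  unfolding weighted_shift_def
  by (intro holo_fun_on_mult holo_fun_on_shift_factor holo_fun_on_compose_map[OF holo_map_on_shift, where f=f and T=H])
    (simp_all add: shift_in_H)

lemma weighted_shift_closed:
  assumes f: "holo_fun_on H f"
  shows "weighted_shift a f \<in> bergman_space H \<longleftrightarrow> f \<in> bergman_space H"
proof -
  let ?F = "\<lambda>q. indicator H q *\<^sub>R (cmod (f q))\<^sup>2"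
  have "?F \<in> borel_measurable borel"
    using measurable_on_H[of "\<lambda>q. (cmod (f q))\<^sup>2"] holo_fun_on_imp_continuous_on[OF f] by (simp add: continuous_intros)
  from change_of_variables_shift(1)[OF this, of a]
  have "integrable lborel ?F \<longleftrightarrow> integrable lborel (\<lambda>p. (cmod (shift_factor a (zpart p)))\<^sup>2 *\<^sub>R ?F (shift a p))" .
  also have "(\<lambda>p. (cmod (shift_factor a (zpart p)))\<^sup>2 *\<^sub>R ?F (shift a p)) = (\<lambda>p. indicator H p *\<^sub>R (cmod (weighted_shift a f p))\<^sup>2)"
    by (rule ext) (simp add: indicator_def shift_in_H weighted_shift_def norm_mult power_mult_distrib)
  finally show ?thesis
    using f weighted_shift_holo[OF f, of a] by (simp add: bergman_space_def set_integrable_def)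
qed

lemma weighted_shift_isometry:
  assumes "f \<in> bergman_space H" "g \<in> bergman_space H"
  shows "bergman_inner H (weighted_shift a f) (weighted_shift a g) = bergman_inner H f g"
proof -
  let ?F = "\<lambda>q. indicator H q *\<^sub>R (f q * cnj (g q))"
  have "?F \<in> borel_measurable borel"
    using measurable_on_H[of "\<lambda>q. f q * cnj (g q)"] bergman_spaceD(2)[OF assms(1)] bergman_spaceD(2)[OF assms(2)]
    by (simp add: continuous_intros)
  from change_of_variables_shift(2)[OF this, of a]
  have "integral\<^sup>L lborel ?F = (\<integral>p. (cmod (shift_factor a (zpart p)))\<^sup>2 *\<^sub>R ?F (shift a p) \<partial>lborel)" .
  also have "(\<lambda>p. (cmod (shift_factor a (zpart p)))\<^sup>2 *\<^sub>R ?F (shift a p))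
      = (\<lambda>p. indicator H p *\<^sub>R (weighted_shift a f p * cnj (weighted_shift a g p)))"
  proof
    fix p
    have "(cmod (shift_factor a (zpart p)))\<^sup>2 *\<^sub>R x = shift_factor a (zpart p) * cnj (shift_factor a (zpart p)) * x" for x :: complex
      unfolding complex_norm_square[symmetric] scaleR_conv_of_real ..
    then show "(cmod (shift_factor a (zpart p)))\<^sup>2 *\<^sub>R ?F (shift a p)
        = indicator H p *\<^sub>R (weighted_shift a f p * cnj (weighted_shift a g p))"
      by (simp add: indicator_def shift_in_H weighted_shift_def)
  qed
  finally show ?thesis by (simp add: bergman_inner_def set_lebesgue_integral_def)
qed

lemma bergman_inner_scale: "bergman_inner H (\<lambda>p. c * f p) g = c * bergman_inner H f g"
  unfolding bergman_inner_def set_lebesgue_integral_def integral_mult_right_zero[symmetric]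
  by (intro Bochner_Integration.integral_cong) (simp_all add: mult.assoc)

lemma bergman_inner_sym: "bergman_inner H g f = cnj (bergman_inner H f g)"
proof -
  have "cnj (bergman_inner H f g) = (\<integral>p. cnj (indicator H p *\<^sub>R (f p * cnj (g p))) \<partial>lborel)"
    unfolding bergman_inner_def set_lebesgue_integral_def by (rule Bochner_Integration.integral_cnj[symmetric])
  also have "\<dots> = bergman_inner H g f"
    unfolding bergman_inner_def set_lebesgue_integral_def
    by (intro Bochner_Integration.integral_cong) (simp_all add: mult.commute)
  finally show ?thesis ..
qed

lemma bergman_inner_add:
  assumes "f \<in> bergman_space H" "g \<in> bergman_space H" "h \<in> bergman_space H"
  shows "bergman_inner H (\<lambda>p. f p + g p) h = bergman_inner H f h + bergman_inner H g h"
  unfolding bergman_inner_def distrib_right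
  using bergman_integrable[OF assms(1,3)] bergman_integrable[OF assms(2,3)] by (rule set_integral_add)

lemma weighted_shift_kern:
  "weighted_shift (zpart p) (kern p) =
    (\<lambda>q. of_real (exp ((norm (zpart p))\<^sup>2 / 2)) * cser (cnj (p $ None * of_real (exp ((norm (zpart p))\<^sup>2 / 2))) * q $ None))"
proof
  fix q
  let ?a = "zpart p"
  let ?e = "exp (hinner (zpart q + ?a) ?a)" and ?j = "shift_factor ?a (zpart q)"
  have ej: "?e * ?j = of_real (exp ((norm ?a)\<^sup>2 / 2))"
    unfolding shift_factor_def hinner_add_left hinner_self exp_add[symmetric] exp_of_real[symmetric]
    by (simp add: field_simps)
  have "weighted_shift ?a (kern p) q = (?e * ?j) * cser (cnj (p $ None) * (?e * ?j) * q $ None)"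
    unfolding weighted_shift_def kern_def shift_def by (simp add: mult_ac)
  then show "weighted_shift ?a (kern p) q =
      of_real (exp ((norm ?a)\<^sup>2 / 2)) * cser (cnj (p $ None * of_real (exp ((norm ?a)\<^sup>2 / 2))) * q $ None)"
    unfolding ej by simp
qed

lemma axis_representative:
  fixes p :: "complex^('n option)"
  defines "s \<equiv> p $ None * of_real (exp ((norm (zpart p))\<^sup>2 / 2))"
  shows "shift (zpart p) (pt 0 s) = p" "shift_factor (zpart p) 0 = of_real (exp (- ((norm (zpart p))\<^sup>2 / 2)))"
    "p \<in> H \<Longrightarrow> cmod s < 1"
proof -
  show 1: "shift_factor (zpart p) 0 = of_real (exp (- ((norm (zpart p))\<^sup>2 / 2)))"
    unfolding shift_factor_def exp_of_real[symmetric] by simp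
  have "s * shift_factor (zpart p) 0 = p $ None"
    unfolding 1 s_def mult.assoc of_real_mult[symmetric] exp_add[symmetric] by simp
  then show 2: "shift (zpart p) (pt 0 s) = p" by (simp add: shift_def)
  assume "p \<in> H"
  then have "pt 0 s \<in> H" using shift_in_H[of "zpart p" "pt 0 s"] by (simp add: 2)
  then show "cmod s < 1" by (simp add: H_eq hartogs_w_axis)
qed

lemma kern_closed:
  assumes p: "p \<in> H" shows "kern p \<in> bergman_space H"
proof -
  have "weighted_shift (zpart p) (kern p) \<in> bergman_space H"
    unfolding weighted_shift_kern by (intro bergman_scale axis_kernel_closed axis_representative p)
  then show ?thesis using weighted_shift_closed[OF kern_holo[OF p]] by simp
qed

text \<open>The isometry moves \<open>p\<close> to the w-axis, where the reproducing property is known.\<close>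

lemma kern_reproducing:
  assumes h: "h \<in> bergman_space H" and p: "p \<in> H"
  shows "bergman_inner H h (kern p) = h p"
proof -
  define s where "s = p $ None * of_real (exp ((norm (zpart p))\<^sup>2 / 2))"
  let ?E = "complex_of_real (exp ((norm (zpart p))\<^sup>2 / 2))"
  note s = axis_representative[of p, folded s_def]
  let ?h = "weighted_shift (zpart p) h"
  have hh: "?h \<in> bergman_space H" using weighted_shift_closed[OF bergman_spaceD(1)[OF h]] h by blast
  have "bergman_inner H h (kern p) = bergman_inner H ?h (weighted_shift (zpart p) (kern p))"
    by (rule weighted_shift_isometry[symmetric, OF h kern_closed[OF p]])
  also have "\<dots> = cnj (bergman_inner H (\<lambda>q. ?E * cser (cnj s * q $ None)) ?h)"
    unfolding weighted_shift_kern s_def by (rule bergman_inner_sym)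
  also have "\<dots> = ?E * bergman_inner H ?h (\<lambda>q. cser (cnj s * q $ None))"
    unfolding bergman_inner_scale bergman_inner_sym[of ?h] by simp
  also have "\<dots> = ?E * ?h (pt 0 s)"
    by (simp only: reproducing_on_w_axis[OF hh s(3)[OF p]])
  also have "\<dots> = h p"
    by (simp add: weighted_shift_def s(1,2) exp_minus)
  finally show ?thesis .
qed

end

sublocale hartogs_space \<subseteq> kernel_space "bergman_space H" "bergman_inner H" H kern
proof (unfold_locales, goal_cases)
  case 1 then show ?case by (rule bergman_zero)
next
  case (2 f g) then show ?case by (rule bergman_add)
next
  case (3 f c) then show ?case by (rule bergman_scale)
next
  case (4 f g h) then show ?case by (rule bergman_inner_add)
next
  case (5 f g c) then show ?case by (simp only: bergman_inner_scale)
next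
  case (6 f g) show ?case by (rule bergman_inner_sym)
next
  case (7 f)
  show ?case
    unfolding bergman_inner_self[OF 7] set_lebesgue_integral_def Re_complex_of_real
    by (rule Bochner_Integration.integral_nonneg) simp
next
  case (8 p) then show ?case by (rule kern_closed)
next
  case (9 h p) then show ?case by (rule kern_reproducing)
qed

context hartogs_space begin

lemma sqn_eq: "f \<in> bergman_space H \<Longrightarrow> sqn f = set_lebesgue_integral lborel H (\<lambda>p. (cmod (f p))\<^sup>2)"
  by (simp add: sqn_def bergman_inner_self)

lemma ennreal_sqn:
  assumes f: "f \<in> bergman_space H"
  shows "ennreal (sqn f) = (\<integral>\<^sup>+p. ennreal (indicator H p *\<^sub>R (cmod (f p))\<^sup>2) \<partial>lborel)"
  unfolding sqn_eq[OF f] set_lebesgue_integral_def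
  using bergman_spaceD(3)[OF f] unfolding set_integrable_def
  by (intro nn_integral_eq_integral[symmetric]) simp_all

lemma rser_sums:
  assumes "\<bar>t\<bar> < 1" shows "(\<lambda>k. coef k * t ^ k) sums rser t"
proof -
  have "summable (\<lambda>k. norm (coef k * t ^ k))"
    using coef_summable[of "\<bar>t\<bar>"] assms coef_pos by (simp add: abs_mult power_abs less_imp_le)
  then show ?thesis unfolding rser_def by (rule summable_sums[OF summable_norm_cancel])
qed

lemma cser_of_real:
  assumes "\<bar>t\<bar> < 1" shows "cser (of_real t) = of_real (rser t)"
proof -
  have "(\<lambda>k. of_real (coef k * t ^ k)) sums (of_real (rser t) :: complex)"
    using rser_sums[OF assms] by (simp only: sums_of_real_iff)
  then show ?thesis unfolding cser_def by (simp add: sums_iff)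
qed

lemma kern_diagonal:
  "kern p p = of_real (exp ((norm (zpart p))\<^sup>2)) * cser (of_real (rho p))"
proof -
  have "p $ None * cnj (p $ None) * exp (hinner (zpart p) (zpart p)) = of_real (rho p)"
    unfolding hinner_self exp_of_real complex_norm_square[symmetric] rho_def by simp
  then show ?thesis unfolding kern_def by (simp only: hinner_self exp_of_real)
qed

lemma rho_in_unit: "p \<in> H \<Longrightarrow> \<bar>rho p\<bar> < 1"
  using rho_nonneg[of p] by (simp add: H_eq hartogs_def)

lemma sqn_kern: "p \<in> H \<Longrightarrow> sqn (kern p) = exp ((norm (zpart p))\<^sup>2) * rser (rho p)"
  by (simp add: sqn_kernel kern_diagonal cser_of_real rho_in_unit flip: of_real_mult)

text \<open>The squared distance of two kernels is expressed by values of the kernel, all of which are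
  continuous.\<close>

lemma kern_approximation:
  assumes q: "q \<in> H" and e: "\<epsilon> > 0"
  obtains U where "open U" "q \<in> U" "U \<subseteq> H" "\<And>p. p \<in> U \<Longrightarrow> sqn (\<lambda>x. kern q x - kern p x) < \<epsilon>"
proof -
  let ?\<Phi> = "\<lambda>p. Re (kern q q) + Re (kern p p) - 2 * Re (kern q p)"
  have eq: "sqn (\<lambda>x. kern q x - kern p x) = ?\<Phi> p" if p: "p \<in> H" for p
    using sqn_minus[OF kern_closed[OF q] kern_closed[OF p]] kern_reproducing[OF kern_closed[OF q] p]
    by (simp add: sqn_kernel p q)
  have cq: "continuous_on H (kern q)" by (rule holo_fun_on_imp_continuous_on[OF kern_holo[OF q]])
  have cc: "continuous_on (ball 0 1) cser" by (rule holomorphic_on_imp_continuous_on[OF cser_holomorphic])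
  have "continuous_on H (\<lambda>p. kern p p)"
    unfolding kern_diagonal
    by (intro continuous_intros continuous_on_compose2[OF cc] continuous_on_rho) (use rho_in_unit in auto)
  then have "continuous_on H ?\<Phi>" by (intro continuous_intros cq)
  then have "open (H \<inter> ?\<Phi> -` {..<\<epsilon>})" by (rule continuous_open_preimage[OF _ open_H]) simp
  then show ?thesis using q e eq by (intro that[of "H \<inter> ?\<Phi> -` {..<\<epsilon>}"]) auto
qed

text \<open>The orthonormal family is the union of the chain obtained from a dense sequence of points. The
  residuals tend to zero pointwise and are Cauchy in norm, so Fatou's lemma, applied to
  \<open>|r\<^sub>j - r\<^sub>i|\<^sup>2\<close> as \<open>i\<close> grows, bounds the norm of \<open>r\<^sub>j\<close>.\<close>

lemma bergman_onb_exists: "\<exists>B. bergman_onb H B"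
proof -
  obtain D :: "(complex^('n option)) set" where D: "countable D" "\<And>X. open X \<Longrightarrow> X \<noteq> {} \<Longrightarrow> \<exists>d\<in>D. d \<in> X"
    using countable_dense_setE by blast
  have ne: "D \<inter> H \<noteq> {}" using D(2)[OF open_H] zero_in_hartogs by (auto simp: H_eq)
  have cD: "countable (D \<inter> H)" using D(1) by simp
  define p where "p = from_nat_into (D \<inter> H)"
  have range_p: "range p = D \<inter> H" unfolding p_def by (rule range_from_nat_into[OF ne cD])
  have pH: "p i \<in> H" for i using range_p by auto
  have approx: "\<exists>i. sqn (\<lambda>x. kern q x - kern (p i) x) < \<epsilon>" if q: "q \<in> H" and e: "\<epsilon> > 0" for q \<epsilon>
  proof -
    obtain U where U: "open U" "q \<in> U" "U \<subseteq> H" "\<And>p. p \<in> U \<Longrightarrow> sqn (\<lambda>x. kern q x - kern p x) < \<epsilon>"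
      using kern_approximation[OF q e] by blast
    then obtain d where "d \<in> D" "d \<in> U" using D(2)[of U] by auto
    moreover from this obtain i where "d = p i" using range_p U(3) by blast
    ultimately show ?thesis using U(4) by blast
  qed
  obtain E where fin: "\<And>i. finite (E i)" and on: "\<And>i. orthonormal (E i)" and mono: "\<And>i j. i \<le> j \<Longrightarrow> E i \<subseteq> E j"
    and lim: "\<And>h q. h \<in> bergman_space H \<Longrightarrow> q \<in> H \<Longrightarrow> (\<lambda>i. residual (E i) h q) \<longlonglongrightarrow> 0"
    and cau: "\<And>h \<epsilon>. h \<in> bergman_space H \<Longrightarrow> \<epsilon> > 0 \<Longrightarrow> \<exists>j. \<forall>i\<ge>j. sqn (\<lambda>x. residual (E j) h x - residual (E i) h x) < \<epsilon>"
    using dense_kernels_chain[of p, OF pH approx] by blast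
  let ?B = "\<Union>i. E i"
  have "bergman_onb H ?B"
    unfolding bergman_onb_def
  proof (intro conjI ballI allI impI)
    show "?B \<subseteq> bergman_space H" using on by (auto simp: orthonormal_def)
    fix f g assume "f \<in> ?B" "g \<in> ?B"
    then obtain i j where "f \<in> E i" "g \<in> E j" by blast
    then have "f \<in> E (max i j)" "g \<in> E (max i j)"
      using mono[of i "max i j"] mono[of j "max i j"] by auto
    then show "bergman_inner H f g = (if f = g then 1 else 0)"
      using on[of "max i j"] by (simp add: orthonormal_def)
  next
    fix h and \<epsilon> :: real assume h: "h \<in> bergman_space H" and e: "\<epsilon> > 0"
    obtain j where j: "\<And>i. i \<ge> j \<Longrightarrow> sqn (\<lambda>x. residual (E j) h x - residual (E i) h x) < \<epsilon> / 2"
      using cau[OF h, of "\<epsilon> / 2"] e by auto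
    let ?r = "\<lambda>i. residual (E i) h"
    let ?u = "\<lambda>i p. ennreal (indicator H p *\<^sub>R (cmod (?r j p - ?r i p))\<^sup>2)"
    have rV: "?r i \<in> bergman_space H" for i by (rule residual_closed[OF fin on h])
    have dV: "(\<lambda>x. ?r j x - ?r i x) \<in> bergman_space H" for i by (rule minus_closed[OF rV rV])
    have u_meas: "?u i \<in> borel_measurable lborel" for i
      using bergman_spaceD(2)[OF rV]
      by (intro measurable_compose[OF _ measurable_ennreal] measurable_on_H continuous_intros)
    have "ennreal (sqn (?r j)) = (\<integral>\<^sup>+p. ennreal (indicator H p *\<^sub>R (cmod (?r j p))\<^sup>2) \<partial>lborel)"
      by (rule ennreal_sqn[OF rV])
    also have "\<dots> = (\<integral>\<^sup>+p. liminf (\<lambda>i. ?u i p) \<partial>lborel)"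
    proof (rule nn_integral_cong)
      fix p
      have "(\<lambda>i. indicator H p *\<^sub>R (cmod (?r j p - ?r i p))\<^sup>2) \<longlonglongrightarrow> indicator H p *\<^sub>R (cmod (?r j p))\<^sup>2"
      proof (cases "p \<in> H")
        case True
        have "(\<lambda>i. indicator H p *\<^sub>R (cmod (?r j p - ?r i p))\<^sup>2) \<longlonglongrightarrow> indicator H p *\<^sub>R (cmod (?r j p - 0))\<^sup>2"
          by (intro tendsto_intros lim h True)
        then show ?thesis by simp
      qed simp
      then have "(\<lambda>i. ?u i p) \<longlonglongrightarrow> ennreal (indicator H p *\<^sub>R (cmod (?r j p))\<^sup>2)"
        by (rule tendsto_ennrealI)
      then show "ennreal (indicator H p *\<^sub>R (cmod (?r j p))\<^sup>2) = liminf (\<lambda>i. ?u i p)"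
        by (intro lim_imp_Liminf[symmetric]) simp_all
    qed
    also have "\<dots> \<le> liminf (\<lambda>i. \<integral>\<^sup>+p. ?u i p \<partial>lborel)"
      by (rule nn_integral_liminf[OF u_meas])
    also have "\<dots> \<le> limsup (\<lambda>i. \<integral>\<^sup>+p. ?u i p \<partial>lborel)"
      by (rule Liminf_le_Limsup) simp
    also have "\<dots> \<le> ennreal (\<epsilon> / 2)"
    proof (rule Limsup_bounded)
      show "\<forall>\<^sub>F i in sequentially. (\<integral>\<^sup>+p. ?u i p \<partial>lborel) \<le> ennreal (\<epsilon> / 2)"
        using eventually_ge_at_top[of j]
      proof eventually_elim
        case (elim i)
        then show ?case unfolding ennreal_sqn[OF dV, symmetric] using j[OF elim] by (intro ennreal_leI) simp
      qed
    qed
    finally have "sqn (?r j) \<le> \<epsilon> / 2" using e by (simp add: ennreal_le_iff)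
    then have "set_lebesgue_integral lborel H (\<lambda>p. (cmod (?r j p))\<^sup>2) < \<epsilon>"
      using e unfolding sqn_eq[OF rV] by linarith
    then show "\<exists>F c. finite F \<and> F \<subseteq> ?B \<and> (LINT p:H|lborel. (cmod (h p - (\<Sum>f\<in>F. c f * f p)))\<^sup>2) < \<epsilon>"
      using fin[of j] unfolding residual_def lincomb_def
      by (intro exI[of _ "E j"] exI[of _ "bergman_inner H h"]) blast
  qed
  then show ?thesis by blast
qed

lemma bergman_kernel_eq:
  assumes p: "p \<in> H"
  shows "bergman_kernel H p = exp ((norm (zpart p))\<^sup>2) * rser (rho p)"
proof -
  define B where "B = (SOME B. bergman_onb H B)"
  have B: "bergman_onb H B" unfolding B_def by (rule someI_ex[OF bergman_onb_exists])
  then have on: "orthonormal B" by (simp add: bergman_onb_def orthonormal_def)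
  have "((\<lambda>f. (cmod (f p))\<^sup>2) has_sum sqn (kern p)) B"
  proof (rule orthonormal_basis_has_sum_kernel[OF on _ p])
    fix h and \<epsilon> :: real assume h: "h \<in> bergman_space H" and e: "\<epsilon> > 0"
    then obtain F c where F: "finite F" "F \<subseteq> B"
      "(LINT p:H|lborel. (cmod (h p - (\<Sum>f\<in>F. c f * f p)))\<^sup>2) < \<epsilon>"
      using B unfolding bergman_onb_def by blast
    have "(\<lambda>x. h x - lincomb F c x) \<in> bergman_space H"
      using F on by (intro minus_closed lincomb_closed h) (auto simp: orthonormal_def)
    from sqn_eq[OF this] F show "\<exists>F c. finite F \<and> F \<subseteq> B \<and> sqn (\<lambda>x. h x - lincomb F c x) < \<epsilon>"
      by (intro exI[of _ F] exI[of _ c]) (simp add: lincomb_def)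
  qed
  then show ?thesis unfolding bergman_kernel_def B_def[symmetric] by (simp add: infsumI sqn_kern[OF p])
qed

end

section \<open>Rules for maps of class \<open>C\<^sup>k\<close>\<close>

lemma frechet_derivative_eq: "(f has_derivative f') (at p) \<Longrightarrow> frechet_derivative f (at p) = f'"
  by (rule frechet_derivative_at[symmetric])

lemma Ck_on_cong:
  assumes S: "open S" and eq: "\<And>p. p \<in> S \<Longrightarrow> f p = g p" and f: "Ck_on k S f"
  shows "Ck_on k S g"
  using eq f
proof (induction k arbitrary: f g)
  case 0 then show ?case using continuous_on_cong[of S S f g] by simp
next
  case (Suc k)
  have d: "(g has_derivative frechet_derivative f (at p)) (at p)" if p: "p \<in> S" for p
  proof -
    have "(f has_derivative frechet_derivative f (at p)) (at p)"
      using Suc.prems(2) p by (simp add: frechet_derivative_works[symmetric])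
    then show ?thesis by (rule has_derivative_transform_within_open[OF _ S p]) (rule Suc.prems(1))
  qed
  have "Ck_on k S (\<lambda>p. frechet_derivative g (at p) v)" for v
  proof (rule Suc.IH)
    show "Ck_on k S (\<lambda>p. frechet_derivative f (at p) v)" using Suc.prems(2) by simp
    show "frechet_derivative f (at p) v = frechet_derivative g (at p) v" if "p \<in> S" for p
      using frechet_derivative_eq[OF d[OF that]] by simp
  qed
  then show ?case using d by (auto simp: differentiable_def)
qed

lemma Ck_on_SucI:
  assumes S: "open S" and d: "\<And>p. p \<in> S \<Longrightarrow> (f has_derivative f' p) (at p)" and c: "\<And>v. Ck_on k S (\<lambda>p. f' p v)"
  shows "Ck_on (Suc k) S f"
proof -
  have "Ck_on k S (\<lambda>p. frechet_derivative f (at p) v)" for v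
    by (rule Ck_on_cong[OF S _ c[of v]]) (simp add: frechet_derivative_eq[OF d])
  then show ?thesis using d by (auto simp: differentiable_def)
qed

lemma Ck_on_SucD:
  assumes "Ck_on (Suc k) S f"
  shows "\<And>p. p \<in> S \<Longrightarrow> (f has_derivative frechet_derivative f (at p)) (at p)"
    and "\<And>v. Ck_on k S (\<lambda>p. frechet_derivative f (at p) v)"
  using assms by (simp_all add: frechet_derivative_works[symmetric])

lemma Ck_on_Suc_imp: "Ck_on (Suc k) S f \<Longrightarrow> Ck_on k S f"
proof (induction k arbitrary: f)
  case 0
  then have "\<forall>p\<in>S. isCont f p" by (simp add: differentiable_imp_continuous_within)
  then show ?case by (simp add: continuous_at_imp_continuous_on)
next
  case (Suc k)
  then have "\<forall>p\<in>S. f differentiable (at p)" "\<And>v. Ck_on (Suc k) S (\<lambda>p. frechet_derivative f (at p) v)"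
    by auto
  then show ?case using Suc.IH by simp
qed

lemma Ck_on_const: "open S \<Longrightarrow> Ck_on k S (\<lambda>p. c)"
proof (induction k arbitrary: c)
  case (Suc k)
  show ?case by (rule Ck_on_SucI[OF Suc.prems, where f'="\<lambda>p v. 0"]) (auto intro: Suc)
qed simp

lemma Ck_on_add:
  assumes "open S" shows "Ck_on k S f \<Longrightarrow> Ck_on k S g \<Longrightarrow> Ck_on k S (\<lambda>p. f p + g p)"
proof (induction k arbitrary: f g)
  case 0 then show ?case by (simp add: continuous_intros)
next
  case (Suc k)
  note f = Ck_on_SucD[OF Suc.prems(1)] and g = Ck_on_SucD[OF Suc.prems(2)]
  show ?case
    by (rule Ck_on_SucI[OF assms has_derivative_add[OF f(1) g(1)]]) (auto intro: Suc.IH f(2) g(2))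
qed

lemma Ck_on_sum:
  assumes "open S" "\<And>i. i \<in> I \<Longrightarrow> Ck_on k S (f i)" shows "Ck_on k S (\<lambda>p. \<Sum>i\<in>I. f i p)"
proof (cases "finite I")
  case True then show ?thesis using assms(2)
    by (induction I rule: finite_induct) (auto intro: Ck_on_const Ck_on_add assms(1))
qed (simp add: Ck_on_const assms(1))

lemma Ck_on_bounded_linear:
  assumes S: "open S" and L: "bounded_linear L" shows "Ck_on k S f \<Longrightarrow> Ck_on k S (\<lambda>p. L (f p))"
proof (induction k arbitrary: f)
  case 0 then show ?case by (simp add: bounded_linear.continuous_on[OF L])
next
  case (Suc k)
  note f = Ck_on_SucD[OF Suc.prems]
  show ?case
    by (rule Ck_on_SucI[OF S bounded_linear.has_derivative[OF L f(1)]]) (auto intro: Suc.IH f(2))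
qed

lemma Ck_on_id: "open S \<Longrightarrow> Ck_on k S (\<lambda>p. p)"
proof (cases k)
  case (Suc j)
  assume S: "open S"
  show ?thesis
    unfolding Suc by (rule Ck_on_SucI[OF S, where f'="\<lambda>p v. v"]) (rule has_derivative_ident, rule Ck_on_const[OF S])
qed simp

lemma Ck_on_bilinear:
  assumes S: "open S" and B: "bounded_bilinear B"
  shows "Ck_on k S f \<Longrightarrow> Ck_on k S g \<Longrightarrow> Ck_on k S (\<lambda>p. B (f p) (g p))"
proof (induction k arbitrary: f g)
  case 0 then show ?case by (simp add: bounded_bilinear.continuous_on[OF B])
next
  case (Suc k)
  note f = Ck_on_SucD[OF Suc.prems(1)] and g = Ck_on_SucD[OF Suc.prems(2)]
  note low = Ck_on_Suc_imp[OF Suc.prems(1)] Ck_on_Suc_imp[OF Suc.prems(2)]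
  show ?case
  proof (rule Ck_on_SucI[OF S bounded_bilinear.FDERIV[OF B f(1) g(1)]])
    fix v
    show "Ck_on k S (\<lambda>p. B (f p) (frechet_derivative g (at p) v) + B (frechet_derivative f (at p) v) (g p))"
      by (rule Ck_on_add[OF S Suc.IH[OF low(1) g(2)] Suc.IH[OF f(2) low(2)]])
  qed
qed

lemmas Ck_on_mult = Ck_on_bilinear[OF _ bounded_bilinear_mult]

text \<open>Indexing all derivatives of the outer function makes the induction on \<open>k\<close> go through, as one
  step replaces \<open>F j\<close> by \<open>F (Suc j)\<close>.\<close>

lemma Ck_on_real_compose:
  fixes F :: "nat \<Rightarrow> real \<Rightarrow> real"
  assumes S: "open S" and F: "\<And>j x. x \<in> I \<Longrightarrow> (F j has_field_derivative F (Suc j) x) (at x)"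
    and fI: "\<And>p. p \<in> S \<Longrightarrow> f p \<in> I"
  shows "Ck_on k S f \<Longrightarrow> Ck_on k S (\<lambda>p. F j (f p))"
proof (induction k arbitrary: j)
  case 0
  have "continuous_on I (F j)"
    using F by (intro continuous_at_imp_continuous_on ballI) (blast intro: DERIV_isCont)
  then show ?case using 0 fI by (auto intro: continuous_on_compose2)
next
  case (Suc k)
  note f = Ck_on_SucD[OF Suc.prems]
  show ?case
  proof (rule Ck_on_SucI[OF S])
    fix p assume p: "p \<in> S"
    show "((\<lambda>p. F j (f p)) has_derivative (\<lambda>v. F (Suc j) (f p) * frechet_derivative f (at p) v)) (at p)"
      using has_derivative_compose[OF f(1)[OF p] F[OF fI[OF p], unfolded has_field_derivative_def]] .
  next
    fix v show "Ck_on k S (\<lambda>p. F (Suc j) (f p) * frechet_derivative f (at p) v)"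
      by (rule Ck_on_mult[OF S Suc.IH[OF Ck_on_Suc_imp[OF Suc.prems]] f(2)])
  qed
qed

lemma Ck_on_exp:
  assumes "open S" "Ck_on k S f" shows "Ck_on k S (\<lambda>p. exp (f p :: real))"
  by (rule Ck_on_real_compose[where I=UNIV and F="\<lambda>j. exp", OF assms(1) _ _ assms(2)]) (auto intro: DERIV_exp)

lemma Ck_on_inverse:
  assumes S: "open S" and pos: "\<And>p. p \<in> S \<Longrightarrow> f p > 0" and f: "Ck_on k S f"
  shows "Ck_on k S (\<lambda>p. inverse (f p) :: real)"
proof -
  let ?F = "\<lambda>j x::real. (- 1) ^ j * fact j * inverse x ^ Suc j"
  have d: "(?F j has_field_derivative ?F (Suc j) x) (at x)" if "x \<in> {0<..}" for j x
  proof -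
    have "x \<noteq> 0" using that by simp
    then have "(?F j has_field_derivative (- 1) ^ j * fact j * (real (Suc j) * (- (inverse x ^ 2)) * inverse x ^ j)) (at x)"
      by (auto intro!: derivative_eq_intros simp: power2_eq_square algebra_simps simp del: power_Suc)
    also have "(- 1) ^ j * fact j * (real (Suc j) * (- (inverse x ^ 2)) * inverse x ^ j) = ?F (Suc j) x"
      by (simp add: power2_eq_square algebra_simps)
    finally show ?thesis .
  qed
  have "Ck_on k S (\<lambda>p. ?F 0 (f p))"
    by (rule Ck_on_real_compose[where I="{0<..}" and F="?F", OF S d _ f]) (use pos in simp_all)
  then show ?thesis by simp
qed

section \<open>The logarithm of the diagonal series\<close>

context hartogs_space begin

text \<open>The derivatives of \<open>rser\<close>, obtained termwise.\<close>

definition rder :: "nat \<Rightarrow> real \<Rightarrow> real" where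
  "rder j t = (\<Sum>k. (diffs ^^ j) coef k * t ^ k)"

lemma rder_summable: "\<bar>t\<bar> < 1 \<Longrightarrow> summable (\<lambda>k. (diffs ^^ j) coef k * t ^ k)"
proof (induction j arbitrary: t)
  case 0 then show ?case using rser_sums[of t] by (simp add: sums_iff)
next
  case (Suc j)
  then show ?case using termdiff_converges[of t 1 "(diffs ^^ j) coef"] by simp
qed

lemma rder_deriv: "\<bar>t\<bar> < 1 \<Longrightarrow> (rder j has_field_derivative rder (Suc j) t) (at t)"
  unfolding rder_def using termdiffs_strong'[of 1 "(diffs ^^ j) coef" t] rder_summable[of _ j] by simp

lemma rder_0: "rder 0 = rser"
  by (simp add: rder_def rser_def fun_eq_iff)

lemma rser_pos: assumes "0 \<le> t" "t < 1" shows "rser t > 0"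
proof -
  have "rser t \<ge> coef 0 * t ^ 0"
    using sum_le_suminf[OF sums_summable[OF rser_sums], of t "{0}"] assms coef_pos
    by (simp add: rser_def less_imp_le)
  then show ?thesis using coef_pos[of 0] by simp
qed

text \<open>The derivative of the logarithm of the diagonal series \<open>rser\<close>.\<close>

definition lder :: "real \<Rightarrow> real" where
  "lder t = rder 1 t / rder 0 t"

text \<open>With \<open>F\<close> the logarithm of \<open>rser\<close>, these are \<open>1 + t F'\<close> and \<open>(t F')'\<close>, the coefficients of the
  horizontal and of the vertical part of the metric.\<close>

definition hcoef :: "real \<Rightarrow> real" where
  "hcoef t = 1 + t * lder t"

definition vcoef :: "real \<Rightarrow> real" where
  "vcoef t = lder t + t * (rder 2 t / rder 0 t - (lder t)\<^sup>2)"

lemma first_moment_sums: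
  assumes "\<bar>t\<bar> < 1" shows "(\<lambda>k. real k * coef k * t ^ k) sums (t * rder 1 t)"
proof -
  have "(\<lambda>n. of_nat n * coef n * t ^ (n - Suc 0)) sums rder 1 t"
    unfolding rder_def using diffs_equiv[of coef t] rder_summable[OF assms, of 1] by simp
  from sums_mult[OF this, of t] have "(\<lambda>n. t * (real n * coef n * t ^ (n - Suc 0))) sums (t * rder 1 t)" .
  moreover have "t * (real n * coef n * t ^ (n - Suc 0)) = real n * coef n * t ^ n" for n
    by (cases n) simp_all
  ultimately show ?thesis by simp
qed

lemma second_moment_sums:
  assumes "\<bar>t\<bar> < 1" shows "(\<lambda>k. (real k)\<^sup>2 * coef k * t ^ k) sums (t * rder 1 t + t\<^sup>2 * rder 2 t)"
proof -
  let ?g = "\<lambda>k. real k * (real k - 1) * coef k * t ^ k"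
  have "(\<lambda>n. of_nat n * diffs coef n * t ^ (n - Suc 0)) sums rder 2 t"
    unfolding rder_def using diffs_equiv[of "diffs coef" t] rder_summable[OF assms, of 2] by (simp add: eval_nat_numeral)
  from sums_mult[OF this, of "t\<^sup>2"]
  have "(\<lambda>n. t\<^sup>2 * (real n * diffs coef n * t ^ (n - Suc 0))) sums (t\<^sup>2 * rder 2 t)" .
  moreover have "t\<^sup>2 * (real n * diffs coef n * t ^ (n - Suc 0)) = ?g (Suc n)" for n
    by (cases n) (simp_all add: diffs_def power2_eq_square algebra_simps)
  ultimately have "(\<lambda>n. ?g (Suc n)) sums (t\<^sup>2 * rder 2 t)" by simp
  then have "?g sums (t\<^sup>2 * rder 2 t)" by (subst (asm) sums_Suc_iff) simp
  from sums_add[OF first_moment_sums[OF assms] this] show ?thesis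
    by (simp add: power2_eq_square algebra_simps)
qed

text \<open>Let \<open>P\<close> be the series and \<open>x\<close> the mean of \<open>k\<close> for the weights \<open>coef k * t ^ k\<close>. Then
  \<open>t * P * vcoef t\<close> is, for \<open>t > 0\<close>, the sum of \<open>(k - x)\<^sup>2\<close> with these weights, an unnormalised
  variance. It vanishes only if a single term carries all the weight, but every coefficient is
  positive. At \<open>t = 0\<close> the value is \<open>coef 1 / coef 0\<close>.\<close>

lemma vcoef_pos:
  assumes t: "0 \<le> t" "t < 1" shows "vcoef t > 0"
proof (cases "t = 0")
  case True
  have "rder 1 0 = coef 1"
    unfolding rder_def using powser_sums_zero[of "diffs coef"] by (simp add: sums_iff diffs_def)
  then show ?thesis
    using True rser_pos[OF t] coef_pos[of 1] by (simp add: vcoef_def lder_def rder_0)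
next
  case False
  then have t0: "t > 0" and ta: "\<bar>t\<bar> < 1" using t by auto
  define P P1 P2 where "P = rder 0 t" and "P1 = rder 1 t" and "P2 = rder 2 t"
  have P: "P > 0" using rser_pos[OF t] by (simp add: P_def rder_0)
  define x where "x = t * P1 / P"
  have "(\<lambda>k. coef k * t ^ k) sums P" using rser_sums[OF ta] by (simp add: P_def rder_0)
  from sums_add[OF sums_diff[OF second_moment_sums[OF ta] sums_mult[OF first_moment_sums[OF ta], of "2 * x"]]
      sums_mult[OF this, of "x\<^sup>2"]]
  have s: "(\<lambda>k. (real k - x)\<^sup>2 * (coef k * t ^ k)) sums (t * P1 + t\<^sup>2 * P2 - 2 * x * (t * P1) + x\<^sup>2 * P)"
    unfolding P1_def P2_def by (simp add: power2_eq_square algebra_simps)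
  have pos: "0 < (\<Sum>k. (real k - x)\<^sup>2 * (coef k * t ^ k))"
  proof -
    \<comment> \<open>a term of the sum that is not zero\<close>
    define i :: nat where "i = (if x = 0 then 1 else 0)"
    have "(real i - x)\<^sup>2 > 0" by (simp add: i_def)
    then show ?thesis
      using suminf_pos2[OF sums_summable[OF s], of i] t0 coef_pos by (simp add: less_imp_le)
  qed
  have "t * P * vcoef t = t * P1 + t\<^sup>2 * P2 - 2 * x * (t * P1) + x\<^sup>2 * P"
  proof -
    have q: "vcoef t = P1 / P + t * (P2 / P - (P1 / P)\<^sup>2)"
      by (simp add: vcoef_def lder_def P_def P1_def P2_def)
    show ?thesis unfolding q using P by (simp add: x_def power2_eq_square field_simps)
  qed
  then have "t * P * vcoef t > 0" using pos sums_unique[OF s] by simp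
  then show ?thesis using zero_less_mult_pos[of "t * P" "vcoef t"] mult_pos_pos[OF t0 P] by blast
qed

lemma lder_nonneg: assumes t: "0 \<le> t" "t < 1" shows "lder t \<ge> 0"
proof -
  have "rder 1 t \<ge> 0"
    unfolding rder_def using rder_summable[of t 1] t coef_pos
    by (intro suminf_nonneg) (simp_all add: diffs_def less_imp_le)
  then show ?thesis using rser_pos[OF t] by (simp add: lder_def rder_0)
qed

lemma hcoef_pos: "0 \<le> t \<Longrightarrow> t < 1 \<Longrightarrow> hcoef t > 0"
  using lder_nonneg[of t] by (simp add: hcoef_def add_pos_nonneg)

lemma ln_rser_deriv:
  assumes "0 \<le> t" "t < 1" shows "((\<lambda>t. ln (rser t)) has_field_derivative lder t) (at t)"
proof -
  have "(rser has_field_derivative rder 1 t) (at t)" using rder_deriv[of t 0] assms by (simp add: rder_0)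
  from DERIV_chain2[OF DERIV_ln_divide[OF rser_pos[OF assms]] this]
  show ?thesis by (simp add: lder_def rder_0)
qed

lemma lder_deriv:
  assumes "0 \<le> t" "t < 1" shows "(lder has_field_derivative (rder 2 t / rder 0 t - (lder t)\<^sup>2)) (at t)"
proof -
  have "rder 0 t \<noteq> 0" using rser_pos[OF assms] by (simp add: rder_0)
  moreover have "(rder 0 has_field_derivative rder 1 t) (at t)" "(rder 1 has_field_derivative rder 2 t) (at t)"
    using rder_deriv[of t 0] rder_deriv[of t 1] assms by (simp_all add: numeral_2_eq_2)
  ultimately show ?thesis
    unfolding lder_def[abs_def] by (auto intro!: derivative_eq_intros simp: power2_eq_square field_simps)
qed

lemma hcoef_deriv:
  assumes "0 \<le> t" "t < 1" shows "(hcoef has_field_derivative vcoef t) (at t)"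
  unfolding hcoef_def[abs_def] vcoef_def
  by (auto intro!: derivative_eq_intros lder_deriv[OF assms] simp: algebra_simps)

end

section \<open>The Bergman metric\<close>

lemma Re_hinner: "Re (hinner z a) = z \<bullet> a"
  by (simp add: hinner_def inner_vec_def inner_complex_def)

lemma bounded_linear_zpart: "bounded_linear zpart"
  unfolding linear_conv_bounded_linear[symmetric] by (auto intro!: linearI simp: zpart_add zpart_scaleR)

lemma zpart_axis [simp]: "zpart (axis (Some j) c) = axis j c" "zpart (axis None c) = 0"
  by (simp_all add: vec_eq_iff axis_def)

lemma hinner_axis [simp]: "hinner (axis j c) z = c * cnj (z $ j)"
  by (simp add: hinner_def axis_def if_distrib[of "\<lambda>x. x * _"] cong: if_cong)

lemma hinner_scale [simp]: "hinner (c *s z) a = c * hinner z a" "hinner z (c *s a) = cnj c * hinner z a"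
  by (simp_all add: hinner_def sum_distrib_left mult_ac)

lemma zpart_scale [simp]: "zpart (c *s p) = c *s zpart p"
  by (simp add: vec_eq_iff)

lemma axis_ii: "axis k \<i> = \<i> *s axis k (1::complex)"
  by (simp add: vec_eq_iff axis_def)

lemma sum_option: "(\<Sum>k\<in>(UNIV :: 'n::finite option set). f k) = f None + (\<Sum>i\<in>UNIV. f (Some i))"
  unfolding UNIV_option_conv by (subst sum.insert) (auto simp: sum.reindex)

lemma wirtinger_eq: "(g has_derivative D) (at p) \<Longrightarrow> wirtinger k g p = (D (axis k 1) - \<i> * D (axis k \<i>)) / 2"
  by (simp add: wirtinger_def frechet_derivative_eq)

lemma wirtinger_bar_eq: "(g has_derivative D) (at p) \<Longrightarrow> wirtinger_bar k g p = (D (axis k 1) + \<i> * D (axis k \<i>)) / 2"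
  by (simp add: wirtinger_bar_def frechet_derivative_eq)

lemma wirtinger_bar_of_real:
  assumes d: "(\<phi> has_derivative (\<lambda>v. 2 * Re (L v))) (at p)" and L: "\<And>c v. L (c *s v) = c * L v"
  shows "wirtinger_bar k (\<lambda>q. of_real (\<phi> q)) p = cnj (L (axis k 1))"
proof -
  have "((\<lambda>q. complex_of_real (\<phi> q)) has_derivative (\<lambda>v. of_real (2 * Re (L v)))) (at p)"
    by (rule has_derivative_of_real[OF d])
  from wirtinger_bar_eq[OF this] show ?thesis
    unfolding axis_ii L by (simp add: complex_eq_iff)
qed

lemma wirtinger_real_times_nth:
  assumes d: "(g has_derivative (\<lambda>v. y * v $ c + of_real (2 * Re (M v)) * x)) (at p)"
    and M: "\<And>c v. M (c *s v) = c * M v"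
  shows "wirtinger a g p = M (axis a 1) * x + y * (if a = c then 1 else 0)"
proof -
  define m \<delta> where "m = M (axis a 1)" and "\<delta> = axis a (1::complex) $ c"
  have "wirtinger a g p = (y * \<delta> + of_real (2 * Re m) * x - \<i> * (y * (\<i> * \<delta>) + of_real (2 * Re (\<i> * m)) * x)) / 2"
    unfolding wirtinger_eq[OF d] axis_ii M m_def \<delta>_def by simp
  also have "\<dots> = (of_real (Re m) + \<i> * of_real (Im m)) * x + y * \<delta>"
    by (simp add: field_simps)
  also have "of_real (Re m) + \<i> * of_real (Im m) = m" by (rule complex_eq[symmetric])
  finally show ?thesis by (simp add: m_def \<delta>_def axis_def eq_commute)
qed

lemma has_derivative_norm_sq:
  "((\<lambda>z::complex^'m::finite. (norm z)\<^sup>2) has_derivative (\<lambda>v. 2 * Re (hinner v z))) (at z)"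
proof -
  have "((\<lambda>z. z \<bullet> z) has_derivative (\<lambda>v. z \<bullet> v + v \<bullet> z)) (at z)"
    by (intro has_derivative_inner has_derivative_ident)
  then show ?thesis by (simp add: power2_norm_eq_inner Re_hinner inner_commute)
qed

lemma eucl_form_eq: "eucl_form z u v = \<i> * (hinner u v - hinner v u)"
proof -
  have "wirtinger_bar b (\<lambda>q. complex_of_real ((norm q)\<^sup>2)) = (\<lambda>q. of_real 1 * q $ b)" for b :: 'a
    by (rule ext, subst wirtinger_bar_of_real[OF has_derivative_norm_sq]) simp_all
  moreover have "wirtinger a (\<lambda>q. of_real 1 * q $ b) z = (if a = b then 1 else 0)" for a b :: 'a
  proof -
    have "((\<lambda>q. complex_of_real 1 * q $ b) has_derivative (\<lambda>v. 1 * v $ b + of_real (2 * Re 0) * 0)) (at z)"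
      by (auto intro!: bounded_linear_imp_has_derivative bounded_linear_vec_nth)
    from wirtinger_real_times_nth[OF this] show ?thesis by simp
  qed
  ultimately show ?thesis
    unfolding eucl_form_def ddbar_form_def
    by (simp add: hinner_def sum_subtractf if_distrib[of "\<lambda>x. x * _"] cong: if_cong)
qed

definition zweight :: "complex^('n::finite option) \<Rightarrow> real" where
  "zweight p = exp ((norm (zpart p))\<^sup>2)"

text \<open>The \<open>(1,0)\<close>-form \<open>dw + w \<Sum> cnj z\<^sub>i dz\<^sub>i\<close>, that is \<open>w\<close> times the holomorphic differential of
  \<open>ln rho\<close>. Multiplying by \<open>w\<close> removes the pole on \<open>w = 0\<close>.\<close>

definition vertical :: "complex^('n::finite option) \<Rightarrow> complex^('n option) \<Rightarrow> complex" where
  "vertical p v = v $ None + p $ None * hinner (zpart v) (zpart p)"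

lemma vertical_scale [simp]: "vertical p (c *s v) = c * vertical p v"
  by (simp add: vertical_def algebra_simps)

lemma vertical_add: "vertical p (u + v) = vertical p u + vertical p v"
  by (simp add: vertical_def zpart_add hinner_add_left algebra_simps)

lemma scaleR_cvec: "r *\<^sub>R (v :: complex^'m) = of_real r *s v"
  by (simp add: vec_eq_iff) (simp add: scaleR_conv_of_real)

lemma vertical_axis: "vertical p (axis None 1) = 1" "vertical p (axis (Some i) 1) = p $ None * cnj (p $ Some i)"
proof -
  have "axis (Some i) (1::complex) $ None = 0" by (simp add: axis_def)
  then show "vertical p (axis None 1) = 1" "vertical p (axis (Some i) 1) = p $ None * cnj (p $ Some i)"
    by (simp_all add: vertical_def)
qed

lemma has_derivative_norm_zpart:
  "((\<lambda>p. (norm (zpart p))\<^sup>2) has_derivative (\<lambda>v. 2 * Re (hinner (zpart v) (zpart p)))) (at p)"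
  by (rule has_derivative_compose[OF bounded_linear_imp_has_derivative[OF bounded_linear_zpart] has_derivative_norm_sq])

lemma has_derivative_zweight:
  "(zweight has_derivative (\<lambda>v. 2 * Re (of_real (zweight p) * hinner (zpart v) (zpart p)))) (at p)"
proof -
  have "((\<lambda>p. exp ((norm (zpart p))\<^sup>2)) has_derivative (\<lambda>v. exp ((norm (zpart p))\<^sup>2) * (2 * Re (hinner (zpart v) (zpart p))))) (at p)"
    by (rule has_derivative_exp[OF has_derivative_norm_zpart, unfolded mult.commute[of "2 * Re _"]])
  then show ?thesis unfolding zweight_def[abs_def] by (simp add: mult.left_commute)
qed

lemma rho_eq: "rho p = (cmod (p $ None))\<^sup>2 * zweight p"
  by (simp add: rho_def zweight_def)

lemma has_derivative_rho:
  "(rho has_derivative (\<lambda>v. 2 * Re (of_real (zweight p) * cnj (p $ None) * vertical p v))) (at p)"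
proof -
  have "((\<lambda>p::complex^('a option). p $ None \<bullet> p $ None) has_derivative (\<lambda>v. p $ None \<bullet> v $ None + v $ None \<bullet> p $ None)) (at p)"
    by (intro has_derivative_inner bounded_linear_imp_has_derivative bounded_linear_vec_nth)
  from has_derivative_mult[OF this has_derivative_zweight]
  have "((\<lambda>p. (cmod (p $ None))\<^sup>2 * zweight p) has_derivative
      (\<lambda>v. (p $ None \<bullet> p $ None) * (2 * Re (of_real (zweight p) * hinner (zpart v) (zpart p))) +
        (p $ None \<bullet> v $ None + v $ None \<bullet> p $ None) * zweight p)) (at p)"
    unfolding power2_norm_eq_inner .
  also have "(\<lambda>v. (p $ None \<bullet> p $ None) * (2 * Re (of_real (zweight p) * hinner (zpart v) (zpart p))) +
        (p $ None \<bullet> v $ None + v $ None \<bullet> p $ None) * zweight p)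
      = (\<lambda>v. 2 * Re (of_real (zweight p) * cnj (p $ None) * vertical p v))"
    by (rule ext) (simp add: vertical_def inner_complex_def algebra_simps)
  finally show ?thesis unfolding rho_eq[abs_def] .
qed

context hartogs_space begin

lemma rho_bounds: "p \<in> H \<Longrightarrow> 0 \<le> rho p" "p \<in> H \<Longrightarrow> rho p < 1"
  using rho_nonneg by (simp_all add: H_eq hartogs_def)

lemma has_derivative_of_rho:
  assumes "(f has_field_derivative d) (at (rho p))"
  shows "((\<lambda>q. f (rho q)) has_derivative (\<lambda>v. 2 * Re (of_real (d * zweight p) * cnj (p $ None) * vertical p v))) (at p)"
  using has_derivative_compose[OF has_derivative_rho assms[unfolded has_field_derivative_def]]
  by (simp add: algebra_simps)

text \<open>The Hermitian form \<open>\<partial>\<partial>-bar\<close> of \<open>ln K = |z|\<^sup>2 + F (rho)\<close>: since \<open>ln rho = ln |w|\<^sup>2 + |z|\<^sup>2\<close>, the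
  chain rule with respect to \<open>ln rho\<close> gives one term with \<open>\<partial>\<partial>-bar |z|\<^sup>2\<close> and one with the square
  of \<open>\<partial> ln rho\<close>.\<close>

definition levi :: "complex^('n option) \<Rightarrow> complex^('n option) \<Rightarrow> complex^('n option) \<Rightarrow> complex" where
  "levi p u v = of_real (hcoef (rho p)) * hinner (zpart u) (zpart v)
     + of_real (zweight p * vcoef (rho p)) * (vertical p u * cnj (vertical p v))"

lemma ln_bergman_kernel_derivative:
  assumes p: "p \<in> H"
  shows "((\<lambda>q. ln (bergman_kernel H q)) has_derivative
    (\<lambda>v. 2 * Re (hinner (zpart v) (zpart p) + of_real (lder (rho p) * zweight p) * cnj (p $ None) * vertical p v))) (at p)"
proof -
  have "((\<lambda>q. (norm (zpart q))\<^sup>2 + ln (rser (rho q))) has_derivative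
      (\<lambda>v. 2 * Re (hinner (zpart v) (zpart p)) + 2 * Re (of_real (lder (rho p) * zweight p) * cnj (p $ None) * vertical p v))) (at p)"
    by (intro has_derivative_add has_derivative_norm_zpart has_derivative_of_rho[OF ln_rser_deriv] rho_bounds p)
  then have "((\<lambda>q. ln (bergman_kernel H q)) has_derivative
      (\<lambda>v. 2 * Re (hinner (zpart v) (zpart p)) + 2 * Re (of_real (lder (rho p) * zweight p) * cnj (p $ None) * vertical p v))) (at p)"
  proof (rule has_derivative_transform_within_open[OF _ open_H p])
    fix q assume "q \<in> H"
    then show "(norm (zpart q))\<^sup>2 + ln (rser (rho q)) = ln (bergman_kernel H q)"
      using rser_pos[OF rho_bounds[of q]] by (simp add: bergman_kernel_eq ln_mult)
  qed
  then show ?thesis by (simp only: plus_complex.sel distrib_left)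
qed

lemma wirtinger_bar_ln_bergman_kernel:
  assumes p: "p \<in> H"
  shows "wirtinger_bar b (\<lambda>q. of_real (ln (bergman_kernel H q))) p =
    of_real (case b of None \<Rightarrow> lder (rho p) * zweight p | Some j \<Rightarrow> hcoef (rho p)) * p $ b"
proof -
  have 1: "wirtinger_bar b (\<lambda>q. of_real (ln (bergman_kernel H q))) p =
      cnj (hinner (zpart (axis b 1)) (zpart p) + of_real (lder (rho p) * zweight p) * cnj (p $ None) * vertical p (axis b 1))"
    by (rule wirtinger_bar_of_real[OF ln_bergman_kernel_derivative[OF p]]) (simp add: algebra_simps)
  show ?thesis
  proof (cases b)
    case None then show ?thesis unfolding 1 by (simp add: vertical_axis)
  next
    case (Some j)
    have "of_real (hcoef (rho p)) = 1 + of_real (lder (rho p) * zweight p) * (p $ None * cnj (p $ None))"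
      unfolding hcoef_def rho_eq complex_norm_square[symmetric] by (simp add: mult_ac)
    then show ?thesis unfolding 1 using Some by (simp add: vertical_axis algebra_simps)
  qed
qed

text \<open>The derivatives with respect to the conjugate variables are a real function times a coordinate,
  so each second derivative is a product rule. The case distinctions only match its terms with
  \<open>rho p = zweight p * |w|\<^sup>2\<close>.\<close>

lemma complex_hessian_ln_bergman_kernel:
  assumes p: "p \<in> H"
  shows "wirtinger a (wirtinger_bar b (\<lambda>q. of_real (ln (bergman_kernel H q)))) p =
    of_real (hcoef (rho p)) * (if a = b \<and> a \<noteq> None then 1 else 0)
    + of_real (zweight p * vcoef (rho p)) * (vertical p (axis a 1) * cnj (vertical p (axis b 1)))"
proof -
  define r where "r q = (case b of None \<Rightarrow> lder (rho q) * zweight q | Some j \<Rightarrow> hcoef (rho q))" for q :: "complex^('n option)"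
  have E: "of_real (rho p) = of_real (zweight p) * (p $ None * cnj (p $ None))"
    unfolding rho_eq complex_norm_square[symmetric] by simp
  \<comment> \<open>the product rule, for the real factor \<open>r\<close> of the first derivative\<close>
  have key: "wirtinger a (wirtinger_bar b (\<lambda>q. of_real (ln (bergman_kernel H q)))) p
      = M (axis a 1) * p $ b + of_real (r p) * (if a = b then 1 else 0)"
    if d: "(r has_derivative (\<lambda>v. 2 * Re (M v))) (at p)" and M: "\<And>c v. M (c *s v) = c * M v" for M
  proof -
    have "((\<lambda>q. complex_of_real (r q) * q $ b) has_derivative
        (\<lambda>v. of_real (r p) * v $ b + of_real (2 * Re (M v)) * p $ b)) (at p)"
      by (intro has_derivative_mult has_derivative_of_real[OF d] bounded_linear_imp_has_derivative bounded_linear_vec_nth)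
    then have "(wirtinger_bar b (\<lambda>q. of_real (ln (bergman_kernel H q))) has_derivative
        (\<lambda>v. of_real (r p) * v $ b + of_real (2 * Re (M v)) * p $ b)) (at p)"
      by (rule has_derivative_transform_within_open[OF _ open_H p]) (simp add: wirtinger_bar_ln_bergman_kernel r_def)
    then show ?thesis by (rule wirtinger_real_times_nth) (rule M)
  qed
  show ?thesis
  proof (cases b)
    case (Some j)
    have "(r has_derivative (\<lambda>v. 2 * Re (of_real (vcoef (rho p) * zweight p) * cnj (p $ None) * vertical p v))) (at p)"
      unfolding r_def[abs_def] Some by (simp, rule has_derivative_of_rho[OF hcoef_deriv[OF rho_bounds[OF p]], simplified])
    from key[OF this] show ?thesis
      using Some by (simp add: vertical_axis r_def algebra_simps)
  next
    case None
    let ?l = "rder 2 (rho p) / rder 0 (rho p) - (lder (rho p))\<^sup>2"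
    let ?M = "\<lambda>v. of_real (lder (rho p) * zweight p) * hinner (zpart v) (zpart p)
        + of_real (?l * zweight p * zweight p) * cnj (p $ None) * vertical p v"
    have "((\<lambda>q. lder (rho q) * zweight q) has_derivative
        (\<lambda>v. lder (rho p) * (2 * Re (of_real (zweight p) * hinner (zpart v) (zpart p)))
          + 2 * Re (of_real (?l * zweight p) * cnj (p $ None) * vertical p v) * zweight p)) (at p)"
      by (intro has_derivative_mult has_derivative_of_rho[OF lder_deriv[OF rho_bounds[OF p]]] has_derivative_zweight)
    also have "(\<lambda>v. lder (rho p) * (2 * Re (of_real (zweight p) * hinner (zpart v) (zpart p)))
          + 2 * Re (of_real (?l * zweight p) * cnj (p $ None) * vertical p v) * zweight p) = (\<lambda>v. 2 * Re (?M v))"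
      by (rule ext) (simp add: algebra_simps)
    finally have "(r has_derivative (\<lambda>v. 2 * Re (?M v))) (at p)"
      unfolding r_def[abs_def] None by simp
    from key[OF this]
    have k: "wirtinger a (wirtinger_bar b (\<lambda>q. of_real (ln (bergman_kernel H q)))) p
      = ?M (axis a 1) * p $ None + of_real (lder (rho p) * zweight p) * (if a = None then 1 else 0)"
      using None by (simp add: r_def algebra_simps)
    have q: "of_real (vcoef (rho p)) = of_real (lder (rho p)) + of_real ?l * (of_real (zweight p) * (p $ None * cnj (p $ None)))"
      unfolding E[symmetric] vcoef_def by (simp add: algebra_simps)
    show ?thesis
    proof (cases a)
      case None
      with \<open>b = None\<close> show ?thesis unfolding k of_real_mult q by (simp add: vertical_axis algebra_simps)
    next
      case (Some i)
      with \<open>b = None\<close> show ?thesis unfolding k of_real_mult q by (simp add: vertical_axis algebra_simps)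
    qed
  qed
qed

lemma sum_levi:
  fixes p u v :: "complex^('n option)"
  shows "(\<Sum>a\<in>UNIV. \<Sum>b\<in>UNIV. (A * (if a = b \<and> a \<noteq> None then 1 else 0)
      + B * (vertical p (axis a 1) * cnj (vertical p (axis b 1)))) * (u $ a * cnj (v $ b)))
    = A * hinner (zpart u) (zpart v) + B * (vertical p u * cnj (vertical p v))"
proof -
  have vertical_sum: "vertical p x = (\<Sum>a\<in>UNIV. vertical p (axis a 1) * x $ a)" for x :: "complex^('n option)"
    unfolding sum_option vertical_axis by (simp add: vertical_def hinner_def sum_distrib_left mult_ac)
  have "(\<Sum>a\<in>UNIV. \<Sum>b\<in>UNIV. A * (if a = b \<and> a \<noteq> None then 1 else 0) * (u $ a * cnj (v $ b)))
      = A * hinner (zpart u) (zpart v)"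
    unfolding sum_option by (simp add: hinner_def sum_distrib_left if_distrib[of "\<lambda>x. x * _"] if_distrib[of "\<lambda>x. A * x"] cong: if_cong)
  moreover have "(\<Sum>a\<in>UNIV. \<Sum>b\<in>UNIV. B * (vertical p (axis a 1) * cnj (vertical p (axis b 1))) * (u $ a * cnj (v $ b)))
      = B * (vertical p u * cnj (vertical p v))"
  proof -
    have "B * (vertical p u * cnj (vertical p v))
        = B * ((\<Sum>a\<in>UNIV. vertical p (axis a 1) * u $ a) * (\<Sum>b\<in>UNIV. cnj (vertical p (axis b 1)) * cnj (v $ b)))"
      by (simp only: vertical_sum[of u] vertical_sum[of v] cnj_sum complex_cnj_mult)
    also have "\<dots> = (\<Sum>a\<in>UNIV. \<Sum>b\<in>UNIV. B * ((vertical p (axis a 1) * u $ a) * (cnj (vertical p (axis b 1)) * cnj (v $ b))))"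
      by (simp only: sum_product) (simp only: sum_distrib_left)
    finally show ?thesis by (simp only: mult_ac)
  qed
  ultimately show ?thesis by (simp only: distrib_right sum.distrib)
qed

lemma bergman_form_eq:
  assumes p: "p \<in> H" shows "bergman_form H p u v = \<i> * (levi p u v - levi p v u)"
  unfolding bergman_form_def ddbar_form_def complex_hessian_ln_bergman_kernel[OF p] right_diff_distrib
    sum_subtractf sum_levi levi_def ..

lemma levi_sym: "levi p v u = cnj (levi p u v)"
  by (simp add: levi_def hinner_cnj mult.commute)

lemma levi_scale: "levi p (c *s u) v = c * levi p u v" "levi p u (c *s v) = cnj c * levi p u v"
  by (simp_all add: levi_def algebra_simps)

lemma levi_add: "levi p (u + u') v = levi p u v + levi p u' v" "levi p u (v + v') = levi p u v + levi p u v'"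
  by (simp_all add: levi_def zpart_add hinner_add_left hinner_add_right vertical_add algebra_simps)

abbreviation bmetric where "bmetric \<equiv> metric_of_form (bergman_form H)"

lemma bmetric_eq:
  assumes p: "p \<in> H" shows "bmetric p u v = 2 * Re (levi p u v)"
proof -
  have "bergman_form H p u (\<i> *s v) = levi p u v + levi p v u"
    unfolding bergman_form_eq[OF p] levi_scale by (simp add: right_diff_distrib mult.assoc[symmetric])
  also have "\<dots> = levi p u v + cnj (levi p u v)"
    by (subst levi_sym[of p v u]) (rule refl)
  finally show ?thesis unfolding metric_of_form_def by simp
qed

lemma bmetric_pos:
  assumes p: "p \<in> H" and u: "u \<noteq> 0" shows "bmetric p u u > 0"
proof -
  have "levi p u u = of_real (hcoef (rho p) * (norm (zpart u))\<^sup>2 + zweight p * vcoef (rho p) * (cmod (vertical p u))\<^sup>2)"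
    unfolding levi_def hinner_self complex_norm_square[symmetric] by simp
  then have eq: "bmetric p u u = 2 * (hcoef (rho p) * (norm (zpart u))\<^sup>2 + zweight p * vcoef (rho p) * (cmod (vertical p u))\<^sup>2)"
    unfolding bmetric_eq[OF p] by simp
  have A: "hcoef (rho p) > 0" and Q: "zweight p * vcoef (rho p) > 0"
    using hcoef_pos[OF rho_bounds[OF p]] vcoef_pos[OF rho_bounds[OF p]] by (simp_all add: zweight_def)
  show ?thesis
  proof (cases "zpart u = 0")
    case False
    then have "hcoef (rho p) * (norm (zpart u))\<^sup>2 > 0" using A by simp
    moreover have "zweight p * vcoef (rho p) * (cmod (vertical p u))\<^sup>2 \<ge> 0" using Q by simp
    ultimately show ?thesis unfolding eq by (simp add: add_pos_nonneg)
  next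
    case True
    have "u $ None \<noteq> 0"
    proof
      assume "u $ None = 0"
      then have "u = pt 0 0" using pt_zpart[of u] True by metis
      also have "\<dots> = 0" by (simp add: vec_eq_iff pt_def split: option.split)
      finally show False using u by simp
    qed
    then have "vertical p u \<noteq> 0" using True by (simp add: vertical_def)
    then show ?thesis unfolding eq using Q True by simp
  qed
qed

lemma bmetric_sym: "p \<in> H \<Longrightarrow> bmetric p u v = bmetric p v u"
  by (simp add: bmetric_eq levi_sym[of p v u])

lemma bmetric_bilinear: "p \<in> H \<Longrightarrow> bilinear (bmetric p)"
  unfolding bilinear_def by (auto intro!: linearI simp: bmetric_eq levi_add scaleR_cvec levi_scale)

end

section \<open>Smoothness of the metric\<close>

context hartogs_space begin

lemma Ck_nth: "Ck_on k H (\<lambda>p. p $ i)"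
  by (rule Ck_on_bounded_linear[OF open_H bounded_linear_vec_nth Ck_on_id[OF open_H]])

lemma Ck_cnj_nth: "Ck_on k H (\<lambda>p. cnj (p $ i))"
  by (rule Ck_on_bounded_linear[OF open_H bounded_linear_cnj Ck_nth])

lemma Ck_zweight: "Ck_on k H zweight"
proof -
  have "Ck_on k H (\<lambda>p. Re (\<Sum>i\<in>UNIV. p $ Some i * cnj (p $ Some i)))"
    by (intro Ck_on_bounded_linear[OF open_H bounded_linear_Re] Ck_on_sum Ck_on_mult open_H Ck_nth Ck_cnj_nth)
  moreover have "Re (\<Sum>i\<in>UNIV. p $ Some i * cnj (p $ Some i)) = (norm (zpart p))\<^sup>2" for p :: "complex^('n option)"
    using hinner_self[of "zpart p"] by (simp add: hinner_def)
  ultimately show ?thesis unfolding zweight_def[abs_def] by (intro Ck_on_exp open_H) simp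
qed

lemma Ck_rho: "Ck_on k H rho"
proof -
  have "Ck_on k H (\<lambda>p. Re (p $ None * cnj (p $ None)) * zweight p)"
    by (intro Ck_on_bounded_linear[OF open_H bounded_linear_Re] Ck_on_mult open_H Ck_nth Ck_cnj_nth Ck_zweight)
  moreover have "Re (p $ None * cnj (p $ None)) * zweight p = rho p" for p :: "complex^('n option)"
    unfolding rho_eq complex_norm_square[symmetric] by simp
  ultimately show ?thesis by simp
qed

lemma Ck_rder: "Ck_on k H (\<lambda>p. rder j (rho p))"
  by (rule Ck_on_real_compose[where I="{-1<..<1}" and F=rder, OF open_H _ _ Ck_rho])
    (use rho_bounds in \<open>auto intro!: rder_deriv intro: less_le_trans[of _ 0]\<close>)

lemma Ck_lder: "Ck_on k H (\<lambda>p. lder (rho p))"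
proof -
  have "Ck_on k H (\<lambda>p. inverse (rder 0 (rho p)))"
    by (rule Ck_on_inverse[OF open_H _ Ck_rder]) (simp add: rder_0 rser_pos rho_bounds)
  then have "Ck_on k H (\<lambda>p. rder 1 (rho p) * inverse (rder 0 (rho p)))"
    by (intro Ck_on_mult open_H Ck_rder)
  then show ?thesis by (simp add: lder_def divide_inverse)
qed

lemma Ck_hcoef: "Ck_on k H (\<lambda>p. hcoef (rho p))"
  unfolding hcoef_def by (intro Ck_on_add Ck_on_mult Ck_on_const open_H Ck_rho Ck_lder)

lemma Ck_vcoef: "Ck_on k H (\<lambda>p. vcoef (rho p))"
proof -
  have "Ck_on k H (\<lambda>p. inverse (rder 0 (rho p)))"
    by (rule Ck_on_inverse[OF open_H _ Ck_rder]) (simp add: rder_0 rser_pos rho_bounds)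
  then have "Ck_on k H (\<lambda>p. lder (rho p) + rho p * (rder 2 (rho p) * inverse (rder 0 (rho p)) + (- 1) * (lder (rho p) * lder (rho p))))"
    by (intro Ck_on_add Ck_on_mult Ck_on_const open_H Ck_rho Ck_rder Ck_lder)
  then show ?thesis by (simp add: vcoef_def power2_eq_square divide_inverse)
qed

lemma Ck_vertical: "Ck_on k H (\<lambda>p. vertical p v)"
  unfolding vertical_def hinner_def zpart_nth
  by (intro Ck_on_add Ck_on_sum Ck_on_mult Ck_on_const open_H Ck_nth Ck_cnj_nth)

lemma bmetric_smooth: "smooth_on H (\<lambda>p. bmetric p u v)"
  unfolding smooth_on_def
proof
  fix k
  have "Ck_on k H (\<lambda>p. 2 * (hcoef (rho p) * Re (hinner (zpart u) (zpart v))
      + (zweight p * vcoef (rho p)) * Re (vertical p u * cnj (vertical p v))))"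
    by (intro Ck_on_add Ck_on_mult Ck_on_const open_H Ck_hcoef Ck_vcoef Ck_zweight Ck_vertical
        Ck_on_bounded_linear[OF open_H bounded_linear_Re] Ck_on_bounded_linear[OF open_H bounded_linear_cnj])
  then show "Ck_on k H (\<lambda>p. bmetric p u v)"
    by (rule Ck_on_cong[OF open_H, rotated]) (simp add: bmetric_eq levi_def)
qed

lemma riemannian_metric_bmetric: "riemannian_metric_on H bmetric"
  unfolding riemannian_metric_on_def using bmetric_bilinear bmetric_sym bmetric_pos bmetric_smooth by blast

section \<open>The submanifold w = 0 is totally geodesic\<close>

lemma axis_in_H: "pt z 0 \<in> H"
  by (simp add: H_eq hartogs_def rho_def)

lemma on_axis: "rho (pt z 0) = 0" "vertical (pt z 0) v = v $ None" "hcoef 0 = 1"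
  by (simp_all add: rho_def vertical_def hcoef_def)

text \<open>The horizontal coefficient depends on \<open>rho\<close>, which vanishes to second order on \<open>w = 0\<close>. In the
  vertical term one factor vanishes there because \<open>(\<beta>, 0)\<close> is tangent to \<open>w = 0\<close>, so only the
  derivative of that factor remains.\<close>

lemma bmetric_derivative_on_axis:
  "((\<lambda>q. bmetric q (pt \<beta> 0) v) has_derivative
    (\<lambda>h. 2 * (zweight (pt x 0) * vcoef 0 * Re (h $ None * hinner \<beta> x * cnj (v $ None))))) (at (pt x 0))"
proof -
  let ?p = "pt x 0 :: complex^('n option)"
  have z: "((\<lambda>q. zpart q) has_derivative zpart) (at ?p)"
    by (rule bounded_linear_imp_has_derivative[OF bounded_linear_zpart])
  have A: "((\<lambda>q. hcoef (rho q)) has_derivative (\<lambda>h. 0)) (at ?p)"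
  proof -
    have "(hcoef has_field_derivative vcoef (rho ?p)) (at (rho ?p))" by (rule hcoef_deriv) (simp_all add: on_axis)
    from has_derivative_of_rho[OF this] show ?thesis by simp
  qed
  obtain K' where K: "((\<lambda>q. zweight q * vcoef (rho q)) has_derivative K') (at ?p)"
    using Ck_on_SucD(1)[OF Ck_on_mult[OF open_H Ck_zweight Ck_vcoef] axis_in_H] by blast
  have l: "((\<lambda>q. vertical q (pt \<beta> 0)) has_derivative (\<lambda>h. h $ None * hinner \<beta> x)) (at ?p)"
  proof -
    have "bounded_linear (\<lambda>y::complex^'n. hinner \<beta> y)"
      unfolding hinner_def by (intro bounded_linear_sum bounded_linear_const_mult
          bounded_linear_compose[OF bounded_linear_cnj] bounded_linear_vec_nth)
    then have "((\<lambda>q. hinner \<beta> (zpart q)) has_derivative (\<lambda>h. hinner \<beta> (zpart h))) (at ?p)"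
      by (rule bounded_linear.has_derivative[OF _ z])
    from has_derivative_mult[OF bounded_linear_imp_has_derivative[OF bounded_linear_vec_nth[of None]] this]
    show ?thesis by (simp add: vertical_def)
  qed
  obtain l' where l': "((\<lambda>q. vertical q v) has_derivative l') (at ?p)"
    using Ck_on_SucD(1)[OF Ck_vertical axis_in_H] by blast
  have R: "((\<lambda>q. Re (vertical q (pt \<beta> 0) * cnj (vertical q v))) has_derivative
      (\<lambda>h. Re (h $ None * hinner \<beta> x * cnj (v $ None)))) (at ?p)"
    using bounded_linear.has_derivative[OF bounded_linear_Re
        has_derivative_mult[OF l bounded_linear.has_derivative[OF bounded_linear_cnj l']]]
    by (simp add: on_axis)
  have "((\<lambda>q. 2 * (hcoef (rho q) * Re (hinner \<beta> (zpart v)) + (zweight q * vcoef (rho q)) * Re (vertical q (pt \<beta> 0) * cnj (vertical q v))))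
      has_derivative (\<lambda>h. 2 * (zweight ?p * vcoef 0 * Re (h $ None * hinner \<beta> x * cnj (v $ None))))) (at ?p)"
    using has_derivative_mult_right[OF has_derivative_add[OF has_derivative_mult_left[OF A] has_derivative_mult[OF K R]], of 2]
    by (simp add: on_axis)
  then show ?thesis
    by (rule has_derivative_transform_within_open[OF _ open_H axis_in_H]) (simp add: bmetric_eq levi_def)
qed

lemma bmetric_unique_zero:
  assumes "p \<in> H" "bmetric p u u = 0" shows "u = 0"
  using bmetric_pos[of p u] assms by fastforce

lemma bmetric_zero: "p \<in> H \<Longrightarrow> bmetric p 0 v = 0"
  by (simp add: bmetric_eq levi_def vertical_def)

text \<open>In the Koszul formula each remaining derivative contains the w-component of a vector tangent to
  \<open>w = 0\<close>. This is the infinitesimal form of the fact that \<open>w = 0\<close> is the fixed point set of the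
  isometry \<open>(z, w) \<mapsto> (z, -w)\<close>.\<close>

lemma christoffel_on_axis: "christoffel bmetric (pt x 0) (pt \<alpha> 0) (pt \<beta> 0) = 0"
proof -
  have D: "frechet_derivative (\<lambda>q. bmetric q (pt \<beta> 0) v) (at (pt x 0)) h
      = 2 * (zweight (pt x 0) * vcoef 0 * Re (h $ None * hinner \<beta> x * cnj (v $ None)))" for \<beta> v h
    by (simp add: frechet_derivative_eq[OF bmetric_derivative_on_axis])
  show ?thesis
    unfolding christoffel_def D
  proof (rule the_equality)
    fix y :: "complex^('n option)"
    assume "\<forall>w. 2 * bmetric (pt x 0) y w =
      2 * (zweight (pt x 0) * vcoef 0 * Re (pt \<alpha> 0 $ None * hinner \<beta> x * cnj (w $ None))) +
      2 * (zweight (pt x 0) * vcoef 0 * Re (pt \<beta> 0 $ None * hinner \<alpha> x * cnj (w $ None))) -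
      2 * (zweight (pt x 0) * vcoef 0 * Re (w $ None * hinner \<alpha> x * cnj (pt \<beta> 0 $ None)))"
    then have "bmetric (pt x 0) y y = 0" by simp
    then show "y = 0" by (rule bmetric_unique_zero[OF axis_in_H])
  qed (simp add: bmetric_zero[OF axis_in_H])
qed

lemma bounded_linear_pt: "bounded_linear (\<lambda>z. pt z 0)"
  unfolding linear_conv_bounded_linear[symmetric]
  by (auto intro!: linearI simp: vec_eq_iff pt_def split: option.split)

lemma frechet_pt: "frechet_derivative (\<lambda>z. pt z 0) (at x) = (\<lambda>v. pt v 0)"
  by (rule frechet_derivative_eq[OF bounded_linear_imp_has_derivative[OF bounded_linear_pt]])

lemma pt_diff: "pt y 0 - pt z 0 = pt (y - z) 0"
  by (simp add: vec_eq_iff pt_def split: option.split)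

text \<open>Since the Christoffel symbols vanish on tangent vectors, covariant differentiation along \<open>w = 0\<close>
  is ordinary differentiation, which stays tangent; the normal part of a tangent vector is zero.\<close>

lemma second_fundamental_form_zero:
  assumes Y: "smooth_on UNIV Y"
  shows "second_fundamental_form bmetric (\<lambda>z. pt z 0) X Y x = 0"
proof -
  let ?T = "range (\<lambda>v::complex^'n. pt v 0)"
  have "Ck_on 1 UNIV Y" using Y by (simp only: smooth_on_def)
  then have "(Y has_derivative frechet_derivative Y (at x)) (at x)"
    unfolding One_nat_def by (rule Ck_on_SucD(1)) simp
  then have "((\<lambda>y. pt (Y y) 0) has_derivative (\<lambda>v. pt (frechet_derivative Y (at x) v) 0)) (at x)"
    by (rule bounded_linear.has_derivative[OF bounded_linear_pt])
  then have cov: "cov_deriv_along bmetric (\<lambda>z. pt z 0) (X x) (\<lambda>y. frechet_derivative (\<lambda>z. pt z 0) (at y) (Y y)) x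
      = pt (frechet_derivative Y (at x) (X x)) 0"
    by (simp add: cov_deriv_along_def frechet_pt frechet_derivative_eq christoffel_on_axis)
  show ?thesis
    unfolding second_fundamental_form_def cov unfolding frechet_pt normal_part_def
  proof (rule the_equality)
    fix \<nu> :: "complex^('n option)"
    assume \<nu>: "(\<forall>t\<in>?T. bmetric (pt x 0) \<nu> t = 0) \<and> pt (frechet_derivative Y (at x) (X x)) 0 - \<nu> \<in> ?T"
    then obtain v where "pt (frechet_derivative Y (at x) (X x)) 0 - \<nu> = pt v 0" by blast
    then have "\<nu> = pt (frechet_derivative Y (at x) (X x) - v) 0" by (simp add: pt_diff[symmetric] algebra_simps)
    then have "\<nu> \<in> ?T" by blast
    then have "bmetric (pt x 0) \<nu> \<nu> = 0" using \<nu> by blast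
    then show "\<nu> = 0" by (rule bmetric_unique_zero[OF axis_in_H])
  qed (auto simp: bmetric_zero[OF axis_in_H])
qed

lemma pullback_bergman_form: "pullback_form (\<lambda>z. pt z 0) (bergman_form H) = eucl_form"
  by (intro ext) (simp add: pullback_form_def frechet_pt bergman_form_eq[OF axis_in_H] eucl_form_eq levi_def on_axis)

lemma holomorphic_embedding_axis: "holomorphic_embedding H (\<lambda>z. pt z 0)"
  unfolding holomorphic_embedding_def
proof (intro conjI allI)
  have "holo_fun_on UNIV (\<lambda>z::complex^'n. pt z 0 $ k)" for k
    by (cases k) (auto intro: holo_fun_on_const holo_fun_on_nth)
  then show "holo_map_on UNIV (\<lambda>z::complex^'n. pt z 0)" by (simp add: holo_map_on_def)
  show "range (\<lambda>z. pt z 0) \<subseteq> H" using axis_in_H by blast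
  show "inj (frechet_derivative (\<lambda>z::complex^'n. pt z 0) (at x))" for x
    unfolding frechet_pt by (rule inj_on_inverseI[where g=zpart]) simp
  show "\<exists>h. homeomorphism UNIV (range (\<lambda>z::complex^'n. pt z 0)) (\<lambda>z. pt z 0) h"
    by (rule exI[of _ zpart], rule homeomorphismI) (auto intro!: continuous_intros)
qed

lemma complex_submanifold_axis: "complex_submanifold H CARD('n) (range (\<lambda>z::complex^'n. pt z 0))"
  unfolding complex_submanifold_def
proof (intro conjI ballI)
  show "range (\<lambda>z. pt z 0) \<subseteq> H" using axis_in_H by blast
  fix p assume "p \<in> range (\<lambda>z::complex^'n. pt z 0)"
  then have p: "p \<in> H" using axis_in_H by blast
  have id: "holo_map_on H (\<lambda>p. p)" by (simp add: holo_map_on_def holo_fun_on_nth)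
  have hom: "homeomorphism H H (\<lambda>p. p) (\<lambda>p. p)" by (rule homeomorphism_ident)
  have card: "card (UNIV - {None :: 'n option}) = CARD('n)"
    by (simp add: card_Diff_singleton)
  have "range (\<lambda>z::complex^'n. pt z 0) \<inter> H = H \<inter> {x. x $ None = 0}"
  proof (intro set_eqI iffI)
    fix x assume "x \<in> H \<inter> {x. x $ None = 0}"
    then have "x = pt (zpart x) 0" "x \<in> H" using pt_zpart[of x] by auto
    then show "x \<in> range (\<lambda>z::complex^'n. pt z 0) \<inter> H" by blast
  qed auto
  then have img: "(\<lambda>p. p) ` (range (\<lambda>z::complex^'n. pt z 0) \<inter> H) = H \<inter> {x. \<forall>k\<in>{None}. x $ k = 0}" by simp
  show "\<exists>U (V :: (complex^('n option)) set) \<phi> \<psi> I. open U \<and> p \<in> U \<and> U \<subseteq> H \<and> open V \<and> homeomorphism U V \<phi> \<psi> \<and> holo_map_on U \<phi> \<and>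
      holo_map_on V \<psi> \<and> card (UNIV - I) = CARD('n) \<and>
      \<phi> ` (range (\<lambda>z::complex^'n. pt z 0) \<inter> U) = V \<inter> {x. \<forall>k\<in>I. x $ k = 0}"
    by (rule exI[of _ H], rule exI[of _ H], rule exI[of _ "\<lambda>p. p"], rule exI[of _ "\<lambda>p. p"], rule exI[of _ "{None}"])
      (intro conjI open_H p subset_refl hom id card img)
qed

section \<open>Pseudoconvexity\<close>

definition exhaustion :: "complex^('n option) \<Rightarrow> real" where
  "exhaustion p = (norm (zpart p))\<^sup>2 + 1 / (1 - rho p)"

lemma continuous_exhaustion: "continuous_on H exhaustion"
proof -
  have "1 - rho p \<noteq> 0" if "p \<in> H" for p using rho_bounds[OF that] by simp
  then show ?thesis
    unfolding exhaustion_def by (intro continuous_intros continuous_on_rho) auto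
qed

lemma circle_mean:
  fixes h :: "complex \<Rightarrow> complex"
  assumes "h holomorphic_on UNIV"
  shows "((\<lambda>\<theta>. h (cis \<theta>)) has_integral 2 * pi * h 0) {0..2*pi}"
proof -
  have c: "continuous_on UNIV h" using assms by (rule holomorphic_on_imp_continuous_on)
  have "continuous_on {0..2*pi} (\<lambda>t. h (cis t))"
    by (intro continuous_on_compose2[OF c] continuous_on_cis continuous_intros) auto
  then have i: "set_integrable lborel {0..2*pi} (\<lambda>t. h (cis t))"
    unfolding set_integrable_def by (intro borel_integrable_compact) auto
  have "(1 / (2 * pi)) *\<^sub>R (LINT \<theta>:{0..2*pi}|lborel. h (cis \<theta>) * cnj (cis \<theta>) ^ 0) = (deriv ^^ 0) h 0 / fact 0"
    by (rule circle_coefficient[OF assms]) auto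
  then have "(LINT \<theta>:{0..2*pi}|lborel. h (cis \<theta>)) = 2 * pi * h 0"
    by (simp add: scaleR_conv_of_real field_simps)
  then show ?thesis using set_borel_integral_eq_integral[OF i] by (simp add: has_integral_iff)
qed

text \<open>On the boundary circle of a disc \<open>p + \<zeta> v\<close> the quadratic \<open>|z|\<^sup>2\<close> agrees with a harmonic
  function, so there \<open>rho\<close> equals \<open>|h|\<^sup>2\<close> for an entire function \<open>h\<close> of \<open>\<zeta>\<close>, with
  \<open>rho p \<le> |h 0|\<^sup>2\<close>. Bounding the convex function \<open>1 / (1 - s)\<close> below by its tangent line at
  \<open>rho p\<close>, and \<open>|h|\<^sup>2\<close> by \<open>2 Re (cnj (h 0) h) - |h 0|\<^sup>2\<close>, the exhaustion is bounded below on the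
  circle by the real part of an entire function \<open>k\<close>, whose mean is its value at the centre.\<close>

lemma psh_exhaustion: "continuous_psh_on H exhaustion"
  unfolding continuous_psh_on_def
proof (intro conjI allI impI)
  show cont: "continuous_on H exhaustion" by (rule continuous_exhaustion)
  fix p v assume disc: "\<forall>\<zeta>. cmod \<zeta> \<le> 1 \<longrightarrow> p + \<zeta> *s v \<in> H"
  have pH: "p \<in> H" using disc[rule_format, of 0] by simp
  let ?A = "zpart p" and ?B = "zpart v"
  define s0 where "s0 = rho p"
  have s0: "0 \<le> s0" "s0 < 1" using rho_bounds[OF pH] by (simp_all add: s0_def)
  define c where "c = hinner ?B ?A"
  define N where "N = (norm ?A)\<^sup>2 + (norm ?B)\<^sup>2"
  define h where "h \<zeta> = (p $ None + \<zeta> * v $ None) * exp (of_real (N / 2) + \<zeta> * c)" for \<zeta>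
  let ?q = "\<lambda>\<theta>. p + cis \<theta> *s v"
  have qH: "?q \<theta> \<in> H" for \<theta> using disc by simp
  have nq: "(norm (zpart (?q \<theta>)))\<^sup>2 = N + 2 * Re (cis \<theta> * c)" for \<theta>
  proof -
    have "(norm (cis \<theta> *s ?B))\<^sup>2 = (norm ?B)\<^sup>2" by (simp add: norm_sq_vec norm_mult)
    moreover have "Re (hinner ?A (cis \<theta> *s ?B)) = Re (cis \<theta> * c)"
      unfolding c_def hinner_cnj[symmetric, of ?A] by simp
    ultimately show ?thesis unfolding zpart_add zpart_scale norm_sq_add N_def by simp
  qed
  have rho_h: "rho (?q \<theta>) = (cmod (h (cis \<theta>)))\<^sup>2" for \<theta>
  proof -
    have "(cmod (exp (of_real (N / 2) + cis \<theta> * c)))\<^sup>2 = exp (N + 2 * Re (cis \<theta> * c))"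
      by (simp add: power2_eq_square exp_add[symmetric])
    then show ?thesis unfolding rho_def nq h_def by (simp add: norm_mult power_mult_distrib)
  qed
  have h0: "s0 \<le> (cmod (h 0))\<^sup>2"
  proof -
    have "(cmod (h 0))\<^sup>2 = (cmod (p $ None))\<^sup>2 * exp N"
      by (simp add: h_def norm_mult power_mult_distrib power2_eq_square[of "exp _"] exp_add[symmetric])
    moreover have "exp ((norm ?A)\<^sup>2) \<le> exp N" by (simp add: N_def)
    ultimately show ?thesis unfolding s0_def rho_def by (simp add: mult_left_mono)
  qed
  have tangent: "1 / (1 - s) \<ge> 1 / (1 - s0) + (s - s0) / (1 - s0)\<^sup>2" if "s < 1" for s
  proof -
    have "1 / (1 - s) - (1 / (1 - s0) + (s - s0) / (1 - s0)\<^sup>2) = (s - s0)\<^sup>2 / ((1 - s) * (1 - s0)\<^sup>2)"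
      using that s0 by (simp add: divide_simps power2_eq_square) (simp add: algebra_simps)
    also have "\<dots> \<ge> 0" using that s0 by simp
    finally show ?thesis by linarith
  qed
  define b where "b = 1 / (1 - s0)\<^sup>2"
  have b: "b > 0" using s0 by (simp add: b_def)
  define k where "k \<zeta> = of_real (N + 1 / (1 - s0)) + 2 * \<zeta> * c + of_real b * (2 * cnj (h 0) * h \<zeta> - of_real ((cmod (h 0))\<^sup>2) - of_real s0)" for \<zeta>
  have lower: "Re (k (cis \<theta>)) \<le> exhaustion (?q \<theta>)" for \<theta>
  proof -
    have "0 \<le> (cmod (h (cis \<theta>) - h 0))\<^sup>2" by simp
    also have "(cmod (h (cis \<theta>) - h 0))\<^sup>2 = (cmod (h (cis \<theta>)))\<^sup>2 - 2 * Re (cnj (h 0) * h (cis \<theta>)) + (cmod (h 0))\<^sup>2"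
      unfolding cmod_power2 by (simp add: power2_eq_square algebra_simps)
    finally have "2 * Re (cnj (h 0) * h (cis \<theta>)) - (cmod (h 0))\<^sup>2 - s0 \<le> rho (?q \<theta>) - s0"
      unfolding rho_h by simp
    then have "b * (2 * Re (cnj (h 0) * h (cis \<theta>)) - (cmod (h 0))\<^sup>2 - s0) \<le> b * (rho (?q \<theta>) - s0)"
      using b by (intro mult_left_mono) auto
    also have "1 / (1 - s0) + b * (rho (?q \<theta>) - s0) \<le> 1 / (1 - rho (?q \<theta>))"
      using tangent[of "rho (?q \<theta>)"] rho_bounds[OF qH] by (simp add: b_def)
    finally have "N + 1 / (1 - s0) + 2 * Re (cis \<theta> * c) + b * (2 * Re (cnj (h 0) * h (cis \<theta>)) - (cmod (h 0))\<^sup>2 - s0)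
        \<le> exhaustion (?q \<theta>)"
      unfolding exhaustion_def nq by simp
    then show ?thesis by (simp add: k_def algebra_simps)
  qed
  have "k holomorphic_on UNIV" unfolding k_def h_def by (intro holomorphic_intros)
  from has_integral_linear[OF circle_mean[OF this] bounded_linear_Re]
  have int1: "((\<lambda>\<theta>. Re (k (cis \<theta>))) has_integral 2 * pi * Re (k 0)) {0..2*pi}"
    by (simp add: o_def)
  have "continuous_on {0..2*pi} (\<lambda>\<theta>. exhaustion (?q \<theta>))"
  proof (rule continuous_on_compose2[OF cont])
    show "continuous_on {0..2*pi} ?q"
      unfolding vector_scalar_mult_def by (intro continuous_intros continuous_on_cis)
  qed (use qH in auto)
  then have int2: "((\<lambda>\<theta>. exhaustion (?q \<theta>)) has_integral integral {0..2*pi} (\<lambda>\<theta>. exhaustion (?q \<theta>))) {0..2*pi}"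
    by (intro integrable_integral integrable_continuous_real)
  have "2 * pi * Re (k 0) \<le> integral {0..2*pi} (\<lambda>\<theta>. exhaustion (?q \<theta>))"
    by (rule has_integral_le[OF int1 int2]) (rule lower)
  moreover have "exhaustion p \<le> Re (k 0)"
  proof -
    have "cnj (h 0) * h 0 = of_real ((cmod (h 0))\<^sup>2)"
      using complex_norm_square[of "h 0"] by (simp add: mult.commute)
    then have "Re (k 0) = N + 1 / (1 - s0) + b * ((cmod (h 0))\<^sup>2 - s0)"
      unfolding k_def by (simp add: mult.assoc)
    moreover have "b * ((cmod (h 0))\<^sup>2 - s0) \<ge> 0" using b h0 by simp
    moreover have "(norm ?A)\<^sup>2 \<le> N" by (simp add: N_def)
    ultimately show ?thesis by (simp add: exhaustion_def s0_def[symmetric])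
  qed
  ultimately have "2 * pi * exhaustion p \<le> integral {0..2*pi} (\<lambda>\<theta>. exhaustion (?q \<theta>))"
    by (meson mult_left_mono order_trans pi_ge_zero mult_nonneg_nonneg zero_le_numeral)
  then show "exhaustion p \<le> 1 / (2 * pi) * integral {0..2*pi} (\<lambda>\<theta>. exhaustion (p + cis \<theta> *s v))"
    by (simp add: field_simps)
qed

lemma compact_sublevel: "compact {p \<in> H. exhaustion p \<le> c}"
proof -
  have le: "1 / (1 - rho p) \<le> c" "(norm (zpart p))\<^sup>2 \<le> c" if "p \<in> H" "exhaustion p \<le> c" for p
  proof -
    have "1 / (1 - rho p) > 0" using rho_bounds[OF that(1)] by simp
    then show "1 / (1 - rho p) \<le> c" "(norm (zpart p))\<^sup>2 \<le> c"
      using that(2) zero_le_power2[of "norm (zpart p)"] unfolding exhaustion_def by linarith+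
  qed
  have "{p \<in> H. exhaustion p \<le> c} \<subseteq> cball 0 (sqrt (c + 1))"
  proof
    fix p assume "p \<in> {p \<in> H. exhaustion p \<le> c}"
    then have "(cmod (p $ None))\<^sup>2 \<le> 1" "(norm (zpart p))\<^sup>2 \<le> c"
      using w_less_1[of p] le(2) by (simp_all add: power_le_one)
    moreover have "(norm p)\<^sup>2 = (cmod (p $ None))\<^sup>2 + (norm (zpart p))\<^sup>2"
      unfolding norm_sq_vec sum_option by simp
    ultimately show "p \<in> cball 0 (sqrt (c + 1))" by (simp add: real_le_rsqrt)
  qed
  moreover have "closed {p \<in> H. exhaustion p \<le> c}"
  proof -
    let ?S = "{p. rho p \<le> 1 - 1 / c} \<inter> {p :: complex^('n option). c > 0}"
    have SH: "?S \<subseteq> H"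
    proof
      fix p assume "p \<in> ?S"
      then have "rho p \<le> 1 - 1 / c" "1 / c > 0" by (simp_all split: if_splits)
      then show "p \<in> H" unfolding H_eq hartogs_def mem_Collect_eq by linarith
    qed
    have "{p \<in> H. exhaustion p \<le> c} \<subseteq> ?S"
    proof
      fix p assume p: "p \<in> {p \<in> H. exhaustion p \<le> c}"
      then have r: "1 - rho p > 0" and e: "1 / (1 - rho p) \<le> c" using le(1) rho_bounds(2)[of p] by auto
      have "c > 0" by (rule less_le_trans[OF _ e]) (use r in simp)
      then show "p \<in> ?S" using e r by (simp add: field_simps)
    qed
    then have "{p \<in> H. exhaustion p \<le> c} = ?S \<inter> exhaustion -` {..c}" using SH by auto
    moreover have "closed ?S"
      by (intro closed_Int closed_Collect_le continuous_intros continuous_on_rho) simp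
    ultimately show ?thesis
      using continuous_closed_preimage[OF continuous_on_subset[OF continuous_exhaustion SH]] by simp
  qed
  ultimately show ?thesis by (meson bounded_cball bounded_subset compact_eq_bounded_closed)
qed

lemma pseudoconvex_H: "pseudoconvex_domain H"
  unfolding pseudoconvex_domain_def
proof (intro conjI)
  have 0: "0 \<in> H" by (simp add: H_eq zero_in_hartogs)
  then show "H \<noteq> {}" by blast
  have "starlike H"
    unfolding starlike_def
  proof (intro bexI[of _ 0] ballI subsetI)
    fix p q assume p: "p \<in> H" and "q \<in> closed_segment 0 p"
    then obtain u where u: "0 \<le> u" "u \<le> 1" "q = u *\<^sub>R p" by (auto simp: closed_segment_def)
    have "(\<chi> k. of_real u * p $ k) \<in> H"
      using p u unfolding H_eq by (intro hartogs_contract) auto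
    moreover have "(\<chi> k. of_real u * p $ k) = q" using u(3) by (simp add: scaleR_cvec vector_scalar_mult_def)
    ultimately show "q \<in> H" by simp
  qed (rule 0)
  then show "connected H" by (rule starlike_imp_connected)
  show "\<exists>u. continuous_psh_on H u \<and> (\<forall>c. compact {p \<in> H. u p \<le> c})"
    using psh_exhaustion compact_sublevel by blast
qed (rule open_H)

end

section \<open>The theorem\<close>

theorem mainTheorem9:
  fixes D :: "(complex^('n::finite option)) set"
    and \<iota> :: "complex^'n \<Rightarrow> complex^('n option)"
  assumes D: "D = {pt z w | z w. (cmod w)\<^sup>2 < exp (- (norm z)\<^sup>2)}"
    and \<iota>: "\<iota> = (\<lambda>z. pt z 0)"
  shows "pseudoconvex_domain D \<and>
    riemannian_metric_on D (metric_of_form (bergman_form D)) \<and>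
    holomorphic_embedding D \<iota> \<and>
    pullback_form \<iota> (bergman_form D) = eucl_form \<and>
    complex_submanifold D CARD('n) (range \<iota>) \<and>
    (\<forall>X Y. smooth_on UNIV X \<longrightarrow> smooth_on UNIV Y \<longrightarrow>
       (\<forall>z. second_fundamental_form (metric_of_form (bergman_form D)) \<iota> X Y z = 0))"
proof -
  have "D = hartogs"
  proof (intro set_eqI iffI)
    fix p assume "p \<in> D"
    then obtain z w where "p = pt z w" "(cmod w)\<^sup>2 < exp (- (norm z)\<^sup>2)" unfolding D by blast
    then show "p \<in> hartogs" by (simp add: hartogs_def rho_def exp_minus field_simps)
  next
    fix p assume "p \<in> (hartogs :: (complex^('n option)) set)"
    then have "(cmod (p $ None))\<^sup>2 < exp (- (norm (zpart p))\<^sup>2)"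
      by (simp add: hartogs_def rho_def exp_minus field_simps)
    then show "p \<in> D" unfolding D using pt_zpart[of p] by (metis (mono_tags, lifting) mem_Collect_eq)
  qed
  then interpret hartogs_space D by unfold_locales
  show ?thesis
    unfolding \<iota> using pseudoconvex_H riemannian_metric_bmetric holomorphic_embedding_axis
      pullback_bergman_form complex_submanifold_axis second_fundamental_form_zero by blast
qed

end
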